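(* (In $\mathsf{ZF}$.) Let $X$ be an arbitrary set. Then the following four statements are equivalent: (1) $X$ is $\mathrm{H}^{\mathrm{D}}$-finite; (2) $[X]^{<\omega}$ is D-finite; (3) $X$ is $\mathrm{H}^{\mathrm{D}}_2$-finite; (4) $X$ is $\mathrm{H}^{\mathrm{B}}_4$-finite.
   Context: Work in $\mathsf{ZF}$, without the Axiom of Choice. A set is finite if it is in bijection with some $n\in\omega$, and infinite otherwise. A set is D-finite (Dedekind-finite) if it is not in bijection with any of its proper subsets. $[X]^{<\omega}$ is the set of all finite subsets of $X$; it is a group (the Boolean group on $X$) under symmetric difference $\bigtriangleup$, and sums of finitely many of its elements are computed in this group. For $Y\subseteq[X]^{<\omega}$ and $n<\omega$, $\mathrm{FS}(Y)=\{\sum_{y\in F}y : F\subseteq Y \text{ finite nonempty}\}$ and $\mathrm{FS}_{\leq n}(Y)=\{\sum_{y\in F}y : F\subseteq Y,\ 0<|F|\leq n\}$. When $Y$ consists of pairwise disjoint sets, sums coincide with unions, and one writes $\mathrm{FU}(Y)$, $\mathrm{FU}_{\leq n}(Y)$ for $\mathrm{FS}(Y)$, $\mathrm{FS}_{\leq n}(Y)$. Given $c:[X]^{<\omega}\to 2=\{0,1\}$, a subset of $[X]^{<\omega}$ is monochromatic if $c$ is constant on it. A set $X$ is $\mathrm{H}^{\mathrm{B}}_n$-finite if there is a colouring $c:[X]^{<\omega}\to 2$ such that for every infinite $Y\subseteq[X]^{<\omega}$ the set $\mathrm{FS}_{\leq n}(Y)$ is not monochromatic. $X$ is $\mathrm{H}^{\mathrm{D}}_n$-finite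 if there is a colouring $c:[X]^{<\omega}\to 2$ such that for every infinite $Y\subseteq[X]^{<\omega}$ consisting of pairwise disjoint elements the set $\mathrm{FU}_{\leq n}(Y)$ is not monochromatic. $X$ is $\mathrm{H}^{\mathrm{D}}$-finite if there is a colouring $c:[X]^{<\omega}\to 2$ such that for every infinite $Y\subseteq[X]^{<\omega}$ consisting of pairwise disjoint elements the set $\mathrm{FU}(Y)$ is not monochromatic. *)

theory Defs
  imports Main
begin

text \<open>
  HOL has a choice operator, under which all the notions below would collapse to
  finiteness if they were stated for HOL sets.  Derivability in ZF is therefore rendered
  (using the completeness theorem) as truth in every first-order model of ZF.  The
  membership relation of a model is an arbitrary relation on an arbitrary type; it need
  not be well-founded, and the natural numbers of the model may be nonstandard.
  Separation and Replacement are restricted to first-order formulas with parameters.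
  This restriction is essential: for arbitrary HOL predicates they would make the model
  satisfy the Axiom of Choice.
\<close>

text \<open>Formulas in the language of set theory, with de Bruijn indices.\<close>

datatype fm = Mem nat nat | Eq nat nat | Neg fm | Conj fm fm | All fm

primrec sat :: "('a \<Rightarrow> 'a \<Rightarrow> bool) \<Rightarrow> fm \<Rightarrow> (nat \<Rightarrow> 'a) \<Rightarrow> bool" where
  "sat E (Mem i j) s \<longleftrightarrow> E (s i) (s j)"
| "sat E (Eq i j) s \<longleftrightarrow> s i = s j"
| "sat E (Neg p) s \<longleftrightarrow> \<not> sat E p s"
| "sat E (Conj p q) s \<longleftrightarrow> sat E p s \<and> sat E q s"
| "sat E (All p) s \<longleftrightarrow> (\<forall>x. sat E p (case_nat x s))"

text \<open>
  The set-theoretic notions are those of the structure: every object, including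
  functions, colourings and natural numbers, is an element of the structure, and all
  quantifiers range over such elements.
\<close>

locale membership =
  fixes mem :: "'a \<Rightarrow> 'a \<Rightarrow> bool"  (infix "\<epsilon>" 50)
begin

text \<open>
  The set of all \<open>x\<close> with \<open>P x\<close>.  It is applied only where ZF proves that
  this set exists.
\<close>

definition Coll :: "('a \<Rightarrow> bool) \<Rightarrow> 'a" where
  "Coll P = (THE y. \<forall>x. x \<epsilon> y \<longleftrightarrow> P x)"

definition subset :: "'a \<Rightarrow> 'a \<Rightarrow> bool" where
  "subset a b \<longleftrightarrow> (\<forall>x. x \<epsilon> a \<longrightarrow> x \<epsilon> b)"

definition empty :: 'a where
  "empty = Coll (\<lambda>x. False)"

definition succ :: "'a \<Rightarrow> 'a" where
  "succ n = Coll (\<lambda>x. x \<epsilon> n \<or> x = n)"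

definition is_inductive :: "'a \<Rightarrow> bool" where
  "is_inductive I \<longleftrightarrow> empty \<epsilon> I \<and> (\<forall>x. x \<epsilon> I \<longrightarrow> succ x \<epsilon> I)"

definition natural :: "'a \<Rightarrow> bool" where
  "natural n \<longleftrightarrow> (\<forall>I. is_inductive I \<longrightarrow> n \<epsilon> I)"

primrec numeral_set :: "nat \<Rightarrow> 'a" where
  "numeral_set 0 = empty"
| "numeral_set (Suc k) = succ (numeral_set k)"

definition upair :: "'a \<Rightarrow> 'a \<Rightarrow> 'a" where
  "upair a b = Coll (\<lambda>x. x = a \<or> x = b)"

definition opair :: "'a \<Rightarrow> 'a \<Rightarrow> 'a" where
  "opair a b = upair (upair a a) (upair a b)"

definition func :: "'a \<Rightarrow> 'a \<Rightarrow> 'a \<Rightarrow> bool" where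
  "func f A B \<longleftrightarrow>
     (\<forall>p. p \<epsilon> f \<longrightarrow> (\<exists>x y. x \<epsilon> A \<and> y \<epsilon> B \<and> p = opair x y)) \<and>
     (\<forall>x. x \<epsilon> A \<longrightarrow> (\<exists>!y. opair x y \<epsilon> f))"

definition app :: "'a \<Rightarrow> 'a \<Rightarrow> 'a" where
  "app f x = (THE y. opair x y \<epsilon> f)"

definition bijection :: "'a \<Rightarrow> 'a \<Rightarrow> 'a \<Rightarrow> bool" where
  "bijection f A B \<longleftrightarrow>
     func f A B \<and> (\<forall>y. y \<epsilon> B \<longrightarrow> (\<exists>!x. x \<epsilon> A \<and> app f x = y))"

definition equipotent :: "'a \<Rightarrow> 'a \<Rightarrow> bool" where
  "equipotent A B \<longleftrightarrow> (\<exists>f. bijection f A B)"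

definition set_finite :: "'a \<Rightarrow> bool" where
  "set_finite A \<longleftrightarrow> (\<exists>n. natural n \<and> equipotent A n)"

definition D_finite :: "'a \<Rightarrow> bool" where
  "D_finite A \<longleftrightarrow> \<not> (\<exists>B. subset B A \<and> B \<noteq> A \<and> equipotent A B)"

definition card_le :: "'a \<Rightarrow> 'a \<Rightarrow> bool" where
  "card_le A n \<longleftrightarrow> (\<exists>m. natural m \<and> (m \<epsilon> n \<or> m = n) \<and> equipotent A m)"

definition Fin :: "'a \<Rightarrow> 'a" where
  "Fin X = Coll (\<lambda>x. subset x X \<and> set_finite x)"

definition symdiff :: "'a \<Rightarrow> 'a \<Rightarrow> 'a" where
  "symdiff u v = Coll (\<lambda>x. (x \<epsilon> u \<and> \<not> x \<epsilon> v) \<or> (x \<epsilon> v \<and> \<not> x \<epsilon> u))"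

text \<open>
  \<open>z\<close> is the sum of the finite set \<open>F\<close> in the Boolean group on \<open>X\<close>:
  \<open>f\<close> enumerates \<open>F\<close> and \<open>g\<close> is the sequence of partial sums.
  The value does not depend on the enumeration, since the group is abelian.
\<close>

definition is_sum :: "'a \<Rightarrow> 'a \<Rightarrow> 'a \<Rightarrow> bool" where
  "is_sum X F z \<longleftrightarrow>
     (\<exists>n f g. natural n \<and> bijection f n F \<and> func g (succ n) (Fin X) \<and>
        app g empty = empty \<and>
        (\<forall>i. i \<epsilon> n \<longrightarrow> app g (succ i) = symdiff (app g i) (app f i)) \<and>
        app g n = z)"

definition FS :: "'a \<Rightarrow> 'a \<Rightarrow> 'a" where
  "FS X Y = Coll (\<lambda>z. \<exists>F. subset F Y \<and> set_finite F \<and> F \<noteq> empty \<and> is_sum X F z)"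

definition FS_le :: "'a \<Rightarrow> 'a \<Rightarrow> 'a \<Rightarrow> 'a" where
  "FS_le n X Y = Coll (\<lambda>z. \<exists>F. subset F Y \<and> card_le F n \<and> F \<noteq> empty \<and> is_sum X F z)"

definition pairwise_disjoint :: "'a \<Rightarrow> bool" where
  "pairwise_disjoint Y \<longleftrightarrow>
     (\<forall>u v. u \<epsilon> Y \<and> v \<epsilon> Y \<and> u \<noteq> v \<longrightarrow> \<not> (\<exists>x. x \<epsilon> u \<and> x \<epsilon> v))"

definition coloring :: "'a \<Rightarrow> 'a \<Rightarrow> bool" where
  "coloring X c \<longleftrightarrow> func c (Fin X) (numeral_set 2)"

definition monochromatic :: "'a \<Rightarrow> 'a \<Rightarrow> bool" where
  "monochromatic c A \<longleftrightarrow> (\<forall>u v. u \<epsilon> A \<and> v \<epsilon> A \<longrightarrow> app c u = app c v)"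

definition HB_n_finite :: "'a \<Rightarrow> 'a \<Rightarrow> bool" where
  "HB_n_finite n X \<longleftrightarrow>
     (\<exists>c. coloring X c \<and>
        (\<forall>Y. subset Y (Fin X) \<and> \<not> set_finite Y \<longrightarrow> \<not> monochromatic c (FS_le n X Y)))"

text \<open>
  For pairwise disjoint \<open>Y\<close>, FU is by definition the same set as FS.
\<close>

definition HD_n_finite :: "'a \<Rightarrow> 'a \<Rightarrow> bool" where
  "HD_n_finite n X \<longleftrightarrow>
     (\<exists>c. coloring X c \<and>
        (\<forall>Y. subset Y (Fin X) \<and> \<not> set_finite Y \<and> pairwise_disjoint Y \<longrightarrow>
           \<not> monochromatic c (FS_le n X Y)))"

definition HD_finite :: "'a \<Rightarrow> bool" where
  "HD_finite X \<longleftrightarrow>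
     (\<exists>c. coloring X c \<and>
        (\<forall>Y. subset Y (Fin X) \<and> \<not> set_finite Y \<and> pairwise_disjoint Y \<longrightarrow>
           \<not> monochromatic c (FS X Y)))"

end

locale ZF_model = membership mem for mem :: "'a \<Rightarrow> 'a \<Rightarrow> bool"  (infix "\<epsilon>" 50) +
  assumes extensionality: "\<forall>x. x \<epsilon> a \<longleftrightarrow> x \<epsilon> b \<Longrightarrow> a = b"
    and foundation: "x \<epsilon> a \<Longrightarrow> \<exists>y. y \<epsilon> a \<and> \<not> (\<exists>z. z \<epsilon> a \<and> z \<epsilon> y)"
    and pairing: "\<exists>c. \<forall>x. x \<epsilon> c \<longleftrightarrow> x = a \<or> x = b"
    and union: "\<exists>u. \<forall>x. x \<epsilon> u \<longleftrightarrow> (\<exists>y. x \<epsilon> y \<and> y \<epsilon> a)"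
    and power_set: "\<exists>p. \<forall>x. x \<epsilon> p \<longleftrightarrow> (\<forall>y. y \<epsilon> x \<longrightarrow> y \<epsilon> a)"
    and infinity:
      "\<exists>I. (\<exists>e. e \<epsilon> I \<and> (\<forall>x. \<not> x \<epsilon> e)) \<and>
           (\<forall>x. x \<epsilon> I \<longrightarrow> (\<exists>y. y \<epsilon> I \<and> (\<forall>z. z \<epsilon> y \<longleftrightarrow> z \<epsilon> x \<or> z = x)))"
    and separation: "\<exists>b. \<forall>x. x \<epsilon> b \<longleftrightarrow> x \<epsilon> a \<and> sat mem p (case_nat x s)"
    and replacement:
      "\<forall>x. x \<epsilon> a \<longrightarrow> (\<exists>!y. sat mem p (case_nat x (case_nat y s))) \<Longrightarrow>
       \<exists>b. \<forall>y. y \<epsilon> b \<longleftrightarrow> (\<exists>x. x \<epsilon> a \<and> sat mem p (case_nat x (case_nat y s)))"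

end

theory Submission
  imports Defs
begin

text \<open>
  All notions live inside an arbitrary model of ZF. Sets of the model come from Separation, so every
  predicate used to form one has to be definable by a first-order formula; closure
  rules for definable predicates (\<open>definable\<close>, \<open>definable_separation\<close>) reduce this to routine. Finite sets
  of the model are handled by induction (\<open>finite_induct\<close>), and recursion along its natural numbers is
  replaced by towers (\<open>inflationary_tower\<close>).

  The pivot is a combinatorial form of Dedekind-infiniteness: \<open>Fin X\<close> is D-infinite if and only if
  there is an endless chain, a family of finite subsets of \<open>X\<close> that is linearly ordered by inclusion
  and has no largest member (\<open>endless_chain_imp_D_infinite\<close>, \<open>D_infinite_imp_endless_chain\<close>).

  Let \<open>Fin X\<close> be D-finite. Colour a finite set by the parity of the exponent of 2 in its number of
  elements, so that doubling the size changes the colour (\<open>alternating_coloring\<close>). An infinite family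
  \<open>Y\<close> of finite sets has infinitely many members of one size, since otherwise the unions
  of its members of bounded size form an endless chain (\<open>infinite_class\<close>). If \<open>Y\<close> is pairwise
  disjoint, two members \<open>u\<close>, \<open>v\<close> of equal size show that \<open>u\<close> and the sum of \<open>u\<close> and \<open>v\<close> have different
  colours. In general, four members of equal size can be found that pairwise meet in the same
  kernel \<open>K\<close> (\<open>sunflower_kernel\<close>). With \<open>m\<close> the number of elements of each outside \<open>K\<close>, the sum of two
  of them has \<open>2m\<close> elements and the sum of all four has \<open>4m\<close>.

  Let \<open>Fin X\<close> be D-infinite. An endless chain splits its union into finite blocks, and for any
  colouring the theorem of Hindman for unions of blocks yields infinitely many disjoint sets all of
  whose finite unions have one colour; this refutes the three other properties at once. The
  proof of Hindman is that of Baumgartner, arranged so as to avoid choice. Unions of blocks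
  can be selected because they carry a definable well-order (\<open>block_family\<close>), although the points of a block cannot.
  The nested families of that proof are never selected: only the statement that a
  set is large for some family is carried along, and this notion is partition regular
  (\<open>some_large_finite_split\<close>).
\<close>

section \<open>First-order definability\<close>

text \<open>
  Renaming variables merges the parameters of several formulas and lets a quantifier bind any chosen
  variable.
\<close>

primrec rename_fm :: "(nat \<Rightarrow> nat) \<Rightarrow> fm \<Rightarrow> fm" where
  "rename_fm r (Mem i j) = Mem (r i) (r j)"
| "rename_fm r (Eq i j) = Eq (r i) (r j)"
| "rename_fm r (Neg p) = Neg (rename_fm r p)"
| "rename_fm r (Conj p q) = Conj (rename_fm r p) (rename_fm r q)"
| "rename_fm r (All p) = All (rename_fm (case_nat 0 (\<lambda>i. Suc (r i))) p)"

lemma sat_rename_fm: "sat E (rename_fm r p) s \<longleftrightarrow> sat E p (\<lambda>i. s (r i))"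
proof (induction p arbitrary: r s)
  case (All p)
  have "(\<lambda>i. case_nat x s (case_nat 0 (\<lambda>i. Suc (r i)) i)) = case_nat x (\<lambda>i. s (r i))" for x
    by (auto split: nat.splits)
  then show ?case by (simp add: All)
qed auto

context membership
begin

text \<open>
  Separation in the model applies to formulas only. A predicate of environments is definable if a
  formula with parameters defines it: \<open>\<sigma>\<close> reads each variable of the formula either as a
  slot of the environment or as a fixed element of the model. Since \<open>\<sigma>\<close> is part of the
  existential, predicates with arbitrary elements of the model as parameters are covered, and
  formulas never appear explicitly after the closure rules below.
\<close>

definition definable :: "((nat \<Rightarrow> 'a) \<Rightarrow> bool) \<Rightarrow> bool" where
  "definable P \<longleftrightarrow> (\<exists>p \<sigma>. \<forall>s. P s \<longleftrightarrow> sat mem p (\<lambda>i. case \<sigma> i of Inl j \<Rightarrow> s j | Inr a \<Rightarrow> a))"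

text \<open>
  A function of environments is handled through its graph, with slot 0 for the value.
\<close>

definition def_fun :: "((nat \<Rightarrow> 'a) \<Rightarrow> 'a) \<Rightarrow> bool" where
  "def_fun f \<longleftrightarrow> definable (\<lambda>s. s 0 = f (\<lambda>i. s (Suc i)))"

named_theorems def_intros

lemma definableI: "(\<And>s. P s \<longleftrightarrow> sat mem p (\<lambda>i. case \<sigma> i of Inl j \<Rightarrow> s j | Inr a \<Rightarrow> a)) \<Longrightarrow> definable P"
  unfolding definable_def by blast

lemma definable_mem_var: "definable (\<lambda>s. s i \<epsilon> s j)"
  by (rule definableI[where p = "Mem i j" and \<sigma> = Inl]) simp

lemma definable_eq_var: "definable (\<lambda>s. s i = s j)"
  by (rule definableI[where p = "Eq i j" and \<sigma> = Inl]) simp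

lemma definable_eq_const: "definable (\<lambda>s. s i = a)"
  by (rule definableI[where p = "Eq 0 1" and \<sigma> = "\<lambda>k. if k = 0 then Inl i else Inr a"]) simp

lemma definable_not [def_intros]: "definable P \<Longrightarrow> definable (\<lambda>s. \<not> P s)"
  unfolding definable_def by (metis sat.simps(3))

text \<open>
  Even and odd variables keep the parameters of the two formulas apart.
\<close>

lemma definable_and [def_intros]:
  assumes "definable P" and "definable Q"
  shows "definable (\<lambda>s. P s \<and> Q s)"
proof -
  obtain p \<sigma> where p: "\<And>s. P s \<longleftrightarrow> sat mem p (\<lambda>i. case \<sigma> i of Inl j \<Rightarrow> s j | Inr a \<Rightarrow> a)"
    using assms(1) unfolding definable_def by blast
  obtain q \<tau> where q: "\<And>s. Q s \<longleftrightarrow> sat mem q (\<lambda>i. case \<tau> i of Inl j \<Rightarrow> s j | Inr a \<Rightarrow> a)"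
    using assms(2) unfolding definable_def by blast
  show ?thesis
    by (rule definableI[where p = "Conj (rename_fm (\<lambda>i. 2 * i) p) (rename_fm (\<lambda>i. 2 * i + 1) q)"
          and \<sigma> = "\<lambda>i. if even i then \<sigma> (i div 2) else \<tau> (i div 2)"])
      (simp add: sat_rename_fm p q)
qed

text \<open>
  The variables that denote slot 0 become the bound variable 0; the others, parameters included, move
  up by one.
\<close>

lemma definable_all [def_intros]:
  assumes "definable (\<lambda>s. P (s 0) (\<lambda>i. s (Suc i)))"
  shows "definable (\<lambda>s. \<forall>x. P x s)"
proof -
  obtain p \<sigma> where p: "\<And>s. P (s 0) (\<lambda>i. s (Suc i)) \<longleftrightarrow>
      sat mem p (\<lambda>i. case \<sigma> i of Inl j \<Rightarrow> s j | Inr a \<Rightarrow> a)"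
    using assms unfolding definable_def by blast
  let ?r = "\<lambda>i. if \<sigma> i = Inl 0 then 0 else Suc i"
  let ?\<tau> = "\<lambda>i. case \<sigma> i of Inl j \<Rightarrow> Inl (j - 1) | Inr a \<Rightarrow> Inr a"
  have "P x s \<longleftrightarrow> sat mem (rename_fm ?r p) (case_nat x (\<lambda>i. case ?\<tau> i of Inl j \<Rightarrow> s j | Inr a \<Rightarrow> a))" for x s
  proof -
    have "(\<lambda>i. case \<sigma> i of Inl j \<Rightarrow> case_nat x s j | Inr a \<Rightarrow> a) =
        (\<lambda>i. case_nat x (\<lambda>i. case ?\<tau> i of Inl j \<Rightarrow> s j | Inr a \<Rightarrow> a) (?r i))"
      by (rule ext) (auto split: sum.splits nat.splits)
    then show ?thesis using p[of "case_nat x s"] by (simp add: sat_rename_fm)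
  qed
  then show ?thesis by (intro definableI[where p = "All (rename_fm ?r p)" and \<sigma> = ?\<tau>]) simp
qed

lemma definable_rename:
  assumes "definable P" shows "definable (\<lambda>s. P (\<lambda>i. s (r i)))"
proof -
  obtain p \<sigma> where p: "\<And>s. P s \<longleftrightarrow> sat mem p (\<lambda>i. case \<sigma> i of Inl j \<Rightarrow> s j | Inr a \<Rightarrow> a)"
    using assms(1) unfolding definable_def by blast
  have "(\<lambda>i. case (case \<sigma> i of Inl j \<Rightarrow> Inl (r j) | Inr a \<Rightarrow> Inr a) of Inl j \<Rightarrow> s j | Inr a \<Rightarrow> a)
      = (\<lambda>i. case \<sigma> i of Inl j \<Rightarrow> s (r j) | Inr a \<Rightarrow> a)" for s :: "nat \<Rightarrow> 'a"
    by (auto split: sum.splits)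
  then show ?thesis
    by (intro definableI[where p = p and \<sigma> = "\<lambda>i. case \<sigma> i of Inl j \<Rightarrow> Inl (r j) | Inr a \<Rightarrow> Inr a"])
      (simp add: p)
qed

lemma definable_or [def_intros]: assumes "definable P" and "definable Q" shows "definable (\<lambda>s. P s \<or> Q s)"
proof -
  have "definable (\<lambda>s. \<not> (\<not> P s \<and> \<not> Q s))" by (intro definable_not definable_and assms)
  then show ?thesis by simp
qed

lemma definable_imp [def_intros]: assumes "definable P" and "definable Q" shows "definable (\<lambda>s. P s \<longrightarrow> Q s)"
  unfolding imp_conv_disj by (intro definable_not definable_or assms)

lemma definable_iff [def_intros]: assumes "definable P" and "definable Q" shows "definable (\<lambda>s. P s \<longleftrightarrow> Q s)"
  unfolding iff_conv_conj_imp by (intro definable_imp definable_and assms)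

lemma definable_ex [def_intros]:
  assumes "definable (\<lambda>s. P (s 0) (\<lambda>i. s (Suc i)))"
  shows "definable (\<lambda>s. \<exists>x. P x s)"
proof -
  have "definable (\<lambda>s. \<not> (\<forall>x. \<not> P x s))" by (intro definable_not definable_all assms)
  then show ?thesis by simp
qed

lemma definable_const [def_intros]: "definable (\<lambda>s. b)"
proof -
  have "definable (\<lambda>s. s 0 = s 0)" "definable (\<lambda>s. \<not> s 0 = s 0)"
    by (rule definable_eq_var, rule definable_not, rule definable_eq_var)
  then show ?thesis by (cases b) simp_all
qed

text \<open>
  A complex term is eliminated by giving its value a name with an existential quantifier.
\<close>

lemma definable_subst:
  assumes "definable (\<lambda>s. P (s 0) (\<lambda>i. s (Suc i)))" and "def_fun f"
  shows "definable (\<lambda>s. P (f s) s)"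
proof -
  have "definable (\<lambda>s. \<exists>y. y = f s \<and> P y s)"
    using assms unfolding def_fun_def by (intro definable_ex definable_and)
  then show ?thesis by simp
qed

lemma def_fun_var [def_intros]: "def_fun (\<lambda>s. s i)"
  unfolding def_fun_def by (rule definable_eq_var)

lemma def_fun_const [def_intros]: "def_fun (\<lambda>s. a)"
  unfolding def_fun_def by (rule definable_eq_const)

lemma def_fun_shift: assumes "def_fun f" shows "def_fun (\<lambda>s. f (\<lambda>i. s (Suc i)))"
  using definable_rename[OF assms[unfolded def_fun_def], of "case_nat 0 (\<lambda>i. Suc (Suc i))"]
  unfolding def_fun_def by simp

lemma def_subst1: assumes "definable (\<lambda>s. R (s 0))" and "def_fun f" shows "definable (\<lambda>s. R (f s))"
  by (rule definable_subst[where P = "\<lambda>y s. R y", OF assms])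

lemma def_subst2:
  assumes R: "definable (\<lambda>s. R (s 0) (s 1))" and f: "def_fun f" and g: "def_fun g"
  shows "definable (\<lambda>s. R (f s) (g s))"
proof (rule definable_subst[where P = "\<lambda>y s. R y (g s)", OF _ f])
  show "definable (\<lambda>s. R (s 0) (g (\<lambda>i. s (Suc i))))"
    by (rule definable_subst[where P = "\<lambda>y s. R (s 0) y", OF _ def_fun_shift[OF g]])
      (use definable_rename[OF R, of "\<lambda>i. if i = 0 then 1 else 0"] in simp)
qed

lemma def_subst3:
  assumes R: "definable (\<lambda>s. R (s 0) (s 1) (s 2))" and f: "def_fun f" and g: "def_fun g" and h: "def_fun h"
  shows "definable (\<lambda>s. R (f s) (g s) (h s))"
proof (rule definable_subst[where P = "\<lambda>y s. R y (g s) (h s)", OF _ f])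
  show "definable (\<lambda>s. R (s 0) (g (\<lambda>i. s (Suc i))) (h (\<lambda>i. s (Suc i))))"
  proof (rule definable_subst[where P = "\<lambda>y s. R (s 0) y (h (\<lambda>i. s (Suc i)))", OF _ def_fun_shift[OF g]])
    show "definable (\<lambda>s. R (s (Suc 0)) (s 0) (h (\<lambda>i. s (Suc (Suc i)))))"
      by (rule definable_subst[where P = "\<lambda>y s. R (s (Suc 0)) (s 0) y", OF _ def_fun_shift[OF def_fun_shift[OF h]]])
      (use definable_rename[OF R, of "\<lambda>i. if i = 0 then 2 else if i = 1 then 1 else 0"] in \<open>simp add: numeral_2_eq_2\<close>)
  qed
qed

lemma definable_mem [def_intros]: "def_fun f \<Longrightarrow> def_fun g \<Longrightarrow> definable (\<lambda>s. f s \<epsilon> g s)"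
  by (rule def_subst2[where R = mem, OF definable_mem_var])

lemma definable_eq [def_intros]: "def_fun f \<Longrightarrow> def_fun g \<Longrightarrow> definable (\<lambda>s. f s = g s)"
  by (rule def_subst2[where R = "(=)", OF definable_eq_var])

lemma definable_ex1 [def_intros]:
  "definable (\<lambda>s. \<exists>x. P x s \<and> (\<forall>y. P y s \<longrightarrow> y = x)) \<Longrightarrow> definable (\<lambda>s. \<exists>!x. P x s)"
  unfolding Ex1_def by assumption

lemma Coll_unique: "(\<And>x. x \<epsilon> y \<longleftrightarrow> P x) \<Longrightarrow> (\<And>z. (\<forall>x. x \<epsilon> z \<longleftrightarrow> P x) \<Longrightarrow> z = y) \<Longrightarrow> Coll P = y"
  unfolding Coll_def by (rule the_equality) auto

end

section \<open>Basic sets of the model\<close>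

context ZF_model
begin

lemma ext_eq: "(\<And>x. x \<epsilon> a \<longleftrightarrow> x \<epsilon> b) \<Longrightarrow> a = b"
  using extensionality by blast

lemma Coll_eq: "(\<And>x. x \<epsilon> y \<longleftrightarrow> P x) \<Longrightarrow> Coll P = y"
  by (rule Coll_unique) (auto intro: ext_eq)

lemma mem_Coll: "\<exists>y. \<forall>x. x \<epsilon> y \<longleftrightarrow> P x \<Longrightarrow> x \<epsilon> Coll P \<longleftrightarrow> P x"
  using Coll_eq by metis

text \<open>
  The existence hypothesis is essential: \<open>Coll\<close> is a definite description, and where no
  set exists its value may depend on the predicate itself rather than on the model.
\<close>

lemma def_fun_Coll:
  assumes ex: "\<And>s. \<exists>y. \<forall>x. x \<epsilon> y \<longleftrightarrow> P x s" and P: "definable (\<lambda>s. P (s 0) (\<lambda>i. s (Suc i)))"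
  shows "def_fun (\<lambda>s. Coll (\<lambda>x. P x s))"
proof -
  have "y = Coll (\<lambda>x. P x s) \<longleftrightarrow> (\<forall>x. x \<epsilon> y \<longleftrightarrow> P x s)" for y s
    using mem_Coll[OF ex] by (auto intro: ext_eq)
  moreover have "definable (\<lambda>s. \<forall>x. x \<epsilon> s 0 \<longleftrightarrow> P x (\<lambda>i. s (Suc i)))"
    by (intro def_intros)
      (use definable_rename[OF P, of "\<lambda>i. if i = 0 then 0 else Suc i"] in simp)
  ultimately show ?thesis unfolding def_fun_def by simp
qed

lemma definable_separation:
  assumes "definable (\<lambda>s. P (s 0))"
  shows "\<exists>b. \<forall>x. x \<epsilon> b \<longleftrightarrow> x \<epsilon> a \<and> P x"
proof -
  obtain p \<sigma> where p: "\<And>s :: nat \<Rightarrow> 'a. P (s 0) \<longleftrightarrow> sat mem p (\<lambda>i. case \<sigma> i of Inl j \<Rightarrow> s j | Inr a \<Rightarrow> a)"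
    using assms unfolding definable_def by blast
  let ?r = "\<lambda>i. case \<sigma> i of Inl j \<Rightarrow> 0 | Inr a \<Rightarrow> Suc i"
  let ?t = "\<lambda>i. case \<sigma> i of Inl j \<Rightarrow> a | Inr a \<Rightarrow> a"
  have "P x \<longleftrightarrow> sat mem (rename_fm ?r p) (case_nat x ?t)" for x
  proof -
    have "(\<lambda>i. case \<sigma> i of Inl j \<Rightarrow> x | Inr a \<Rightarrow> a) = (\<lambda>i. case_nat x ?t (?r i))"
      by (rule ext) (auto split: sum.splits)
    then show ?thesis using p[of "\<lambda>_. x"] by (simp add: sat_rename_fm)
  qed
  then show ?thesis using separation[of a "rename_fm ?r p" ?t] by simp
qed

lemma definable_setE:
  assumes "\<And>b. (\<And>x. x \<epsilon> b \<longleftrightarrow> x \<epsilon> a \<and> P x) \<Longrightarrow> thesis" and "definable (\<lambda>s. P (s 0))"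
  shows thesis
  using definable_separation[OF assms(2), of a] assms(1) by blast

lemma definable_comprehension:
  assumes "definable (\<lambda>s. P (s 0))" and "\<And>x. P x \<Longrightarrow> x \<epsilon> a"
  shows "\<exists>b. \<forall>x. x \<epsilon> b \<longleftrightarrow> P x"
  using definable_separation[OF assms(1), of a] assms(2) by blast

lemma mem_empty [simp]: "\<not> x \<epsilon> empty"
  using mem_Coll[of "\<lambda>x. False"] definable_separation[OF definable_const[of False]] by (simp add: empty_def)

lemma mem_upair [simp]: "x \<epsilon> upair a b \<longleftrightarrow> x = a \<or> x = b"
  unfolding upair_def using pairing by (intro mem_Coll) auto

text \<open>
  The primitive operations of the model, all of them total, so that they may occur in definable
  terms without side conditions.
\<close>

definition cup :: "'a \<Rightarrow> 'a \<Rightarrow> 'a" where "cup a b = Coll (\<lambda>x. x \<epsilon> a \<or> x \<epsilon> b)"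
definition Cup :: "'a \<Rightarrow> 'a" where "Cup a = Coll (\<lambda>x. \<exists>y. x \<epsilon> y \<and> y \<epsilon> a)"
definition Power :: "'a \<Rightarrow> 'a" where "Power a = Coll (\<lambda>x. \<forall>y. y \<epsilon> x \<longrightarrow> y \<epsilon> a)"
definition ins :: "'a \<Rightarrow> 'a \<Rightarrow> 'a" where "ins x a = Coll (\<lambda>y. y \<epsilon> a \<or> y = x)"
definition diff :: "'a \<Rightarrow> 'a \<Rightarrow> 'a" where "diff a b = Coll (\<lambda>x. x \<epsilon> a \<and> \<not> x \<epsilon> b)"

lemma cup_ex: "\<exists>y. \<forall>x. x \<epsilon> y \<longleftrightarrow> x \<epsilon> a \<or> x \<epsilon> b"
  using union[of "upair a b"] by auto

lemma Cup_ex: "\<exists>u. \<forall>x. x \<epsilon> u \<longleftrightarrow> (\<exists>y. x \<epsilon> y \<and> y \<epsilon> a)" by (rule union)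

lemma ins_ex: "\<exists>z. \<forall>y. y \<epsilon> z \<longleftrightarrow> y \<epsilon> a \<or> y = x"
  using cup_ex[of a "upair x x"] by simp

lemma diff_ex: "\<exists>z. \<forall>x. x \<epsilon> z \<longleftrightarrow> x \<epsilon> a \<and> \<not> x \<epsilon> b"
  by (rule definable_separation) (intro def_intros)

lemma symdiff_ex: "\<exists>z. \<forall>x. x \<epsilon> z \<longleftrightarrow> (x \<epsilon> u \<and> \<not> x \<epsilon> v) \<or> (x \<epsilon> v \<and> \<not> x \<epsilon> u)"
  using cup_ex[of "diff u v" "diff v u"] mem_Coll[OF diff_ex] unfolding diff_def by simp

lemma mem_cup [simp]: "x \<epsilon> cup a b \<longleftrightarrow> x \<epsilon> a \<or> x \<epsilon> b"
  unfolding cup_def by (rule mem_Coll[OF cup_ex])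
lemma mem_Cup [simp]: "x \<epsilon> Cup a \<longleftrightarrow> (\<exists>y. x \<epsilon> y \<and> y \<epsilon> a)"
  unfolding Cup_def by (rule mem_Coll[OF union])
lemma mem_Power [simp]: "x \<epsilon> Power a \<longleftrightarrow> subset x a"
  unfolding Power_def subset_def by (rule mem_Coll[OF power_set])
lemma mem_ins [simp]: "y \<epsilon> ins x a \<longleftrightarrow> y \<epsilon> a \<or> y = x"
  unfolding ins_def by (rule mem_Coll[OF ins_ex])
lemma mem_diff [simp]: "x \<epsilon> diff a b \<longleftrightarrow> x \<epsilon> a \<and> \<not> x \<epsilon> b"
  unfolding diff_def by (rule mem_Coll[OF diff_ex])
lemma mem_symdiff [simp]: "x \<epsilon> symdiff u v \<longleftrightarrow> (x \<epsilon> u \<and> \<not> x \<epsilon> v) \<or> (x \<epsilon> v \<and> \<not> x \<epsilon> u)"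
  unfolding symdiff_def by (rule mem_Coll[OF symdiff_ex])
lemma succ_ins: "succ n = ins n n"
  unfolding succ_def ins_def ..

lemma upair_eq: "upair a b = upair c d \<longleftrightarrow> a = c \<and> b = d \<or> a = d \<and> b = c"
proof
  assume "upair a b = upair c d"
  then have "x = a \<or> x = b \<longleftrightarrow> x = c \<or> x = d" for x by (metis mem_upair)
  from this[of a] this[of b] this[of c] this[of d]
  show "a = c \<and> b = d \<or> a = d \<and> b = c" by argo
next
  assume "a = c \<and> b = d \<or> a = d \<and> b = c"
  then show "upair a b = upair c d" by (intro ext_eq) auto
qed

lemma opair_eq [simp]: "opair a b = opair c d \<longleftrightarrow> a = c \<and> b = d"
  unfolding opair_def upair_eq by argo

lemma definable_subset [def_intros]: "def_fun f \<Longrightarrow> def_fun g \<Longrightarrow> definable (\<lambda>s. subset (f s) (g s))"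
proof (rule def_subst2)
  show "definable (\<lambda>s. subset (s 0) (s 1))" unfolding subset_def by (intro def_intros)
qed

lemma def_fun_subst1: assumes "definable (\<lambda>s. s 0 = F (s 1))" "def_fun f" shows "def_fun (\<lambda>s. F (f s))"
  unfolding def_fun_def by (rule def_subst2[OF assms(1) def_fun_var def_fun_shift[OF assms(2)]])

lemma def_fun_subst2: assumes "definable (\<lambda>s. s 0 = F (s 1) (s 2))" "def_fun f" "def_fun g" shows "def_fun (\<lambda>s. F (f s) (g s))"
  unfolding def_fun_def by (rule def_subst3[OF assms(1) def_fun_var def_fun_shift[OF assms(2)] def_fun_shift[OF assms(3)]])

lemma definable_graph2: assumes "def_fun (\<lambda>s. F (s 0) (s 1))" shows "definable (\<lambda>s. s 0 = F (s 1) (s 2))"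
  using assms unfolding def_fun_def by (simp add: numeral_2_eq_2)

lemma definable_graph1: assumes "def_fun (\<lambda>s. F (s 0))" shows "definable (\<lambda>s. s 0 = F (s 1))"
  using assms unfolding def_fun_def by simp

lemma def_fun_cup [def_intros]: "def_fun f \<Longrightarrow> def_fun g \<Longrightarrow> def_fun (\<lambda>s. cup (f s) (g s))"
  by (rule def_fun_subst2, rule definable_graph2, unfold cup_def, rule def_fun_Coll[OF cup_ex], intro def_intros)
lemma def_fun_ins [def_intros]: "def_fun f \<Longrightarrow> def_fun g \<Longrightarrow> def_fun (\<lambda>s. ins (f s) (g s))"
  by (rule def_fun_subst2, rule definable_graph2, unfold ins_def, rule def_fun_Coll[OF ins_ex], intro def_intros)
lemma def_fun_diff [def_intros]: "def_fun f \<Longrightarrow> def_fun g \<Longrightarrow> def_fun (\<lambda>s. diff (f s) (g s))"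
  by (rule def_fun_subst2, rule definable_graph2, unfold diff_def, rule def_fun_Coll[OF diff_ex], intro def_intros)
lemma def_fun_symdiff [def_intros]: "def_fun f \<Longrightarrow> def_fun g \<Longrightarrow> def_fun (\<lambda>s. symdiff (f s) (g s))"
  by (rule def_fun_subst2, rule definable_graph2, unfold symdiff_def, rule def_fun_Coll[OF symdiff_ex], intro def_intros)
lemma def_fun_upair [def_intros]: "def_fun f \<Longrightarrow> def_fun g \<Longrightarrow> def_fun (\<lambda>s. upair (f s) (g s))"
  by (rule def_fun_subst2, rule definable_graph2, unfold upair_def, rule def_fun_Coll[OF pairing], intro def_intros)
lemma def_fun_Cup [def_intros]: "def_fun f \<Longrightarrow> def_fun (\<lambda>s. Cup (f s))"
  by (rule def_fun_subst1, rule definable_graph1, unfold Cup_def, rule def_fun_Coll[OF Cup_ex], intro def_intros)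
lemma def_fun_Power [def_intros]: "def_fun f \<Longrightarrow> def_fun (\<lambda>s. Power (f s))"
  by (rule def_fun_subst1, rule definable_graph1, unfold Power_def, rule def_fun_Coll[OF power_set], intro def_intros)
lemma def_fun_opair [def_intros]: "def_fun f \<Longrightarrow> def_fun g \<Longrightarrow> def_fun (\<lambda>s. opair (f s) (g s))"
  unfolding opair_def by (intro def_intros)
lemma def_fun_succ [def_intros]: "def_fun f \<Longrightarrow> def_fun (\<lambda>s. succ (f s))"
  unfolding succ_ins by (intro def_intros)

section \<open>Relations, functions and equipotence\<close>

abbreviation definable2 :: "('a \<Rightarrow> 'a \<Rightarrow> bool) \<Rightarrow> bool" where
  "definable2 R \<equiv> definable (\<lambda>s. R (s 0) (s 1))"

abbreviation definable1 :: "('a \<Rightarrow> bool) \<Rightarrow> bool" where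
  "definable1 P \<equiv> definable (\<lambda>s. P (s 0))"

lemma app_eq: "func f A B \<Longrightarrow> x \<epsilon> A \<Longrightarrow> app f x = y \<longleftrightarrow> opair x y \<epsilon> f"
  unfolding func_def app_def by (metis (mono_tags, lifting) the1_equality)

lemma func_mem: "func f A B \<Longrightarrow> opair x y \<epsilon> f \<Longrightarrow> x \<epsilon> A \<and> y \<epsilon> B"
  unfolding func_def by (metis opair_eq)

lemma app_mem: "func f A B \<Longrightarrow> x \<epsilon> A \<Longrightarrow> app f x \<epsilon> B"
  using app_eq func_mem by blast

lemma relation_graph:
  assumes R: "definable2 R" and AB: "\<And>x y. R x y \<Longrightarrow> x \<epsilon> A \<and> y \<epsilon> B"
  shows "\<exists>f. \<forall>p. p \<epsilon> f \<longleftrightarrow> (\<exists>x y. p = opair x y \<and> R x y)"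
proof (rule definable_comprehension)
  show "definable (\<lambda>s. \<exists>x y. s 0 = opair x y \<and> R x y)"
    by (intro def_intros def_subst2[OF R])
  show "p \<epsilon> Power (Power (cup A B))" if "\<exists>x y. p = opair x y \<and> R x y" for p
    using that AB by (force simp: opair_def subset_def)
qed

text \<open>
  Bijections as relations on the model. A definable relation can be described directly by a HOL
  term, whereas a function of the model is a set of coded pairs.
\<close>

definition bijrel :: "('a \<Rightarrow> 'a \<Rightarrow> bool) \<Rightarrow> 'a \<Rightarrow> 'a \<Rightarrow> bool" where
  "bijrel R A B \<longleftrightarrow> (\<forall>x y. R x y \<longrightarrow> x \<epsilon> A \<and> y \<epsilon> B) \<and>
     (\<forall>x. x \<epsilon> A \<longrightarrow> (\<exists>y. R x y)) \<and> (\<forall>y. y \<epsilon> B \<longrightarrow> (\<exists>x. R x y)) \<and>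
     (\<forall>x y y'. R x y \<longrightarrow> R x y' \<longrightarrow> y = y') \<and> (\<forall>x x' y. R x y \<longrightarrow> R x' y \<longrightarrow> x = x')"

lemma bijrelI:
  assumes "\<And>x y. R x y \<Longrightarrow> x \<epsilon> A" "\<And>x y. R x y \<Longrightarrow> y \<epsilon> B"
    and "\<And>x. x \<epsilon> A \<Longrightarrow> \<exists>y. R x y" and "\<And>y. y \<epsilon> B \<Longrightarrow> \<exists>x. R x y"
    and "\<And>x y y'. R x y \<Longrightarrow> R x y' \<Longrightarrow> y = y'" and "\<And>x x' y. R x y \<Longrightarrow> R x' y \<Longrightarrow> x = x'"
  shows "bijrel R A B"
  unfolding bijrel_def using assms by blast

lemma bijrel_fun: "bijrel R A B \<Longrightarrow> R x y \<Longrightarrow> R x y' \<Longrightarrow> y = y'"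
  and bijrel_inj: "bijrel R A B \<Longrightarrow> R x y \<Longrightarrow> R x' y \<Longrightarrow> x = x'"
  and bijrel_dom: "bijrel R A B \<Longrightarrow> R x y \<Longrightarrow> x \<epsilon> A"
  and bijrel_ran: "bijrel R A B \<Longrightarrow> R x y \<Longrightarrow> y \<epsilon> B"
  and bijrel_total: "bijrel R A B \<Longrightarrow> x \<epsilon> A \<Longrightarrow> \<exists>y. R x y"
  and bijrel_onto: "bijrel R A B \<Longrightarrow> y \<epsilon> B \<Longrightarrow> \<exists>x. R x y"
  unfolding bijrel_def by blast+

text \<open>
  The bridge from definable relations to functions of the model; all functions constructed below come
  from it.
\<close>

lemma func_from_relation:
  assumes "definable2 R" and "\<And>x y. R x y \<Longrightarrow> x \<epsilon> A \<and> y \<epsilon> B"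
    and "\<And>x. x \<epsilon> A \<Longrightarrow> \<exists>!y. R x y"
  shows "\<exists>f. func f A B \<and> (\<forall>x y. opair x y \<epsilon> f \<longleftrightarrow> R x y)"
proof -
  obtain f where f: "\<And>p. p \<epsilon> f \<longleftrightarrow> (\<exists>x y. p = opair x y \<and> R x y)"
    using relation_graph[OF assms(1,2)] by blast
  then have "opair x y \<epsilon> f \<longleftrightarrow> R x y" for x y by auto
  moreover have "func f A B" unfolding func_def using f assms(2,3) by auto
  ultimately show ?thesis by blast
qed

lemma bijrel_iff:
  assumes "\<And>x y. R x y \<Longrightarrow> x \<epsilon> A \<and> y \<epsilon> B" and "\<And>x. x \<epsilon> A \<Longrightarrow> \<exists>!y. R x y"
  shows "bijrel R A B \<longleftrightarrow> (\<forall>y. y \<epsilon> B \<longrightarrow> (\<exists>!x. R x y))"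
proof
  assume "bijrel R A B"
  then show "\<forall>y. y \<epsilon> B \<longrightarrow> (\<exists>!x. R x y)" unfolding bijrel_def by blast
next
  assume *: "\<forall>y. y \<epsilon> B \<longrightarrow> (\<exists>!x. R x y)"
  show "bijrel R A B" unfolding bijrel_def
  proof (intro conjI allI impI)
    show "y = y'" if "R x y" "R x y'" for x y y' using that assms by blast
    show "x = x'" if "R x y" "R x' y" for x x' y using that assms * by blast
  qed (use assms * in blast)+
qed

lemma bijection_iff: "bijection f A B \<longleftrightarrow> func f A B \<and> bijrel (\<lambda>x y. opair x y \<epsilon> f) A B"
proof -
  have "(\<forall>y. y \<epsilon> B \<longrightarrow> (\<exists>!x. x \<epsilon> A \<and> app f x = y)) \<longleftrightarrow> bijrel (\<lambda>x y. opair x y \<epsilon> f) A B"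
    if f: "func f A B"
  proof -
    have "(x \<epsilon> A \<and> app f x = y) \<longleftrightarrow> opair x y \<epsilon> f" for x y
      using app_eq[OF f] func_mem[OF f] by blast
    moreover have "\<exists>!y. opair x y \<epsilon> f" if "x \<epsilon> A" for x
      using f that by (simp add: func_def)
    ultimately show ?thesis using func_mem[OF f]
      by (subst bijrel_iff[where R = "\<lambda>x y. opair x y \<epsilon> f"]) simp_all
  qed
  then show ?thesis unfolding bijection_def by blast
qed

text \<open>
  Together with the next lemma this allows equipotence to be proved and used with definable relations
  only.
\<close>

lemma equipotentE:
  assumes "equipotent A B" obtains R where "definable2 R" and "bijrel R A B"
proof -
  obtain f where f: "bijrel (\<lambda>x y. opair x y \<epsilon> f) A B"
    using assms unfolding equipotent_def bijection_iff by blast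
  show thesis
    by (rule that[where R = "\<lambda>x y. opair x y \<epsilon> f", OF _ f]) (intro def_intros)
qed

lemma equipotentI: assumes "definable2 R" and R: "bijrel R A B" shows "equipotent A B"
proof -
  obtain f where f: "func f A B" "\<And>x y. opair x y \<epsilon> f \<longleftrightarrow> R x y"
    using func_from_relation[OF assms(1), of A B] R unfolding bijrel_def by metis
  then have "bijection f A B" unfolding bijection_iff using R by simp
  then show ?thesis unfolding equipotent_def by blast
qed

lemma definable_func [def_intros]: "def_fun f \<Longrightarrow> def_fun g \<Longrightarrow> def_fun h \<Longrightarrow> definable (\<lambda>s. func (f s) (g s) (h s))"
  by (rule def_subst3[where R = func]) (unfold func_def, intro def_intros)

lemma definable_bijection [def_intros]: "def_fun f \<Longrightarrow> def_fun g \<Longrightarrow> def_fun h \<Longrightarrow> definable (\<lambda>s. bijection (f s) (g s) (h s))"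
  by (rule def_subst3[where R = bijection]) (unfold bijection_iff bijrel_def, intro def_intros)

lemma definable_equipotent [def_intros]: "def_fun f \<Longrightarrow> def_fun g \<Longrightarrow> definable (\<lambda>s. equipotent (f s) (g s))"
  unfolding equipotent_def by (intro def_intros def_fun_shift)

lemma definable_natural [def_intros]: "def_fun f \<Longrightarrow> definable (\<lambda>s. natural (f s))"
  by (rule def_subst1[where R = natural]) (unfold natural_def is_inductive_def, intro def_intros)

lemma definable_finite [def_intros]: "def_fun f \<Longrightarrow> definable (\<lambda>s. set_finite (f s))"
  unfolding set_finite_def by (intro def_intros def_fun_shift)

lemma equipotent_refl [simp]: "equipotent A A"
  by (rule equipotentI[where R = "\<lambda>x y. x \<epsilon> A \<and> x = y"]) (intro def_intros, auto simp: bijrel_def)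

lemma equipotent_sym: assumes "equipotent A B" shows "equipotent B A"
proof -
  obtain R where R: "definable2 R" "bijrel R A B" by (rule equipotentE[OF assms])
  show ?thesis
    by (rule equipotentI[where R = "\<lambda>x y. R y x"])
      (intro def_subst2[OF R(1)] def_intros, use R(2) in \<open>simp add: bijrel_def\<close>)
qed

lemma equipotent_trans: assumes "equipotent A B" and "equipotent B C" shows "equipotent A C"
proof -
  obtain R where R: "definable2 R" "bijrel R A B" by (rule equipotentE[OF assms(1)])
  obtain S where S: "definable2 S" "bijrel S B C" by (rule equipotentE[OF assms(2)])
  have "bijrel (\<lambda>x z. \<exists>y. R x y \<and> S y z) A C"
    unfolding bijrel_def
  proof (intro conjI allI impI)
    fix x assume "x \<epsilon> A"
    then obtain y where "R x y" "y \<epsilon> B" using R(2) unfolding bijrel_def by blast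
    then show "\<exists>z y. R x y \<and> S y z" using S(2) unfolding bijrel_def by blast
  next
    fix z assume "z \<epsilon> C"
    then obtain y where "S y z" "y \<epsilon> B" using S(2) unfolding bijrel_def by blast
    then show "\<exists>x y. R x y \<and> S y z" using R(2) unfolding bijrel_def by blast
  next
    fix x y z assume "\<exists>w. R x w \<and> S w y" "\<exists>w. R x w \<and> S w z"
    then show "y = z" using bijrel_fun[OF R(2)] bijrel_fun[OF S(2)] by metis
  next
    fix x y z assume "\<exists>w. R x w \<and> S w z" "\<exists>w. R y w \<and> S w z"
    then show "x = y" using bijrel_inj[OF R(2)] bijrel_inj[OF S(2)] by metis
  qed (use R(2) S(2) in \<open>auto simp: bijrel_def\<close>)
  then show ?thesis by (rule equipotentI[rotated]) (intro def_intros def_subst2[OF R(1)] def_subst2[OF S(1)])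
qed

definition disj :: "'a \<Rightarrow> 'a \<Rightarrow> bool" where "disj a b \<longleftrightarrow> \<not> (\<exists>x. x \<epsilon> a \<and> x \<epsilon> b)"

lemma definable_disj [def_intros]: "def_fun f \<Longrightarrow> def_fun g \<Longrightarrow> definable (\<lambda>s. disj (f s) (g s))"
  unfolding disj_def by (intro def_intros def_fun_shift)

lemma equipotent_cup:
  assumes "equipotent A A'" and "equipotent B B'" and "disj A B" and "disj A' B'"
  shows "equipotent (cup A B) (cup A' B')"
proof -
  obtain R where R: "definable2 R" "bijrel R A A'" by (rule equipotentE[OF assms(1)])
  obtain S where S: "definable2 S" "bijrel S B B'" by (rule equipotentE[OF assms(2)])
  have "bijrel (\<lambda>x y. R x y \<or> S x y) (cup A B) (cup A' B')"
  proof (rule bijrelI)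
    note RS = bijrel_dom[OF R(2)] bijrel_dom[OF S(2)] bijrel_ran[OF R(2)] bijrel_ran[OF S(2)]
    show "y = y'" if "R x y \<or> S x y" "R x y' \<or> S x y'" for x y y'
      using that RS bijrel_fun[OF R(2)] bijrel_fun[OF S(2)] assms(3) unfolding disj_def by blast
    show "x = x'" if "R x y \<or> S x y" "R x' y \<or> S x' y" for x x' y
      using that RS bijrel_inj[OF R(2)] bijrel_inj[OF S(2)] assms(4) unfolding disj_def by blast
    show "\<exists>y. R x y \<or> S x y" if "x \<epsilon> cup A B" for x
      using that bijrel_total[OF R(2)] bijrel_total[OF S(2)] unfolding mem_cup by blast
    show "\<exists>x. R x y \<or> S x y" if "y \<epsilon> cup A' B'" for y
      using that bijrel_onto[OF R(2)] bijrel_onto[OF S(2)] unfolding mem_cup by blast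
  qed (use bijrel_dom[OF R(2)] bijrel_dom[OF S(2)] bijrel_ran[OF R(2)] bijrel_ran[OF S(2)] in auto)
  then show ?thesis by (rule equipotentI[rotated]) (intro def_intros def_subst2[OF R(1)] def_subst2[OF S(1)])
qed

lemma equipotent_single: "equipotent (ins x empty) (ins y empty)"
  by (rule equipotentI[where R = "\<lambda>u v. u = x \<and> v = y"]) (intro def_intros, auto simp: bijrel_def)

lemma ins_cup: "ins x A = cup A (ins x empty)"
  by (rule ext_eq) auto

lemma equipotent_ins:
  assumes "equipotent A B" and "\<not> x \<epsilon> A" and "\<not> y \<epsilon> B"
  shows "equipotent (ins x A) (ins y B)"
  unfolding ins_cup[of x A] ins_cup[of y B]
  using assms by (intro equipotent_cup equipotent_single) (auto simp: disj_def)

text \<open>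
  The image of \<open>C\<close> under a bijection, with the bijection restricted to \<open>C\<close>
  and to its complement.
\<close>

lemma equipotent_subset:
  assumes "equipotent A B" and "subset C A"
  shows "\<exists>D. subset D B \<and> equipotent C D \<and> equipotent (diff A C) (diff B D)"
proof -
  obtain R where R: "definable2 R" "bijrel R A B" by (rule equipotentE[OF assms(1)])
  obtain D where D: "\<And>y. y \<epsilon> D \<longleftrightarrow> y \<epsilon> B \<and> (\<exists>x. x \<epsilon> C \<and> R x y)"
    by (erule definable_setE) (intro def_intros def_subst2[OF R(1)])
  have "bijrel (\<lambda>x y. x \<epsilon> C \<and> R x y) C D"
    using bijrel_dom[OF R(2)] bijrel_ran[OF R(2)] bijrel_total[OF R(2)] bijrel_onto[OF R(2)]
      bijrel_fun[OF R(2)] bijrel_inj[OF R(2)] assms(2)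
    by (intro bijrelI) (auto simp: D subset_def)
  then have "equipotent C D" by (rule equipotentI[rotated]) (intro def_intros def_subst2[OF R(1)])
  moreover have "bijrel (\<lambda>x y. \<not> x \<epsilon> C \<and> R x y) (diff A C) (diff B D)"
    using bijrel_dom[OF R(2)] bijrel_ran[OF R(2)] bijrel_total[OF R(2)] bijrel_onto[OF R(2)]
      bijrel_fun[OF R(2)] bijrel_inj[OF R(2)] assms(2)
    by (intro bijrelI) (auto simp: D subset_def, metis+)
  then have "equipotent (diff A C) (diff B D)" by (rule equipotentI[rotated]) (intro def_intros def_subst2[OF R(1)])
  moreover have "subset D B" using D by (simp add: subset_def)
  ultimately show ?thesis by blast
qed

lemma equipotent_empty: "equipotent A empty \<Longrightarrow> A = empty"
  by (erule equipotentE, rule ext_eq) (auto simp: bijrel_def)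

lemma equipotent_ins_iff:
  assumes "equipotent A (ins y B)" and "\<not> y \<epsilon> B"
  shows "\<exists>x A'. A = ins x A' \<and> \<not> x \<epsilon> A' \<and> equipotent A' B"
proof -
  obtain D where D: "subset D A" "equipotent (ins y empty) D"
    "equipotent (diff (ins y B) (ins y empty)) (diff A D)"
    using equipotent_subset[OF equipotent_sym[OF assms(1)], of "ins y empty"] by (auto simp: subset_def)
  have "diff (ins y B) (ins y empty) = B" using assms(2) by (intro ext_eq) auto
  then have e: "equipotent (diff A D) B" using D(3) equipotent_sym by simp
  obtain R where R: "bijrel R (ins y empty) D" by (rule equipotentE[OF D(2)])
  then obtain x where x: "\<And>z. z \<epsilon> D \<longleftrightarrow> z = x" unfolding bijrel_def by (metis mem_empty mem_ins)
  have "A = ins x (diff A D)" using x D(1) by (intro ext_eq) (auto simp: subset_def)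
  then show ?thesis using e x by (metis mem_diff)
qed

section \<open>Natural numbers and finite sets of the model\<close>

lemma natural_empty [simp]: "natural empty" unfolding natural_def is_inductive_def by blast
lemma natural_succ [simp]: "natural n \<Longrightarrow> natural (succ n)" unfolding natural_def is_inductive_def by blast
lemma mem_succ [simp]: "x \<epsilon> succ n \<longleftrightarrow> x \<epsilon> n \<or> x = n" by (simp add: succ_ins)

lemma mem_irrefl [simp]: "\<not> x \<epsilon> x"
  using foundation[of x "ins x empty"] by auto

text \<open>
  Induction over the natural numbers of the model, which may be nonstandard; hence the restriction to
  definable \<open>P\<close>.
\<close>

lemma natural_induct [consumes 1]:
  assumes "natural n" and "definable1 P" and "P empty"
    and "\<And>n. natural n \<Longrightarrow> P n \<Longrightarrow> P (succ n)"
  shows "P n"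
proof -
  obtain I e where I: "e \<epsilon> I" "\<forall>x. \<not> x \<epsilon> e"
    "\<And>x. x \<epsilon> I \<Longrightarrow> \<exists>y. y \<epsilon> I \<and> (\<forall>z. z \<epsilon> y \<longleftrightarrow> z \<epsilon> x \<or> z = x)"
    using infinity by blast
  have "e = empty" using I(2) by (intro ext_eq) simp
  moreover have "succ x \<epsilon> I" if "x \<epsilon> I" for x
  proof -
    obtain y where y: "y \<epsilon> I" "\<forall>z. z \<epsilon> y \<longleftrightarrow> z \<epsilon> x \<or> z = x" using I(3)[OF \<open>x \<epsilon> I\<close>] by blast
    have "y = succ x" using y(2) by (intro ext_eq) simp
    then show ?thesis using y(1) by simp
  qed
  ultimately have I: "empty \<epsilon> I" "\<And>x. x \<epsilon> I \<Longrightarrow> succ x \<epsilon> I" using I(1) by simp_all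
  obtain J where J: "\<And>x. x \<epsilon> J \<longleftrightarrow> x \<epsilon> I \<and> (natural x \<and> P x)"
    by (erule definable_setE) (intro def_intros assms(2))
  have "is_inductive J" unfolding is_inductive_def using J I assms(3,4) by simp
  then show ?thesis using assms(1) J unfolding natural_def by blast
qed

lemma finite_empty [simp]: "set_finite empty"
  unfolding set_finite_def using equipotent_refl natural_empty by blast

lemma ins_absorb: "x \<epsilon> A \<Longrightarrow> ins x A = A" by (rule ext_eq) auto

lemma finite_ins [simp]: assumes "set_finite A" shows "set_finite (ins x A)"
proof (cases "x \<epsilon> A")
  case True
  then show ?thesis using assms ins_absorb by simp
next
  case False
  obtain n where "natural n" "equipotent A n" using assms unfolding set_finite_def by blast
  then have "natural (succ n)" "equipotent (ins x A) (succ n)"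
    using False equipotent_ins[of A n x n] natural_succ by (auto simp: succ_ins)
  then show ?thesis unfolding set_finite_def by blast
qed

text \<open>
  Finiteness in the model means equipotence with one of its natural numbers, and induction on that
  number removes one element at a time. The facts on finite sets below use this rule and
  the closure of finiteness under adjoining a point.
\<close>

lemma finite_induct [consumes 1]:
  assumes A: "set_finite A" and P: "definable1 P" and 0: "P empty"
    and step: "\<And>A x. set_finite A \<Longrightarrow> P A \<Longrightarrow> \<not> x \<epsilon> A \<Longrightarrow> P (ins x A)"
  shows "P A"
proof -
  obtain n where n: "natural n" "equipotent A n" using A unfolding set_finite_def by blast
  have "\<forall>A. equipotent A n \<longrightarrow> P A" using n(1)
  proof (induction n rule: natural_induct)
    show "definable (\<lambda>s. \<forall>A. equipotent A (s 0) \<longrightarrow> P A)" by (intro def_intros def_subst1[OF P])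
    show "\<forall>A. equipotent A empty \<longrightarrow> P A" using 0 equipotent_empty by blast
    fix n assume n: "natural n" and IH: "\<forall>A. equipotent A n \<longrightarrow> P A"
    show "\<forall>A. equipotent A (succ n) \<longrightarrow> P A"
    proof (intro allI impI)
      fix A assume "equipotent A (succ n)"
      then obtain x A' where "A = ins x A'" "\<not> x \<epsilon> A'" "equipotent A' n"
        using equipotent_ins_iff[of A n n] by (auto simp: succ_ins)
      then show "P A" using IH step n unfolding set_finite_def by blast
    qed
  qed
  then show ?thesis using n(2) by blast
qed

lemma finite_subset:
  assumes "set_finite A" and "\<And>x. x \<epsilon> B \<Longrightarrow> x \<epsilon> A"
  shows "set_finite B"
proof -
  have "\<forall>B. subset B A \<longrightarrow> set_finite B" using assms(1)
  proof (induction A rule: finite_induct)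
    show "definable (\<lambda>s. \<forall>B. subset B (s 0) \<longrightarrow> set_finite B)" by (intro def_intros)
    show "\<forall>B. subset B empty \<longrightarrow> set_finite B"
    proof (intro allI impI)
      fix B assume "subset B empty"
      then have "B = empty" by (intro ext_eq) (auto simp: subset_def)
      then show "set_finite B" by simp
    qed
    fix A x assume IH: "\<forall>B. subset B A \<longrightarrow> set_finite B"
    show "\<forall>B. subset B (ins x A) \<longrightarrow> set_finite B"
    proof (intro allI impI)
      fix B assume B: "subset B (ins x A)"
      then have "subset (diff B (ins x empty)) A" by (auto simp: subset_def)
      then have "set_finite (ins x (diff B (ins x empty)))" using IH by simp
      moreover have "ins x (diff B (ins x empty)) = ins x B" by (intro ext_eq) auto
      moreover have "B = ins x B \<or> subset B A" using B by (auto simp: subset_def ins_absorb)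
      ultimately show "set_finite B" using IH by auto
    qed
  qed
  then show ?thesis using assms(2) by (auto simp: subset_def)
qed

lemma finite_cup [simp]: assumes "set_finite A" and "set_finite B" shows "set_finite (cup A B)"
  using assms(1)
proof (induction A rule: finite_induct)
  show "definable (\<lambda>s. set_finite (cup (s 0) B))" by (intro def_intros)
  have "cup empty B = B" by (intro ext_eq) simp
  then show "set_finite (cup empty B)" using assms(2) by simp
  fix A x assume "set_finite (cup A B)"
  moreover have "cup (ins x A) B = ins x (cup A B)" by (intro ext_eq) auto
  ultimately show "set_finite (cup (ins x A) B)" by simp
qed

lemma finite_diff [simp]: "set_finite A \<Longrightarrow> set_finite (diff A B)"
  by (erule finite_subset) simp

lemma finite_symdiff [simp]: "set_finite A \<Longrightarrow> set_finite B \<Longrightarrow> set_finite (symdiff A B)"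
  by (rule finite_subset[of "cup A B"]) auto

text \<open>
  A finite union of finite sets, for sets that are not given as values of a function but only known
  to exist: finitely many choices can be made by induction.
\<close>

lemma finite_indexed_union:
  assumes I: "set_finite I" and R: "definable2 R"
    and fin: "\<And>i. i \<epsilon> I \<Longrightarrow> \<exists>D. set_finite D \<and> (\<forall>y. R i y \<longrightarrow> y \<epsilon> D)"
  shows "\<exists>D. set_finite D \<and> (\<forall>i y. i \<epsilon> I \<longrightarrow> R i y \<longrightarrow> y \<epsilon> D)"
proof -
  have "subset I I \<longrightarrow> (\<exists>D. set_finite D \<and> (\<forall>i y. i \<epsilon> I \<longrightarrow> R i y \<longrightarrow> y \<epsilon> D))"
    using I
  proof (induction I rule: finite_induct[where P = "\<lambda>J. subset J I \<longrightarrow>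
        (\<exists>D. set_finite D \<and> (\<forall>i y. i \<epsilon> J \<longrightarrow> R i y \<longrightarrow> y \<epsilon> D))"])
    show "definable (\<lambda>s. subset (s 0) I \<longrightarrow>
        (\<exists>D. set_finite D \<and> (\<forall>i y. i \<epsilon> s 0 \<longrightarrow> R i y \<longrightarrow> y \<epsilon> D)))"
      by (intro def_intros def_subst2[OF R])
    show "subset empty I \<longrightarrow> (\<exists>D. set_finite D \<and> (\<forall>i y. i \<epsilon> empty \<longrightarrow> R i y \<longrightarrow> y \<epsilon> D))"
      using finite_empty mem_empty by blast
    fix J x
    assume IH: "subset J I \<longrightarrow> (\<exists>D. set_finite D \<and> (\<forall>i y. i \<epsilon> J \<longrightarrow> R i y \<longrightarrow> y \<epsilon> D))"
    show "subset (ins x J) I \<longrightarrow>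
        (\<exists>D. set_finite D \<and> (\<forall>i y. i \<epsilon> ins x J \<longrightarrow> R i y \<longrightarrow> y \<epsilon> D))"
    proof
      assume s: "subset (ins x J) I"
      then obtain D where D: "set_finite D" "\<forall>i y. i \<epsilon> J \<longrightarrow> R i y \<longrightarrow> y \<epsilon> D"
        using IH by (auto simp: subset_def)
      obtain D' where "set_finite D'" "\<forall>y. R x y \<longrightarrow> y \<epsilon> D'"
        using fin[of x] s by (auto simp: subset_def)
      then show "\<exists>D. set_finite D \<and> (\<forall>i y. i \<epsilon> ins x J \<longrightarrow> R i y \<longrightarrow> y \<epsilon> D)"
        using D by (intro exI[of _ "cup D D'"]) auto
    qed
  qed
  then show ?thesis by (simp add: subset_def)
qed

lemma finite_image:
  assumes I: "set_finite I" and R: "definable2 R"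
    and single: "\<And>i y y'. i \<epsilon> I \<Longrightarrow> R i y \<Longrightarrow> R i y' \<Longrightarrow> y = y'"
    and onto: "\<And>y. y \<epsilon> B \<Longrightarrow> \<exists>i. i \<epsilon> I \<and> R i y"
  shows "set_finite B"
proof -
  have "\<exists>D. set_finite D \<and> (\<forall>y. R i y \<longrightarrow> y \<epsilon> D)" if "i \<epsilon> I" for i
  proof (cases "\<exists>y. R i y")
    case True
    then obtain y where "R i y" by blast
    then show ?thesis using single[OF that] by (intro exI[of _ "ins y empty"]) auto
  next
    case False
    then show ?thesis using finite_empty by blast
  qed
  then obtain D where "set_finite D" "\<forall>i y. i \<epsilon> I \<longrightarrow> R i y \<longrightarrow> y \<epsilon> D"
    using finite_indexed_union[OF I R] by blast
  then show ?thesis using onto by (blast intro: finite_subset)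
qed

lemma finite_Cup: assumes "set_finite A" and "\<And>x. x \<epsilon> A \<Longrightarrow> set_finite x" shows "set_finite (Cup A)"
proof -
  have "\<exists>D. set_finite D \<and> (\<forall>i y. i \<epsilon> A \<longrightarrow> y \<epsilon> i \<longrightarrow> y \<epsilon> D)"
    by (rule finite_indexed_union[where R = "\<lambda>i y. y \<epsilon> i", OF assms(1)]) (intro def_intros, use assms(2) in blast)
  then show ?thesis by (auto elim!: finite_subset)
qed

lemma finite_Power [simp]: assumes "set_finite A" shows "set_finite (Power A)"
  using assms
proof (induction A rule: finite_induct)
  show "definable (\<lambda>s. set_finite (Power (s 0)))" by (intro def_intros)
  have "Power empty = ins empty empty" by (rule ext_eq) (auto simp: subset_def intro!: ext_eq)
  then show "set_finite (Power empty)" by simp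
  fix A x assume IH: "set_finite (Power A)"
  show "set_finite (Power (ins x A))"
  proof -
    have "\<exists>D. set_finite D \<and> (\<forall>i y. i \<epsilon> Power A \<longrightarrow> (y = i \<or> y = ins x i) \<longrightarrow> y \<epsilon> D)"
    proof (rule finite_indexed_union[where R = "\<lambda>i y. y = i \<or> y = ins x i", OF IH])
      fix i show "\<exists>D. set_finite D \<and> (\<forall>y. (y = i \<or> y = ins x i) \<longrightarrow> y \<epsilon> D)"
        by (rule exI[of _ "ins i (ins (ins x i) empty)"]) simp
    qed (intro def_intros)
    then obtain D where D: "set_finite D" "\<And>i y. i \<epsilon> Power A \<Longrightarrow> (y = i \<or> y = ins x i) \<Longrightarrow> y \<epsilon> D"
      by blast
    show ?thesis
    proof (rule finite_subset[OF D(1)])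
      fix y assume y: "y \<epsilon> Power (ins x A)"
      let ?i = "diff y (ins x empty)"
      have "?i \<epsilon> Power A" using y by (auto simp: subset_def)
      moreover have "y = ?i \<or> y = ins x ?i" by (cases "x \<epsilon> y") (auto intro!: ext_eq)
      ultimately show "y \<epsilon> D" by (rule D(2))
    qed
  qed
qed

lemma finite_minimal:
  assumes A: "set_finite A" and R: "definable2 R" and ne: "A \<noteq> empty"
    and trans: "\<And>x y z. R x y \<Longrightarrow> R y z \<Longrightarrow> R x z" and irrefl: "\<And>x. \<not> R x x"
  shows "\<exists>m. m \<epsilon> A \<and> (\<forall>y. y \<epsilon> A \<longrightarrow> \<not> R y m)"
proof -
  have "A \<noteq> empty \<longrightarrow> (\<exists>m. m \<epsilon> A \<and> (\<forall>y. y \<epsilon> A \<longrightarrow> \<not> R y m))" using A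
  proof (induction A rule: finite_induct)
    show "definable (\<lambda>s. s 0 \<noteq> empty \<longrightarrow> (\<exists>m. m \<epsilon> s 0 \<and> (\<forall>y. y \<epsilon> s 0 \<longrightarrow> \<not> R y m)))"
      by (intro def_intros def_subst2[OF R])
    fix A x assume IH: "A \<noteq> empty \<longrightarrow> (\<exists>m. m \<epsilon> A \<and> (\<forall>y. y \<epsilon> A \<longrightarrow> \<not> R y m))"
    show "ins x A \<noteq> empty \<longrightarrow> (\<exists>m. m \<epsilon> ins x A \<and> (\<forall>y. y \<epsilon> ins x A \<longrightarrow> \<not> R y m))"
    proof (cases "A = empty")
      case True
      then show ?thesis using irrefl by auto
    next
      case False
      then obtain m where m: "m \<epsilon> A" "\<forall>y. y \<epsilon> A \<longrightarrow> \<not> R y m" using IH by blast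
      show ?thesis
      proof (cases "R x m")
        case True
        then have "\<not> R y x" if "y \<epsilon> A" for y using m that trans by blast
        then show ?thesis using irrefl by (intro impI exI[of _ x]) auto
      next
        case False
        then show ?thesis using m by (intro impI exI[of _ m]) auto
      qed
    qed
  qed simp
  then show ?thesis using ne by blast
qed

lemma nonempty: "A \<noteq> empty \<longleftrightarrow> (\<exists>x. x \<epsilon> A)"
  by (metis ext_eq mem_empty)

lemma subset_refl [simp]: "subset A A" by (simp add: subset_def)
lemma subset_trans: "subset A B \<Longrightarrow> subset B C \<Longrightarrow> subset A C" by (simp add: subset_def)
lemma subset_antisym: "subset A B \<Longrightarrow> subset B A \<Longrightarrow> A = B"
  by (rule ext_eq) (auto simp: subset_def)

lemma finite_minimal_subset:
  assumes "set_finite A" and "A \<noteq> empty"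
  shows "\<exists>m. m \<epsilon> A \<and> (\<forall>y. y \<epsilon> A \<longrightarrow> subset y m \<longrightarrow> y = m)"
proof -
  have "\<exists>m. m \<epsilon> A \<and> (\<forall>y. y \<epsilon> A \<longrightarrow> \<not> (subset y m \<and> y \<noteq> m))"
  proof (rule finite_minimal[where R = "\<lambda>y m. subset y m \<and> y \<noteq> m", OF assms(1) _ assms(2)])
    show "definable (\<lambda>s. subset (s 0) (s 1) \<and> s 0 \<noteq> s 1)" by (intro def_intros)
  qed (auto dest: subset_trans subset_antisym)
  then show ?thesis by blast
qed

lemma finite_maximal_subset:
  assumes "set_finite A" and "A \<noteq> empty"
  shows "\<exists>m. m \<epsilon> A \<and> (\<forall>y. y \<epsilon> A \<longrightarrow> subset m y \<longrightarrow> y = m)"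
proof -
  have "\<exists>m. m \<epsilon> A \<and> (\<forall>y. y \<epsilon> A \<longrightarrow> \<not> (subset m y \<and> y \<noteq> m))"
  proof (rule finite_minimal[where R = "\<lambda>y m. subset m y \<and> y \<noteq> m", OF assms(1) _ assms(2)])
    show "definable (\<lambda>s. subset (s 1) (s 0) \<and> s 0 \<noteq> s 1)" by (intro def_intros)
  qed (auto dest: subset_trans subset_antisym)
  then show ?thesis by blast
qed

text \<open>
  If \<open>P\<close> fails at \<open>A\<close>, it fails at a minimal subset of \<open>A\<close>, because the
  power set of \<open>A\<close> is finite.
\<close>

lemma finite_strong_induct [consumes 1]:
  assumes A: "set_finite A" and P: "definable1 P"
    and step: "\<And>A. set_finite A \<Longrightarrow> (\<And>B. subset B A \<Longrightarrow> B \<noteq> A \<Longrightarrow> P B) \<Longrightarrow> P A"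
  shows "P A"
proof (rule ccontr)
  assume nP: "\<not> P A"
  obtain S where S: "\<And>x. x \<epsilon> S \<longleftrightarrow> x \<epsilon> Power A \<and> \<not> P x"
    using definable_separation[of "\<lambda>x. \<not> P x" "Power A"] definable_not[OF P] by blast
  have "set_finite S" using S A by (auto intro: finite_subset[of "Power A"])
  moreover have "S \<noteq> empty" using S nP subset_refl unfolding nonempty mem_Power by blast
  ultimately obtain m where m: "m \<epsilon> S" "\<forall>y. y \<epsilon> S \<longrightarrow> subset y m \<longrightarrow> y = m"
    using finite_minimal_subset by blast
  have "subset m A" using m(1) S by simp
  then have "set_finite m" using A by (auto simp: subset_def intro: finite_subset)
  then have "P m"
  proof (rule step)
    fix B assume "subset B m" "B \<noteq> m"
    moreover from this have "subset B A" using \<open>subset m A\<close> subset_trans by blast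
    ultimately show "P B" using m(2) S by auto
  qed
  then show False using m(1) S by blast
qed

section \<open>Comparing the sizes of finite sets\<close>

lemma equipotent_remove:
  assumes "x \<epsilon> B" and "y \<epsilon> B"
  shows "equipotent (diff B (ins x empty)) (diff B (ins y empty))"
proof (rule equipotentI)
  let ?R = "\<lambda>u v. u \<epsilon> B \<and> u \<noteq> x \<and> (u = y \<and> v = x \<or> u \<noteq> y \<and> v = u)"
  show "definable (\<lambda>s. s 0 \<epsilon> B \<and> s 0 \<noteq> x \<and> (s 0 = y \<and> s 1 = x \<or> s 0 \<noteq> y \<and> s 1 = s 0))"
    by (intro def_intros)
  show "bijrel ?R (diff B (ins x empty)) (diff B (ins y empty))"
  proof (rule bijrelI)
    fix v assume v: "v \<epsilon> diff B (ins y empty)"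
    show "\<exists>u. ?R u v"
      by (rule exI[of _ "if v = x then y else v"]) (use v assms in auto)
  qed (use assms in auto)
qed

text \<open>
  Induction step: a bijection from \<open>A\<close> with the extra point \<open>x\<close> onto \<open>B\<close> sends \<open>x\<close> to some
  \<open>y\<close>. If \<open>x\<close> belongs to \<open>B\<close>, removing \<open>x\<close> instead of \<open>y\<close> from \<open>B\<close> gives a subset of
  \<open>A\<close>; otherwise removing \<open>y\<close> does.
\<close>

lemma pigeonhole:
  assumes "set_finite A" and "subset B A" and "equipotent A B"
  shows "B = A"
proof -
  have "\<forall>B. subset B A \<longrightarrow> equipotent A B \<longrightarrow> B = A" using assms(1)
  proof (induction A rule: finite_induct)
    show "definable (\<lambda>s. \<forall>B. subset B (s 0) \<longrightarrow> equipotent (s 0) B \<longrightarrow> B = s 0)" by (intro def_intros)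
    show "\<forall>B. subset B empty \<longrightarrow> equipotent empty B \<longrightarrow> B = empty"
      by (auto simp: subset_def intro!: ext_eq)
    fix A x assume IH: "\<forall>B. subset B A \<longrightarrow> equipotent A B \<longrightarrow> B = A" and x: "\<not> x \<epsilon> A"
    show "\<forall>B. subset B (ins x A) \<longrightarrow> equipotent (ins x A) B \<longrightarrow> B = ins x A"
    proof (intro allI impI)
      fix B assume B: "subset B (ins x A)" "equipotent (ins x A) B"
      obtain y B' where y: "B = ins y B'" "\<not> y \<epsilon> B'" "equipotent B' A"
        using equipotent_ins_iff[OF equipotent_sym[OF B(2)] x] by blast
      have e: "equipotent A (diff B (ins y empty))"
      proof -
        have "diff B (ins y empty) = B'" using y by (intro ext_eq) auto
        then show ?thesis using y(3) equipotent_sym by simp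
      qed
      show "B = ins x A"
      proof (cases "x \<epsilon> B")
        case True
        have "equipotent A (diff B (ins x empty))"
          using e equipotent_remove[of y B x] True y(1) equipotent_trans by auto
        moreover have "subset (diff B (ins x empty)) A" using B(1) by (auto simp: subset_def)
        ultimately have "diff B (ins x empty) = A" using IH by blast
        then show ?thesis using True by (auto intro!: ext_eq)
      next
        case False
        then have "subset (diff B (ins y empty)) A" using B(1) by (auto simp: subset_def)
        then have "diff B (ins y empty) = A" using IH e by blast
        moreover have "y \<epsilon> A" using y(1) False B(1) by (auto simp: subset_def)
        ultimately show ?thesis by auto
      qed
    qed
  qed
  then show ?thesis using assms(2,3) by blast
qed

text \<open>
  In the induction step the new point of \<open>A\<close> is matched with a point of \<open>B\<close> outside \<open>C\<close>, if there is one.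
\<close>

lemma finite_comparable:
  assumes "set_finite A"
  shows "(\<exists>C. subset C B \<and> equipotent A C) \<or> (\<exists>C. subset C A \<and> equipotent B C)"
  using assms
proof (induction A rule: finite_induct)
  show "definable (\<lambda>s. (\<exists>C. subset C B \<and> equipotent (s 0) C) \<or> (\<exists>C. subset C (s 0) \<and> equipotent B C))"
    by (intro def_intros)
  have "subset empty B" by (simp add: subset_def)
  then show "(\<exists>C. subset C B \<and> equipotent empty C) \<or> (\<exists>C. subset C empty \<and> equipotent B C)"
    using equipotent_refl by blast
  fix A x assume IH: "(\<exists>C. subset C B \<and> equipotent A C) \<or> (\<exists>C. subset C A \<and> equipotent B C)"
    and x: "\<not> x \<epsilon> A"
  have A: "subset A (ins x A)" by (simp add: subset_def)
  show "(\<exists>C. subset C B \<and> equipotent (ins x A) C) \<or> (\<exists>C. subset C (ins x A) \<and> equipotent B C)"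
  proof (cases "\<exists>C. subset C A \<and> equipotent B C")
    case True
    then show ?thesis using A subset_trans by blast
  next
    case False
    then obtain C where C: "subset C B" "equipotent A C" using IH by blast
    then have "C \<noteq> B" using False equipotent_sym subset_refl by blast
    then obtain y where y: "y \<epsilon> B" "\<not> y \<epsilon> C" using C(1) ext_eq unfolding subset_def by metis
    then have "subset (ins y C) B" using C(1) by (auto simp: subset_def)
    then show ?thesis using equipotent_ins[OF C(2) x y(2)] by blast
  qed
qed

lemma finite_equipotent: "set_finite A \<Longrightarrow> equipotent A B \<Longrightarrow> set_finite B"
  unfolding set_finite_def using equipotent_sym equipotent_trans by blast

text \<open>
  Cancellation: if one difference were equipotent to a proper part of the other, adding \<open>K\<close> back
  would make one of the two sets equipotent to a proper part of the other, against the
  pigeonhole principle.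
\<close>

lemma equipotent_diff:
  assumes fin: "set_finite y'" and K: "subset K y" "subset K y'" and e: "equipotent y y'"
  shows "equipotent (diff y K) (diff y' K)"
proof -
  have *: "equipotent (diff y K) (diff y' K)"
    if C: "subset C (diff y' K)" "equipotent (diff y K) C"
      and fin: "set_finite y'" and K: "subset K y" "subset K y'" and e: "equipotent y y'" for y y' C
  proof -
    have "equipotent (cup (diff y K) K) (cup C K)"
      using C by (intro equipotent_cup equipotent_refl) (auto simp: disj_def subset_def)
    moreover have "cup (diff y K) K = y" using K(1) by (intro ext_eq) (auto simp: subset_def)
    ultimately have "equipotent y' (cup C K)" using equipotent_trans[OF equipotent_sym[OF e]] by simp
    moreover have "subset (cup C K) y'" using C(1) K(2) by (auto simp: subset_def)
    ultimately have "cup C K = y'" using pigeonhole[OF fin] by blast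
    then have "C = diff y' K" using C(1) by (intro ext_eq) (auto simp: subset_def)
    then show ?thesis using C(2) by simp
  qed
  have fin': "set_finite y" by (rule finite_equipotent[OF fin equipotent_sym[OF e]])
  consider C where "subset C (diff y' K)" "equipotent (diff y K) C"
    | C where "subset C (diff y K)" "equipotent (diff y' K) C"
    using finite_comparable[of "diff y K" "diff y' K"] fin' by auto
  then show ?thesis
  proof cases
    case 1
    then show ?thesis using *[of C y' y] fin K e by blast
  next
    case 2
    then show ?thesis using *[of C y y'] fin' K equipotent_sym[OF e] equipotent_sym by blast
  qed
qed

section \<open>Dedekind-infinite families and endless chains\<close>

lemma mem_Fin [simp]: "z \<epsilon> Fin X \<longleftrightarrow> subset z X \<and> set_finite z"
proof -
  have "\<exists>b. \<forall>z. z \<epsilon> b \<longleftrightarrow> subset z X \<and> set_finite z"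
    by (rule definable_comprehension[where a = "Power X"]) (intro def_intros, simp)
  then show ?thesis unfolding Fin_def by (rule mem_Coll)
qed

text \<open>
  For finite sets such a chain is automatically ordered like the natural numbers: below each
  member there are finitely many others. It serves as the combinatorial form of
  Dedekind-infiniteness of \<open>Fin X\<close>.
\<close>

definition endless_chain :: "'a \<Rightarrow> bool" where
  "endless_chain U \<longleftrightarrow> (\<exists>u. u \<epsilon> U) \<and> (\<forall>u. u \<epsilon> U \<longrightarrow> set_finite u) \<and>
     (\<forall>u v. u \<epsilon> U \<longrightarrow> v \<epsilon> U \<longrightarrow> subset u v \<or> subset v u) \<and>
     (\<forall>u. u \<epsilon> U \<longrightarrow> (\<exists>v. v \<epsilon> U \<and> \<not> subset v u))"

lemma endless_chain_least_above:
  assumes U: "endless_chain U" and P: "definable1 P" and w: "w \<epsilon> U" "P w"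
  shows "\<exists>m. m \<epsilon> U \<and> P m \<and> (\<forall>v. v \<epsilon> U \<longrightarrow> P v \<longrightarrow> subset m v)"
proof -
  obtain S where S: "\<And>v. v \<epsilon> S \<longleftrightarrow> v \<epsilon> U \<and> (subset v w \<and> P v)"
    by (erule definable_setE) (intro def_intros P)
  have fin: "set_finite w" using U w(1) by (simp add: endless_chain_def)
  have "set_finite S" by (rule finite_subset[OF finite_Power[OF fin]]) (simp add: S)
  moreover have "S \<noteq> empty" using S w subset_refl unfolding nonempty by blast
  ultimately obtain m where m: "m \<epsilon> S" "\<forall>y. y \<epsilon> S \<longrightarrow> subset y m \<longrightarrow> y = m"
    using finite_minimal_subset by blast
  have "subset m v" if "v \<epsilon> U" "P v" for v
  proof (rule ccontr)
    assume n: "\<not> subset m v"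
    then have "subset v m" using U that(1) m(1) S unfolding endless_chain_def by blast
    moreover from this have "v \<epsilon> S" using that m(1) S subset_trans by blast
    ultimately show False using m(2) n by auto
  qed
  then show ?thesis using m(1) S by blast
qed

lemma endless_chain_greatest_below:
  assumes U: "endless_chain U" and w: "w \<epsilon> U" "subset w y" "w \<noteq> y" and y: "y \<epsilon> U"
  shows "\<exists>m. m \<epsilon> U \<and> subset m y \<and> m \<noteq> y \<and>
    (\<forall>v. v \<epsilon> U \<longrightarrow> subset v y \<longrightarrow> v \<noteq> y \<longrightarrow> subset v m)"
proof -
  obtain S where S: "\<And>v. v \<epsilon> S \<longleftrightarrow> v \<epsilon> U \<and> (subset v y \<and> v \<noteq> y)"
    by (erule definable_setE) (intro def_intros)
  have fin: "set_finite y" using U y by (simp add: endless_chain_def)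
  have "set_finite S" by (rule finite_subset[OF finite_Power[OF fin]]) (simp add: S)
  moreover have "S \<noteq> empty" using S w unfolding nonempty by blast
  ultimately obtain m where m: "m \<epsilon> S" "\<forall>y. y \<epsilon> S \<longrightarrow> subset m y \<longrightarrow> y = m"
    using finite_maximal_subset by blast
  have "subset v m" if "v \<epsilon> U" "subset v y" "v \<noteq> y" for v
  proof (rule ccontr)
    assume n: "\<not> subset v m"
    then have "subset m v" using U that(1) m(1) S unfolding endless_chain_def by blast
    then show False using m(2) n S that by auto
  qed
  then show ?thesis using m(1) S by blast
qed

text \<open>
  Send every member of the chain to the next one and fix all other finite sets. This is a bijection of
  \<open>Fin X\<close> with the complement of the least member of the chain.
\<close>

lemma endless_chain_imp_D_infinite:
  assumes U: "endless_chain U" and UX: "\<And>u. u \<epsilon> U \<Longrightarrow> subset u X"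
  shows "\<not> D_finite (Fin X)"
proof -
  define R where "R x y \<longleftrightarrow> subset x X \<and> set_finite x \<and>
    (if x \<epsilon> U then y \<epsilon> U \<and> \<not> subset y x \<and> (\<forall>w. w \<epsilon> U \<longrightarrow> \<not> subset w x \<longrightarrow> subset y w) else y = x)" for x y
  have R_definable: "definable2 R" unfolding R_def if_bool_eq_disj by (intro def_intros)
  obtain u where u: "u \<epsilon> U" using U by (auto simp: endless_chain_def)
  obtain u0 where u0: "u0 \<epsilon> U" "\<And>v. v \<epsilon> U \<Longrightarrow> subset u0 v"
    using endless_chain_least_above[where P = "\<lambda>_. True", OF U definable_const u TrueI] by auto
  have UF: "subset u X" "set_finite u" if "u \<epsilon> U" for u
    using U UX that unfolding endless_chain_def by auto
  have lin: "subset v u \<or> subset u v" if "u \<epsilon> U" "v \<epsilon> U" for u v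
    using U that unfolding endless_chain_def by blast
  have "bijrel R (Fin X) (diff (Fin X) (ins u0 empty))"
  proof (rule bijrelI)
    fix x y assume R: "R x y"
    show "x \<epsilon> Fin X" using R by (simp add: R_def)
    show "y \<epsilon> diff (Fin X) (ins u0 empty)"
      using R u0 UF unfolding R_def by (auto split: if_splits)
  next
    fix x assume x: "x \<epsilon> Fin X"
    show "\<exists>y. R x y"
    proof (cases "x \<epsilon> U")
      case True
      then obtain w where w: "w \<epsilon> U" "\<not> subset w x" using U unfolding endless_chain_def by blast
      have d: "definable1 (\<lambda>w. \<not> subset w x)" by (intro def_intros)
      show ?thesis using endless_chain_least_above[OF U d w] x True by (auto simp: R_def)
    qed (use x in \<open>simp add: R_def\<close>)
  next
    fix y assume y: "y \<epsilon> diff (Fin X) (ins u0 empty)"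
    show "\<exists>x. R x y"
    proof (cases "y \<epsilon> U")
      case True
      obtain m where m: "m \<epsilon> U" "subset m y" "m \<noteq> y"
        "\<And>v. v \<epsilon> U \<Longrightarrow> subset v y \<Longrightarrow> v \<noteq> y \<Longrightarrow> subset v m"
        using endless_chain_greatest_below[OF U u0(1) u0(2)[OF True] _ True] y by auto
      have "subset y w" if "w \<epsilon> U" "\<not> subset w m" for w
        using m(4)[OF that(1)] that lin[OF True that(1)] subset_refl by metis
      moreover have "\<not> subset y m" using m(2,3) subset_antisym by blast
      ultimately have "R m y" unfolding R_def using m(1) UF True by simp
      then show ?thesis by blast
    qed (use y in \<open>auto simp: R_def\<close>)
  next
    fix x y y' assume "R x y" "R x y'"
    then show "y = y'" unfolding R_def by (auto split: if_splits intro: subset_antisym)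
  next
    fix x x' y assume xy: "R x y" "R x' y"
    then have U': "x \<epsilon> U \<longleftrightarrow> x' \<epsilon> U" unfolding R_def by (auto split: if_splits)
    show "x = x'"
    proof (cases "x \<epsilon> U")
      case True
      have "subset x x'" if "R x y" "R x' y" "x \<epsilon> U" "x' \<epsilon> U" for x x'
        using that lin[of x x'] unfolding R_def by auto
      then show ?thesis using xy True U' subset_antisym by blast
    qed (use xy U' in \<open>simp add: R_def\<close>)
  qed
  then have "equipotent (Fin X) (diff (Fin X) (ins u0 empty))" by (rule equipotentI[OF R_definable])
  moreover have "subset (diff (Fin X) (ins u0 empty)) (Fin X)" by (simp add: subset_def)
  moreover have "u0 \<epsilon> Fin X" using UF u0(1) by simp
  then have "diff (Fin X) (ins u0 empty) \<noteq> Fin X" by (metis mem_diff mem_ins)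
  ultimately show ?thesis unfolding D_finite_def by blast
qed

text \<open>
  The iterates of \<open>\<sigma>\<close> on the empty set, without numbering them: the least set \<open>T\<close> that
  contains the empty set and is closed under \<open>\<sigma>\<close>. That \<open>T\<close> is linearly ordered, with
  nothing strictly between \<open>E\<close> and \<open>\<sigma> E\<close>, is the argument of Zermelo. It replaces recursion
  along the natural numbers of the model.
\<close>

lemma inflationary_tower:
  assumes \<sigma>: "def_fun (\<lambda>s. \<sigma> (s 0))"
    and Z: "\<And>E. subset E Z \<Longrightarrow> subset (\<sigma> E) Z" and inf: "\<And>E. subset E Z \<Longrightarrow> subset E (\<sigma> E)"
  obtains T where "empty \<epsilon> T" and "\<And>E. E \<epsilon> T \<Longrightarrow> \<sigma> E \<epsilon> T" and "\<And>E. E \<epsilon> T \<Longrightarrow> subset E Z"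
    and "\<And>P E. E \<epsilon> T \<Longrightarrow> definable1 P \<Longrightarrow> P empty \<Longrightarrow> (\<And>E. E \<epsilon> T \<Longrightarrow> P E \<Longrightarrow> P (\<sigma> E)) \<Longrightarrow> P E"
    and "\<And>E E'. E \<epsilon> T \<Longrightarrow> E' \<epsilon> T \<Longrightarrow> subset E' E \<or> subset (\<sigma> E) E'"
proof -
  note \<sigma>_fo = def_fun_subst1[where F = \<sigma>, OF definable_graph1[OF \<sigma>]]
  define closed where "closed S \<longleftrightarrow> empty \<epsilon> S \<and> (\<forall>E. E \<epsilon> S \<longrightarrow> \<sigma> E \<epsilon> S)" for S
  have "\<exists>T. \<forall>E. E \<epsilon> T \<longleftrightarrow> E \<epsilon> Power Z \<and> (\<forall>S. closed S \<longrightarrow> E \<epsilon> S)"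
    unfolding closed_def by (rule definable_separation) (intro def_intros \<sigma>_fo)
  then obtain T where T: "\<And>E. E \<epsilon> T \<longleftrightarrow> subset E Z \<and> (\<forall>S. closed S \<longrightarrow> E \<epsilon> S)" by auto
  have T0: "empty \<epsilon> T" using T by (simp add: subset_def closed_def)
  have T\<sigma>: "\<sigma> E \<epsilon> T" if "E \<epsilon> T" for E using that T Z by (simp add: closed_def)
  have TZ: "subset E Z" if "E \<epsilon> T" for E using that T by simp
  have ind: "P E" if E: "E \<epsilon> T" and P: "definable1 P" and 0: "P empty"
    and step: "\<And>E. E \<epsilon> T \<Longrightarrow> P E \<Longrightarrow> P (\<sigma> E)" for P E
  proof -
    obtain S where S: "\<And>E. E \<epsilon> S \<longleftrightarrow> E \<epsilon> T \<and> P E" using definable_separation[OF P, of T] by blast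
    have "closed S" unfolding closed_def using S T0 T\<sigma> 0 step by simp
    then show ?thesis using E T S by blast
  qed
  \<comment> \<open>\<open>E\<close> is never jumped over: whatever lies strictly below it stays below it after one step.\<close>
  define normal where "normal E \<longleftrightarrow> (\<forall>E'. E' \<epsilon> T \<longrightarrow> subset E' E \<longrightarrow> E' = E \<or> subset (\<sigma> E') E)" for E
  have cmp: "subset E' E \<or> subset (\<sigma> E) E'" if E: "normal E" "E \<epsilon> T" and E': "E' \<epsilon> T" for E E'
    using E'
  proof (rule ind)
    show "definable (\<lambda>s. subset (s 0) E \<or> subset (\<sigma> E) (s 0))" by (intro def_intros)
    show "subset empty E \<or> subset (\<sigma> E) empty" by (simp add: subset_def)
    fix E' assume E': "E' \<epsilon> T" and "subset E' E \<or> subset (\<sigma> E) E'"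
    then consider "E' = E" | "subset (\<sigma> E') E" | "subset (\<sigma> E) E'"
      using E(1) unfolding normal_def by blast
    then show "subset (\<sigma> E') E \<or> subset (\<sigma> E) (\<sigma> E')"
      using inf[OF TZ[OF E']] subset_trans by cases auto
  qed
  have normal: "normal E" if "E \<epsilon> T" for E
    using that
  proof (rule ind)
    show "definable1 normal" unfolding normal_def by (intro def_intros \<sigma>_fo)
    show "normal empty" unfolding normal_def by (auto simp: subset_def intro!: ext_eq)
    fix E assume E: "E \<epsilon> T" "normal E"
    show "normal (\<sigma> E)"
      unfolding normal_def
    proof (intro allI impI)
      fix E' assume E': "E' \<epsilon> T" "subset E' (\<sigma> E)"
      then consider "E' = \<sigma> E" | "subset E' E" using cmp[OF E(2,1) E'(1)] subset_antisym by blast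
      then show "E' = \<sigma> E \<or> subset (\<sigma> E') (\<sigma> E)"
      proof cases
        case 2
        then have "E' = E \<or> subset (\<sigma> E') E" using E(2) E'(1) unfolding normal_def by blast
        then show ?thesis using inf[OF TZ[OF E(1)]] subset_trans subset_refl by blast
      qed simp
    qed
  qed
  show thesis
  proof (rule that)
    show "empty \<epsilon> T" by (rule T0)
    show "\<sigma> E \<epsilon> T" if "E \<epsilon> T" for E using that by (rule T\<sigma>)
    show "subset E Z" if "E \<epsilon> T" for E using that by (rule TZ)
    show "subset E' E \<or> subset (\<sigma> E) E'" if "E \<epsilon> T" "E' \<epsilon> T" for E E'
      using cmp[OF normal[OF that(1)] that] .
    fix P E assume "E \<epsilon> T" and "definable1 P" and "P empty" and "\<And>E. E \<epsilon> T \<Longrightarrow> P E \<Longrightarrow> P (\<sigma> E)"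
    then show "P E" by (rule ind)
  qed
qed

text \<open>
  Let \<open>R\<close> be the graph of a bijection of \<open>Fin X\<close> with a proper subset that omits \<open>a\<close>. The sets
  obtained by adding to the empty set first \<open>a\<close> and then again and again all images under
  \<open>R\<close> are finite and grow forever, and their unions form the required chain of subsets of \<open>X\<close>.
\<close>

lemma D_infinite_imp_endless_chain:
  assumes "\<not> D_finite (Fin X)"
  shows "\<exists>U. endless_chain U \<and> (\<forall>u. u \<epsilon> U \<longrightarrow> subset u X)"
proof -
  obtain B where B: "subset B (Fin X)" "B \<noteq> Fin X" "equipotent (Fin X) B"
    using assms unfolding D_finite_def by blast
  obtain R where R: "definable2 R" "bijrel R (Fin X) B" by (rule equipotentE[OF B(3)])
  obtain a where a: "a \<epsilon> Fin X" "\<not> a \<epsilon> B" using B(1,2) ext_eq unfolding subset_def by metis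
  define \<sigma> where "\<sigma> S = Coll (\<lambda>y. y \<epsilon> S \<or> y = a \<or> (\<exists>x. x \<epsilon> S \<and> R x y))" for S
  have \<sigma>_ex: "\<exists>z. \<forall>y. y \<epsilon> z \<longleftrightarrow> y \<epsilon> S \<or> y = a \<or> (\<exists>x. x \<epsilon> S \<and> R x y)" for S
  proof (rule definable_comprehension[where a = "cup S (ins a B)"])
    show "definable (\<lambda>s. s 0 \<epsilon> S \<or> s 0 = a \<or> (\<exists>x. x \<epsilon> S \<and> R x (s 0)))" by (intro def_intros def_subst2[OF R(1)])
  qed (use bijrel_ran[OF R(2)] in auto)
  have mem_\<sigma>: "y \<epsilon> \<sigma> S \<longleftrightarrow> y \<epsilon> S \<or> y = a \<or> (\<exists>x. x \<epsilon> S \<and> R x y)" for y S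
    unfolding \<sigma>_def by (rule mem_Coll[OF \<sigma>_ex])
  have "def_fun (\<lambda>s. \<sigma> (s 0))" unfolding \<sigma>_def
    by (rule def_fun_Coll[OF \<sigma>_ex]) (intro def_intros def_subst2[OF R(1)])
  moreover have "subset (\<sigma> E) (Fin X)" if "subset E (Fin X)" for E
    using that a B(1) bijrel_ran[OF R(2)] unfolding subset_def mem_\<sigma> by blast
  moreover have "subset E (\<sigma> E)" for E by (simp add: subset_def mem_\<sigma>)
  ultimately obtain T where T: "empty \<epsilon> T" "\<And>E. E \<epsilon> T \<Longrightarrow> \<sigma> E \<epsilon> T" "\<And>E. E \<epsilon> T \<Longrightarrow> subset E (Fin X)"
    and ind: "\<And>P E. E \<epsilon> T \<Longrightarrow> definable1 P \<Longrightarrow> P empty \<Longrightarrow> (\<And>E. E \<epsilon> T \<Longrightarrow> P E \<Longrightarrow> P (\<sigma> E)) \<Longrightarrow> P E"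
    and cmp: "\<And>E E'. E \<epsilon> T \<Longrightarrow> E' \<epsilon> T \<Longrightarrow> subset E' E \<or> subset (\<sigma> E) E'"
    using inflationary_tower[of \<sigma> "Fin X"] by blast
  have fin: "set_finite S" if "S \<epsilon> T" for S
    using that
  proof (rule ind)
    show "definable1 set_finite" by (intro def_intros)
    fix S assume S: "set_finite S"
    obtain I where I: "\<And>y. y \<epsilon> I \<longleftrightarrow> y \<epsilon> B \<and> (\<exists>x. x \<epsilon> S \<and> R x y)"
      by (erule definable_setE) (intro def_intros def_subst2[OF R(1)])
    have "set_finite I" by (rule finite_image[OF S R(1)]) (use bijrel_fun[OF R(2)] I in blast)+
    then have "set_finite (ins a (cup S I))" using S by simp
    then show "set_finite (\<sigma> S)"
      by (rule finite_subset) (use bijrel_ran[OF R(2)] in \<open>auto simp: mem_\<sigma> I\<close>)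
  qed simp
  \<comment> \<open>A finite set closed under the injection \<open>R\<close> and containing \<open>a\<close> would be equipotent to its image, which
      omits \<open>a\<close>.\<close>
  have nofix: "\<sigma> S \<noteq> S" if S: "S \<epsilon> T" for S
  proof
    assume fx: "\<sigma> S = S"
    obtain I where I: "\<And>y. y \<epsilon> I \<longleftrightarrow> y \<epsilon> B \<and> (\<exists>x. x \<epsilon> S \<and> R x y)"
      by (erule definable_setE) (intro def_intros def_subst2[OF R(1)])
    have SX: "subset S (Fin X)" using T(3)[OF S] .
    have "bijrel (\<lambda>x y. x \<epsilon> S \<and> R x y) S I"
      using bijrel_ran[OF R(2)] bijrel_total[OF R(2)] bijrel_fun[OF R(2)] bijrel_inj[OF R(2)] SX
      by (intro bijrelI) (auto simp: I subset_def)
    then have "equipotent S I" by (rule equipotentI[rotated]) (intro def_intros def_subst2[OF R(1)])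
    moreover have "subset I S" using mem_\<sigma>[of _ S] fx I unfolding subset_def by auto
    ultimately have "I = S" using pigeonhole[OF fin[OF S]] by blast
    moreover have "a \<epsilon> S" using mem_\<sigma>[of a S] unfolding fx by blast
    ultimately show False using I a(2) by blast
  qed
  obtain U where U0: "\<And>u. u \<epsilon> U \<longleftrightarrow> u \<epsilon> Fin X \<and> (\<exists>S. S \<epsilon> T \<and> u = Cup S)"
    by (erule definable_setE) (intro def_intros)
  have "Cup S \<epsilon> Fin X" if "S \<epsilon> T" for S
  proof -
    have "subset x X \<and> set_finite x" if "x \<epsilon> S" for x
      using T(3)[OF \<open>S \<epsilon> T\<close>] that unfolding subset_def[of S] by simp
    then show ?thesis using finite_Cup[OF fin[OF that]] by (auto simp: subset_def)
  qed
  then have U: "u \<epsilon> U \<longleftrightarrow> (\<exists>S. S \<epsilon> T \<and> u = Cup S)" for u using U0 by blast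
  have "endless_chain U"
    unfolding endless_chain_def
  proof (intro conjI allI impI)
    show "\<exists>u. u \<epsilon> U" using U T(1) by blast
    show "set_finite u" if "u \<epsilon> U" for u using that U0 by simp
  next
    fix u v assume "u \<epsilon> U" "v \<epsilon> U"
    then obtain S S' where S: "S \<epsilon> T" "u = Cup S" "S' \<epsilon> T" "v = Cup S'" using U by blast
    have "subset S S' \<or> subset S' S"
      using cmp[OF S(1,3)] \<open>\<And>E. subset E (\<sigma> E)\<close> subset_trans by blast
    then show "subset u v \<or> subset v u" unfolding S(2,4) subset_def mem_Cup by blast
  next
    fix u assume "u \<epsilon> U"
    then have fu: "set_finite u" using U0 by simp
    show "\<exists>v. v \<epsilon> U \<and> \<not> subset v u"
    proof (rule ccontr)
      assume "\<not> ?thesis"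
      then have *: "subset (Cup S) u" if "S \<epsilon> T" for S using U that by blast
      \<comment> \<open>If the unions were bounded by \<open>u\<close>, all stages would be sets of subsets of \<open>u\<close>.\<close>
      have "set_finite T"
      proof (rule finite_subset)
        show "set_finite (Power (Power u))" using fu by simp
        show "S \<epsilon> Power (Power u)" if "S \<epsilon> T" for S using *[OF that] by (auto simp: subset_def)
      qed
      moreover have "T \<noteq> empty" using T(1) by auto
      ultimately obtain M where "M \<epsilon> T" "\<forall>y. y \<epsilon> T \<longrightarrow> subset M y \<longrightarrow> y = M"
        using finite_maximal_subset by blast
      then show False using nofix T(2) \<open>\<And>E. subset E (\<sigma> E)\<close> by blast
    qed
  qed
  then show ?thesis using U0 by auto
qed

section \<open>Sums in the Boolean group\<close>

lemma natural_trans: assumes "natural n" "x \<epsilon> n" "y \<epsilon> x" shows "y \<epsilon> n"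
proof -
  have "\<forall>x y. x \<epsilon> n \<longrightarrow> y \<epsilon> x \<longrightarrow> y \<epsilon> n" using assms(1)
    by (induction n rule: natural_induct) (intro def_intros, auto)
  then show ?thesis using assms by blast
qed

lemma zero_mem_succ: "natural n \<Longrightarrow> empty \<epsilon> succ n"
  by (induction n rule: natural_induct) (intro def_intros, auto)

lemma succ_mem_succ: assumes "natural n" "i \<epsilon> n" shows "succ i \<epsilon> succ n"
proof -
  have "\<forall>i. i \<epsilon> n \<longrightarrow> succ i \<epsilon> succ n" using assms(1)
    by (induction n rule: natural_induct) (intro def_intros, auto)
  then show ?thesis using assms by blast
qed

text \<open>
  The value of \<open>app\<close> outside the domain of a function is unspecified, so the definition of
  sums is not visibly definable; membership of pairs in the functions is.
\<close>

lemma is_sum_iff: "is_sum X F z \<longleftrightarrow>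
  (\<exists>n f g. natural n \<and> bijection f n F \<and> func g (succ n) (Fin X) \<and> opair empty empty \<epsilon> g \<and>
    (\<forall>i u w. i \<epsilon> n \<longrightarrow> opair i u \<epsilon> g \<longrightarrow> opair i w \<epsilon> f \<longrightarrow> opair (succ i) (symdiff u w) \<epsilon> g) \<and>
    opair n z \<epsilon> g)"
proof -
  have "(app g empty = empty \<and> (\<forall>i. i \<epsilon> n \<longrightarrow> app g (succ i) = symdiff (app g i) (app f i)) \<and> app g n = z)
      \<longleftrightarrow> (opair empty empty \<epsilon> g \<and>
    (\<forall>i u w. i \<epsilon> n \<longrightarrow> opair i u \<epsilon> g \<longrightarrow> opair i w \<epsilon> f \<longrightarrow> opair (succ i) (symdiff u w) \<epsilon> g) \<and>
    opair n z \<epsilon> g)" if n: "natural n" and f: "bijection f n F" and g: "func g (succ n) (Fin X)" for n f g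
  proof -
    have 1: "opair empty empty \<epsilon> g \<longleftrightarrow> app g empty = empty"
      using app_eq[OF g zero_mem_succ[OF n]] by simp
    have 2: "opair n z \<epsilon> g \<longleftrightarrow> app g n = z" using app_eq[OF g, of n] by simp
    have 3: "(app g (succ i) = symdiff (app g i) (app f i)) \<longleftrightarrow>
      (\<forall>u w. opair i u \<epsilon> g \<longrightarrow> opair i w \<epsilon> f \<longrightarrow> opair (succ i) (symdiff u w) \<epsilon> g)" if i: "i \<epsilon> n" for i
    proof -
      have f': "func f n F" using f by (simp add: bijection_def)
      have "i \<epsilon> succ n" using i by simp
      then show ?thesis
        using app_eq[OF g] app_eq[OF f' i] succ_mem_succ[OF n i] by (simp flip: app_eq[OF g] app_eq[OF f' i])
    qed
    show ?thesis using 1 2 3 by auto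
  qed
  then show ?thesis unfolding is_sum_def by blast
qed

lemma definable_is_sum [def_intros]: "def_fun f \<Longrightarrow> def_fun g \<Longrightarrow> definable (\<lambda>s. is_sum X (f s) (g s))"
  by (rule def_subst2[where R = "is_sum X"]) (unfold is_sum_iff, intro def_intros)

lemma definable_card_le [def_intros]: "def_fun f \<Longrightarrow> def_fun g \<Longrightarrow> definable (\<lambda>s. card_le (f s) (g s))"
  by (rule def_subst2[where R = card_le]) (unfold card_le_def, intro def_intros)

lemma is_sum_Fin: "is_sum X F z \<Longrightarrow> z \<epsilon> Fin X"
  unfolding is_sum_iff using func_mem by blast

lemma mem_FS [simp]:
  "z \<epsilon> FS X Y \<longleftrightarrow> (\<exists>F. subset F Y \<and> set_finite F \<and> F \<noteq> empty \<and> is_sum X F z)"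
  unfolding FS_def by (intro mem_Coll definable_comprehension[where a = "Fin X"] def_intros) (use is_sum_Fin in blast)

lemma mem_FS_le [simp]:
  "z \<epsilon> FS_le n X Y \<longleftrightarrow> (\<exists>F. subset F Y \<and> card_le F n \<and> F \<noteq> empty \<and> is_sum X F z)"
  unfolding FS_le_def by (intro mem_Coll definable_comprehension[where a = "Fin X"] def_intros) (use is_sum_Fin in blast)

lemma FS_le_FS: "z \<epsilon> FS_le n X Y \<Longrightarrow> z \<epsilon> FS X Y"
  unfolding mem_FS mem_FS_le card_le_def set_finite_def by blast

text \<open>
  The partial sums of pairwise disjoint sets are disjoint unions: the next summand is disjoint from
  all earlier ones, hence from their sum.
\<close>

lemma is_sum_closed:
  assumes sum: "is_sum X F z" and ne: "F \<noteq> empty" and FB: "subset F B"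
    and dF: "pairwise_disjoint F"
    and cup: "\<And>u v. u \<epsilon> B \<Longrightarrow> v \<epsilon> B \<Longrightarrow> disj u v \<Longrightarrow> cup u v \<epsilon> B"
  shows "z \<epsilon> B"
proof -
  obtain n f g where n: "natural n" and f: "bijection f n F" and g: "func g (succ n) (Fin X)"
    and g0: "opair empty empty \<epsilon> g"
    and gs: "\<And>i u w. i \<epsilon> n \<Longrightarrow> opair i u \<epsilon> g \<Longrightarrow> opair i w \<epsilon> f \<Longrightarrow> opair (succ i) (symdiff u w) \<epsilon> g"
    and gn: "opair n z \<epsilon> g"
    using sum unfolding is_sum_iff by blast
  have f: "bijrel (\<lambda>x y. opair x y \<epsilon> f) n F" using f by (simp add: bijection_iff)
  have g_fun: "u = v" if "opair i u \<epsilon> g" "opair i v \<epsilon> g" for i u v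
    using g that func_mem[OF g] unfolding func_def by blast
  \<comment> \<open>The second half, that the partial sum is covered by the earlier summands, makes it disjoint from the
      next one.\<close>
  define P where "P i \<longleftrightarrow> (i \<epsilon> succ n \<longrightarrow> (\<forall>u. opair i u \<epsilon> g \<longrightarrow> (i \<noteq> empty \<longrightarrow> u \<epsilon> B) \<and>
    (\<forall>x. x \<epsilon> u \<longrightarrow> (\<exists>j w. j \<epsilon> i \<and> opair j w \<epsilon> f \<and> x \<epsilon> w))))" for i
  have "P n" using n
  proof (induction n rule: natural_induct)
    show "definable1 P" unfolding P_def by (intro def_intros)
    show "P empty" unfolding P_def using g_fun[OF g0] mem_empty by metis
  next
    fix i assume i: "natural i" and IH: "P i"
    show "P (succ i)"
      unfolding P_def
    proof (rule impI, rule allI, rule impI)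
      fix u assume s: "succ i \<epsilon> succ n" and u: "opair (succ i) u \<epsilon> g"
      have iin: "i \<epsilon> n" using s natural_trans[OF n, of "succ i" i] by auto
      have "\<exists>!u. opair i u \<epsilon> g" using g iin unfolding func_def by simp
      then obtain u' where u': "opair i u' \<epsilon> g" by blast
      obtain w where w: "opair i w \<epsilon> f" using bijrel_total[OF f iin] by blast
      have u_eq: "u = symdiff u' w" using g_fun[OF u gs[OF iin u' w]] .
      have wF: "w \<epsilon> F" using bijrel_ran[OF f w] .
      then have wB: "w \<epsilon> B" using FB by (simp add: subset_def)
      have IH': "i \<noteq> empty \<longrightarrow> u' \<epsilon> B"
        "\<And>x. x \<epsilon> u' \<Longrightarrow> \<exists>j w. j \<epsilon> i \<and> opair j w \<epsilon> f \<and> x \<epsilon> w"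
        using IH iin u' unfolding P_def by auto
      have d: "\<not> x \<epsilon> w" if x: "x \<epsilon> u'" for x
      proof -
        obtain j w' where j: "j \<epsilon> i" "opair j w' \<epsilon> f" "x \<epsilon> w'" using IH'(2)[OF x] by blast
        have "w' \<noteq> w" using bijrel_inj[OF f j(2)] w j(1) mem_irrefl by blast
        then show ?thesis using dF wF bijrel_ran[OF f j(2)] j(3) unfolding pairwise_disjoint_def by blast
      qed
      have eq: "u = cup u' w" unfolding u_eq using d by (intro ext_eq) auto
      have "u \<epsilon> B"
      proof (cases "i = empty")
        case True
        then have "u = w" unfolding eq using IH'(2) by (intro ext_eq) auto
        then show ?thesis using wB by simp
      next
        case False
        then show ?thesis unfolding eq using IH'(1) wB d by (intro cup) (auto simp: disj_def)
      qed
      moreover have "\<exists>j w. j \<epsilon> succ i \<and> opair j w \<epsilon> f \<and> x \<epsilon> w" if "x \<epsilon> u" for x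
        using that IH'(2)[of x] w unfolding eq by auto
      ultimately show "(succ i \<noteq> empty \<longrightarrow> u \<epsilon> B) \<and>
        (\<forall>x. x \<epsilon> u \<longrightarrow> (\<exists>j w. j \<epsilon> succ i \<and> opair j w \<epsilon> f \<and> x \<epsilon> w))" by blast
    qed
  qed
  moreover have "n \<noteq> empty" using ne bijrel_onto[OF f] bijrel_dom[OF f] unfolding nonempty by blast
  ultimately show ?thesis using gn unfolding P_def by auto
qed

lemma is_sum_empty: "is_sum X empty empty"
proof -
  obtain f where f: "bijection f empty empty" using equipotent_refl[of empty] unfolding equipotent_def by blast
  have "\<exists>g. func g (succ empty) (Fin X) \<and> (\<forall>x y. opair x y \<epsilon> g \<longleftrightarrow> x = empty \<and> y = empty)"
    by (rule func_from_relation) (intro def_intros, auto simp: subset_def)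
  then obtain g where "func g (succ empty) (Fin X)" "\<And>x y. opair x y \<epsilon> g \<longleftrightarrow> x = empty \<and> y = empty"
    by blast
  then show ?thesis unfolding is_sum_iff using f
    by (intro exI[of _ empty] exI[of _ f] exI[of _ g]) simp
qed

text \<open>
  Extend the enumeration by \<open>u\<close> and the sequence of partial sums by one entry.
\<close>

lemma is_sum_ins:
  assumes sum: "is_sum X F z" and u: "u \<epsilon> Fin X" "\<not> u \<epsilon> F"
  shows "is_sum X (ins u F) (symdiff z u)"
proof -
  obtain n f g where n: "natural n" and f: "bijection f n F" and g: "func g (succ n) (Fin X)"
    and g0: "opair empty empty \<epsilon> g"
    and gs: "\<And>i u w. i \<epsilon> n \<Longrightarrow> opair i u \<epsilon> g \<Longrightarrow> opair i w \<epsilon> f \<Longrightarrow> opair (succ i) (symdiff u w) \<epsilon> g"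
    and gn: "opair n z \<epsilon> g"
    using sum unfolding is_sum_iff by blast
  have ff: "func f n F" and f: "bijrel (\<lambda>x y. opair x y \<epsilon> f) n F" using f by (simp_all add: bijection_iff)
  have f1: "\<exists>!y. opair x y \<epsilon> f" if "x \<epsilon> n" for x using ff that by (simp add: func_def)
  have g1: "\<exists>!y. opair x y \<epsilon> g" if "x \<epsilon> succ n" for x using g that unfolding func_def by blast
  note fmem = func_mem[OF ff] and gmem = func_mem[OF g]
  have nn: "\<not> succ n \<epsilon> succ n" "\<not> n \<epsilon> n" by (rule mem_irrefl)+
  have "\<exists>f'. func f' (succ n) (ins u F) \<and>
      (\<forall>x y. opair x y \<epsilon> f' \<longleftrightarrow> opair x y \<epsilon> f \<or> x = n \<and> y = u)"
  proof (rule func_from_relation)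
    show "definable (\<lambda>s. opair (s 0) (s 1) \<epsilon> f \<or> s 0 = n \<and> s 1 = u)" by (intro def_intros)
    show "\<exists>!y. opair x y \<epsilon> f \<or> x = n \<and> y = u" if "x \<epsilon> succ n" for x
    proof (cases "x = n")
      case True
      then show ?thesis using fmem nn by blast
    next
      case False
      then show ?thesis using f1[of x] that by auto
    qed
  qed (use fmem in auto)
  then obtain f' where f': "func f' (succ n) (ins u F)"
    "\<And>x y. opair x y \<epsilon> f' \<longleftrightarrow> opair x y \<epsilon> f \<or> x = n \<and> y = u" by blast
  have "bijection f' (succ n) (ins u F)"
    unfolding bijection_iff f'(2)
  proof (intro conjI bijrelI f'(1))
    show "\<exists>x. opair x y \<epsilon> f \<or> x = n \<and> y = u" if "y \<epsilon> ins u F" for y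
      using that bijrel_onto[OF f] by auto
    show "\<exists>y. opair x y \<epsilon> f \<or> x = n \<and> y = u" if "x \<epsilon> succ n" for x
      using that bijrel_total[OF f] by auto
    show "y = y'" if "opair x y \<epsilon> f \<or> x = n \<and> y = u" "opair x y' \<epsilon> f \<or> x = n \<and> y' = u" for x y y'
      using that bijrel_fun[OF f] fmem nn(2) by blast
    show "x = x'" if "opair x y \<epsilon> f \<or> x = n \<and> y = u" "opair x' y \<epsilon> f \<or> x' = n \<and> y = u" for x x' y
      using that bijrel_inj[OF f] fmem u(2) by blast
  qed (use fmem in auto)
  moreover have "\<exists>g'. func g' (succ (succ n)) (Fin X) \<and>
      (\<forall>x y. opair x y \<epsilon> g' \<longleftrightarrow> opair x y \<epsilon> g \<or> x = succ n \<and> y = symdiff z u)"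
  proof (rule func_from_relation)
    show "definable (\<lambda>s. opair (s 0) (s 1) \<epsilon> g \<or> s 0 = succ n \<and> s 1 = symdiff z u)" by (intro def_intros)
    show "\<exists>!y. opair x y \<epsilon> g \<or> x = succ n \<and> y = symdiff z u" if "x \<epsilon> succ (succ n)" for x
    proof (cases "x = succ n")
      case True
      then show ?thesis using gmem nn by blast
    next
      case False
      then show ?thesis using g1[of x] that mem_succ by blast
    qed
    have "symdiff z u \<epsilon> Fin X" using is_sum_Fin[OF sum] u(1) by (auto simp: subset_def)
    then show "x \<epsilon> succ (succ n) \<and> y \<epsilon> Fin X" if "opair x y \<epsilon> g \<or> x = succ n \<and> y = symdiff z u" for x y
      using that gmem mem_succ by blast
  qed
  then obtain g' where g': "func g' (succ (succ n)) (Fin X)"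
    "\<And>x y. opair x y \<epsilon> g' \<longleftrightarrow> opair x y \<epsilon> g \<or> x = succ n \<and> y = symdiff z u" by blast
  moreover have "opair (succ i) (symdiff v w) \<epsilon> g'"
    if i: "i \<epsilon> succ n" and v: "opair i v \<epsilon> g'" and w: "opair i w \<epsilon> f'" for i v w
  proof -
    have v': "opair i v \<epsilon> g" using v i nn unfolding g'(2) by blast
    show ?thesis
    proof (cases "i = n")
      case True
      then have "v = z" using v' gn g1[of n] by auto
      moreover have "w = u" using w True fmem nn unfolding f'(2) by blast
      ultimately show ?thesis using True g'(2) by simp
    next
      case False
      then have "i \<epsilon> n" "opair i w \<epsilon> f" using i w f'(2) by simp_all
      then show ?thesis using gs v' g'(2) by blast
    qed
  qed
  ultimately show ?thesis unfolding is_sum_iff using n g0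
    by (intro exI[of _ "succ n"] exI[of _ f'] exI[of _ g']) (simp add: g'(2))
qed

lemma is_sum_single: assumes "u \<epsilon> Fin X" shows "is_sum X (ins u empty) u"
proof -
  have "symdiff empty u = u" by (intro ext_eq) simp
  then show ?thesis using is_sum_ins[OF is_sum_empty assms] by simp
qed

lemma numeral_set_natural [simp]: "natural (numeral_set k)" by (induction k) auto

lemma numeral_set_le: "j \<le> k \<Longrightarrow> numeral_set j \<epsilon> numeral_set k \<or> numeral_set j = numeral_set k"
  by (induction k) (auto simp: le_Suc_eq)

lemma mem_FS_leI:
  assumes "subset F Y" and "equipotent F (numeral_set j)" and "j \<le> k" and "F \<noteq> empty" and "is_sum X F z"
  shows "z \<epsilon> FS_le (numeral_set k) X Y"
  unfolding mem_FS_le card_le_def using assms numeral_set_le[OF assms(3)] numeral_set_natural by blast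

lemma equipotent_numeral_Suc:
  "equipotent F (numeral_set j) \<Longrightarrow> \<not> u \<epsilon> F \<Longrightarrow> equipotent (ins u F) (numeral_set (Suc j))"
  using equipotent_ins[of F "numeral_set j" u "numeral_set j"] by (simp add: succ_ins)

lemma monochromatic_mono:
  "monochromatic c A \<Longrightarrow> (\<And>z. z \<epsilon> B \<Longrightarrow> z \<epsilon> A) \<Longrightarrow> monochromatic c B"
  unfolding monochromatic_def by blast

section \<open>A colouring that changes when sizes double\<close>

text \<open>
  Without the condition that \<open>D\<close> is nonempty the empty set would be a half of itself, and no colouring
  could give a set and its halves different colours.
\<close>

definition half :: "'a \<Rightarrow> 'a \<Rightarrow> bool" where
  "half D y \<longleftrightarrow> D \<noteq> empty \<and> (\<exists>D'. disj D D' \<and> equipotent D D' \<and> y = cup D D')"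

lemma definable_half [def_intros]: "def_fun f \<Longrightarrow> def_fun g \<Longrightarrow> definable (\<lambda>s. half (f s) (g s))"
  by (rule def_subst2[where R = half]) (unfold half_def, intro def_intros)

lemma half_subset: assumes "half D y" shows "subset D y" "D \<noteq> y"
proof -
  obtain D' where D: "D \<noteq> empty" "disj D D'" "equipotent D D'" "y = cup D D'"
    using assms unfolding half_def by blast
  show "subset D y" using D by (simp add: subset_def)
  have "D' \<noteq> empty" using D equipotent_empty by blast
  then obtain x where "x \<epsilon> D'" unfolding nonempty by blast
  then have "x \<epsilon> y" "\<not> x \<epsilon> D" using D by (auto simp: disj_def)
  then show "D \<noteq> y" by blast
qed

lemma half_transfer:
  assumes "half D y" and e: "equipotent y y'"
  shows "\<exists>D'. half D' y' \<and> equipotent D D'"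
proof -
  obtain D2 where D: "D \<noteq> empty" "disj D D2" "equipotent D D2" "y = cup D D2"
    using assms unfolding half_def by blast
  obtain D' where D': "subset D' y'" "equipotent D D'" "equipotent (diff y D) (diff y' D')"
    using equipotent_subset[OF e half_subset(1)[OF assms(1)]] by blast
  have "diff y D = D2" using D by (intro ext_eq) (auto simp: disj_def)
  then have "equipotent D' (diff y' D')"
    using D'(2,3) D(3) equipotent_sym equipotent_trans by metis
  moreover have "D' \<noteq> empty" using D(1) D'(2) equipotent_empty by blast
  moreover have "y' = cup D' (diff y' D')" using D'(1) by (intro ext_eq) (auto simp: subset_def)
  moreover have "disj D' (diff y' D')" by (simp add: disj_def)
  ultimately show ?thesis using D'(2) unfolding half_def by blast
qed

text \<open>
  A finite set has only one cardinality of halves: if \<open>D\<close> were smaller than \<open>E\<close>, so would be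
  their complements, and the whole set would be equipotent to a proper part of itself.
\<close>

lemma half_unique:
  assumes y: "set_finite y" and "half D y" and "half E y"
  shows "equipotent D E"
proof -
  have *: "equipotent D E" if D0: "half D y" and E0: "half E y" and C: "subset C E" "equipotent D C" for D E C
  proof -
    obtain D' where D: "disj D D'" "equipotent D D'" "y = cup D D'"
      using D0 unfolding half_def by blast
    obtain E' where E: "disj E E'" "equipotent E E'" "y = cup E E'"
      using E0 unfolding half_def by blast
    obtain C' where C': "subset C' E'" "equipotent C C'" using equipotent_subset[OF E(2) C(1)] by blast
    have "equipotent D' C'" using D(2) C(2) C'(2) equipotent_sym equipotent_trans by metis
    then have "equipotent y (cup C C')" unfolding D(3)
      by (intro equipotent_cup C D(1)) (use E C C' in \<open>auto simp: disj_def subset_def\<close>)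
    moreover have "subset (cup C C') y" unfolding E(3) using C C' by (auto simp: subset_def)
    ultimately have "cup C C' = y" using pigeonhole[OF y] by blast
    then have "x \<epsilon> C \<or> x \<epsilon> C'" if "x \<epsilon> E" for x using that E(3) mem_cup by metis
    then have "C = E" using C(1) C'(1) E(1) by (intro ext_eq) (auto simp: disj_def subset_def)
    then show ?thesis using C(2) by simp
  qed
  have "set_finite D" using y half_subset(1)[OF assms(2)] by (auto simp: subset_def intro: finite_subset)
  then show ?thesis using finite_comparable[of D E] *[OF assms(2,3)] *[OF assms(3,2)] equipotent_sym by blast
qed

text \<open>
  \<open>S\<close> consists of the nonempty sets for which the exponent of 2 in the number of elements is odd. The
  recursion that describes \<open>S\<close> is not monotone, but two steps of it are; \<open>S\<close> is the least fixed
  point of the double step, and induction on finite sets shows that it solves the original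
  recursion.
\<close>

lemma halving_set:
  "\<exists>S. \<forall>y. set_finite y \<longrightarrow> subset y X \<longrightarrow> (y \<epsilon> S \<longleftrightarrow> (\<exists>D. half D y \<and> \<not> D \<epsilon> S))"
proof -
  \<comment> \<open>\<open>G\<close> is two steps of the recursion: some half of \<open>y\<close> has all its halves in \<open>Q\<close>.\<close>
  define G where "G Q y \<longleftrightarrow> y \<epsilon> Fin X \<and> (\<exists>D. half D y \<and> (\<forall>E. half E D \<longrightarrow> E \<epsilon> Q))" for Q y
  have G_definable: "definable2 G" unfolding G_def by (intro def_intros)
  obtain S where S: "\<And>y. y \<epsilon> S \<longleftrightarrow> y \<epsilon> Fin X \<and> (\<forall>Q. (\<forall>y. G Q y \<longrightarrow> y \<epsilon> Q) \<longrightarrow> y \<epsilon> Q)"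
    by (erule definable_setE) (intro def_intros def_subst2[OF G_definable])
  have mono: "G Q' y" if "G Q y" "\<And>x. x \<epsilon> Q \<Longrightarrow> x \<epsilon> Q'" for Q Q' y
    using that unfolding G_def by blast
  have GS: "y \<epsilon> S" if "G S y" for y
    unfolding S using mono[OF that] S that by (auto simp: G_def)
  obtain Q where Q: "\<And>y. y \<epsilon> Q \<longleftrightarrow> y \<epsilon> Fin X \<and> G S y"
    by (erule definable_setE) (intro def_intros def_subst2[OF G_definable])
  have "y \<epsilon> Q" if "G Q y" for y
    using mono[OF that, of S] Q GS that by (auto simp: G_def)
  then have SG: "G S y" if "y \<epsilon> S" for y using that S Q by blast
  have "subset y X \<longrightarrow> (y \<epsilon> S \<longleftrightarrow> (\<exists>D. half D y \<and> \<not> D \<epsilon> S))" if "set_finite y" for y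
    using that
  proof (induction y rule: finite_strong_induct)
    show "definable (\<lambda>s. subset (s 0) X \<longrightarrow> (s 0 \<epsilon> S \<longleftrightarrow> (\<exists>D. half D (s 0) \<and> \<not> D \<epsilon> S)))" by (intro def_intros)
    fix y assume y: "set_finite y"
      and IH: "\<And>D. subset D y \<Longrightarrow> D \<noteq> y \<Longrightarrow> subset D X \<longrightarrow> (D \<epsilon> S \<longleftrightarrow> (\<exists>E. half E D \<and> \<not> E \<epsilon> S))"
    show "subset y X \<longrightarrow> (y \<epsilon> S \<longleftrightarrow> (\<exists>D. half D y \<and> \<not> D \<epsilon> S))"
    proof
      assume yX: "subset y X"
      have "D \<epsilon> S \<longleftrightarrow> (\<exists>E. half E D \<and> \<not> E \<epsilon> S)" if "half D y" for D
        using IH[OF half_subset[OF that]] half_subset(1)[OF that] yX subset_trans by blast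
      then have "G S y \<longleftrightarrow> (\<exists>D. half D y \<and> \<not> D \<epsilon> S)"
        unfolding G_def using y yX mem_Fin by blast
      then show "y \<epsilon> S \<longleftrightarrow> (\<exists>D. half D y \<and> \<not> D \<epsilon> S)" using GS SG by blast
    qed
  qed
  then show ?thesis by blast
qed

text \<open>
  Colour by membership in the set of the previous lemma. Since equipotent sets have the same colour
  and all halves of a set are equipotent, no half of a set has the colour of that set.
\<close>

lemma alternating_coloring:
  "\<exists>c. coloring X c \<and> (\<forall>D y. y \<epsilon> Fin X \<longrightarrow> half D y \<longrightarrow> app c D \<noteq> app c y)"
proof -
  obtain S where S: "\<And>y. set_finite y \<Longrightarrow> subset y X \<Longrightarrow> y \<epsilon> S \<longleftrightarrow> (\<exists>D. half D y \<and> \<not> D \<epsilon> S)"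
    using halving_set by blast
  have inv: "\<forall>y'. subset y X \<longrightarrow> subset y' X \<longrightarrow> equipotent y y' \<longrightarrow> (y \<epsilon> S \<longleftrightarrow> y' \<epsilon> S)"
    if "set_finite y" for y
    using that
  proof (induction y rule: finite_strong_induct)
    show "definable (\<lambda>s. \<forall>y'. subset (s 0) X \<longrightarrow> subset y' X \<longrightarrow> equipotent (s 0) y' \<longrightarrow> (s 0 \<epsilon> S \<longleftrightarrow> y' \<epsilon> S))"
      by (intro def_intros)
    fix y assume y: "set_finite y" and IH: "\<And>D. subset D y \<Longrightarrow> D \<noteq> y \<Longrightarrow>
      \<forall>D'. subset D X \<longrightarrow> subset D' X \<longrightarrow> equipotent D D' \<longrightarrow> (D \<epsilon> S \<longleftrightarrow> D' \<epsilon> S)"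
    show "\<forall>y'. subset y X \<longrightarrow> subset y' X \<longrightarrow> equipotent y y' \<longrightarrow> (y \<epsilon> S \<longleftrightarrow> y' \<epsilon> S)"
    proof (intro allI impI)
      fix y' assume X: "subset y X" "subset y' X" and e: "equipotent y y'"
      have IH': "D \<epsilon> S \<longleftrightarrow> D' \<epsilon> S" if "half D y" "half D' y'" "equipotent D D'" for D D'
        using IH[OF half_subset[OF that(1)]] half_subset(1)[OF that(1)] half_subset(1)[OF that(2)]
          X that(3) subset_trans by blast
      have "(\<exists>D. half D y \<and> \<not> D \<epsilon> S) \<longleftrightarrow> (\<exists>D. half D y' \<and> \<not> D \<epsilon> S)"
        using IH' half_transfer[OF _ e] half_transfer[OF _ equipotent_sym[OF e]] equipotent_sym by meson
      then show "y \<epsilon> S \<longleftrightarrow> y' \<epsilon> S" using S y X finite_equipotent[OF y e] by blast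
    qed
  qed
  have alt: "D \<epsilon> S \<longleftrightarrow> \<not> y \<epsilon> S" if y: "set_finite y" "subset y X" and h: "half D y" for D y
  proof
    have fin: "subset E X \<and> set_finite E" if "half E y" for E
      using half_subset(1)[OF that] y subset_trans by (blast intro: finite_subset[OF y(1)] dest: subset_def[THEN iffD1])
    assume D: "D \<epsilon> S"
    show "\<not> y \<epsilon> S"
    proof
      assume "y \<epsilon> S"
      then obtain E where E: "half E y" "\<not> E \<epsilon> S" using S[OF y] by blast
      then show False using inv[of D] fin[OF h] fin[OF E(1)] half_unique[OF y(1) h E(1)] D by blast
    qed
  next
    assume "\<not> y \<epsilon> S"
    then show "D \<epsilon> S" using S[OF y] h by blast
  qed
  have two: "x \<epsilon> numeral_set 2 \<longleftrightarrow> x = empty \<or> x = succ empty" for x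
    by (auto simp: numeral_2_eq_2)
  have ne: "empty \<noteq> succ empty" by (metis mem_empty mem_succ)
  have "\<exists>c. func c (Fin X) (numeral_set 2) \<and>
    (\<forall>x y. opair x y \<epsilon> c \<longleftrightarrow> x \<epsilon> Fin X \<and> (x \<epsilon> S \<and> y = empty \<or> \<not> x \<epsilon> S \<and> y = succ empty))"
  proof (rule func_from_relation)
    show "definable (\<lambda>s. s 0 \<epsilon> Fin X \<and> (s 0 \<epsilon> S \<and> s 1 = empty \<or> \<not> s 0 \<epsilon> S \<and> s 1 = succ empty))"
      by (intro def_intros)
  qed (auto simp: two)
  then obtain c where c: "func c (Fin X) (numeral_set 2)"
    "\<And>x y. opair x y \<epsilon> c \<longleftrightarrow> x \<epsilon> Fin X \<and> (x \<epsilon> S \<and> y = empty \<or> \<not> x \<epsilon> S \<and> y = succ empty)" by blast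
  have val: "app c x = (if x \<epsilon> S then empty else succ empty)" if "x \<epsilon> Fin X" for x
    using that unfolding app_eq[OF c(1) that] c(2) by simp
  have "app c D \<noteq> app c y" if y: "y \<epsilon> Fin X" and h: "half D y" for D y
  proof -
    have "D \<epsilon> Fin X" using y half_subset(1)[OF h] subset_trans by (auto simp: subset_def intro: finite_subset)
    then show ?thesis using val y alt[OF _ _ h] ne ne[symmetric] by auto
  qed
  then show ?thesis using c(1) unfolding coloring_def by blast
qed

section \<open>Dedekind-finite families have no monochromatic sums\<close>

lemma infinite_outside: "\<not> set_finite Y \<Longrightarrow> set_finite D \<Longrightarrow> \<exists>y. y \<epsilon> Y \<and> \<not> y \<epsilon> D"
  using finite_subset by blast

definition embeds :: "'a \<Rightarrow> 'a \<Rightarrow> bool" where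
  "embeds y z \<longleftrightarrow> (\<exists>C. subset C z \<and> equipotent y C)"

lemma definable_embeds [def_intros]: "def_fun f \<Longrightarrow> def_fun g \<Longrightarrow> definable (\<lambda>s. embeds (f s) (g s))"
  unfolding embeds_def by (intro def_intros def_fun_shift)

lemma embeds_trans: assumes "embeds x y" "embeds y z" shows "embeds x z"
proof -
  obtain C C' where C: "subset C y" "equipotent x C" "subset C' z" "equipotent y C'"
    using assms unfolding embeds_def by blast
  obtain D where "subset D C'" "equipotent C D" using equipotent_subset[OF C(4,1)] by blast
  then show ?thesis unfolding embeds_def using C subset_trans equipotent_trans by blast
qed

text \<open>
  Otherwise, for each \<open>z\<close> in \<open>Y\<close>, only finitely many members of \<open>Y\<close> have at most as many elements
  as \<open>z\<close>, and the unions of these finite families form an endless chain of finite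
  subsets of \<open>X\<close>.
\<close>

lemma infinite_class:
  assumes D: "D_finite (Fin X)" and Y: "subset Y (Fin X)" "\<not> set_finite Y"
  shows "\<exists>z Y'. set_finite z \<and> subset Y' Y \<and> \<not> set_finite Y' \<and> (\<forall>y. y \<epsilon> Y' \<longrightarrow> equipotent y z)"
proof (rule ccontr)
  assume neg: "\<not> ?thesis"
  have Yfin: "subset y X" "set_finite y" if "y \<epsilon> Y" for y using Y(1) that by (auto simp: subset_def[of Y])
  have W_ex: "\<exists>W. set_finite W \<and> (\<forall>y. y \<epsilon> W \<longleftrightarrow> y \<epsilon> Y \<and> embeds y z)" if z: "z \<epsilon> Y" for z
  proof -
    obtain W where W: "\<And>y. y \<epsilon> W \<longleftrightarrow> y \<epsilon> Y \<and> embeds y z"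
      by (erule definable_setE) (intro def_intros)
    have "\<exists>D. set_finite D \<and> (\<forall>C y. C \<epsilon> Power z \<longrightarrow> y \<epsilon> Y \<and> equipotent y C \<longrightarrow> y \<epsilon> D)"
    proof (rule finite_indexed_union)
      show "set_finite (Power z)" using Yfin z by simp
      show "definable (\<lambda>s. s 1 \<epsilon> Y \<and> equipotent (s 1) (s 0))" by (intro def_intros)
      fix C assume "C \<epsilon> Power z"
      then have C: "set_finite C" using Yfin(2)[OF z] by (auto simp: subset_def intro: finite_subset)
      have "\<exists>Y'. \<forall>y. y \<epsilon> Y' \<longleftrightarrow> y \<epsilon> Y \<and> equipotent y C" by (rule definable_separation) (intro def_intros)
      then obtain Y' where Y': "\<And>y. y \<epsilon> Y' \<longleftrightarrow> y \<epsilon> Y \<and> equipotent y C" by blast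
      then have "set_finite Y'" using neg C unfolding subset_def by blast
      then show "\<exists>D. set_finite D \<and> (\<forall>y. y \<epsilon> Y \<and> equipotent y C \<longrightarrow> y \<epsilon> D)" using Y' by blast
    qed
    then obtain D where "set_finite D" "\<And>C y. C \<epsilon> Power z \<Longrightarrow> y \<epsilon> Y \<Longrightarrow> equipotent y C \<Longrightarrow> y \<epsilon> D" by blast
    then have "set_finite W" by (elim finite_subset) (auto simp: W embeds_def)
    then show ?thesis using W by blast
  qed
  obtain U where U: "\<And>u. u \<epsilon> U \<longleftrightarrow> u \<epsilon> Fin X \<and>
      (\<exists>z W. z \<epsilon> Y \<and> (\<forall>y. y \<epsilon> W \<longleftrightarrow> y \<epsilon> Y \<and> embeds y z) \<and> u = Cup W)"
    by (erule definable_setE) (intro def_intros)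
  have U_ex: "\<exists>u. u \<epsilon> U \<and> (\<forall>x. x \<epsilon> u \<longleftrightarrow> (\<exists>y. x \<epsilon> y \<and> y \<epsilon> Y \<and> embeds y z))" if z: "z \<epsilon> Y" for z
  proof -
    obtain W where W: "set_finite W" "\<And>y. y \<epsilon> W \<longleftrightarrow> y \<epsilon> Y \<and> embeds y z" using W_ex[OF z] by blast
    have "set_finite (Cup W)" using W Yfin by (intro finite_Cup) simp_all
    moreover have "subset (Cup W) X" using W(2) Yfin(1) unfolding subset_def[of "Cup W"] mem_Cup
      by (metis subset_def)
    ultimately have "Cup W \<epsilon> U" using U W z by auto
    then show ?thesis using W(2) by (intro exI[of _ "Cup W"]) simp
  qed
  have U_mem: "\<exists>z. z \<epsilon> Y \<and> (\<forall>x. x \<epsilon> u \<longleftrightarrow> (\<exists>y. x \<epsilon> y \<and> y \<epsilon> Y \<and> embeds y z))" if "u \<epsilon> U" for u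
    using that U mem_Cup by metis
  have "endless_chain U"
    unfolding endless_chain_def
  proof (intro conjI allI impI)
    obtain z where "z \<epsilon> Y" using infinite_outside[OF Y(2) finite_empty] by blast
    then show "\<exists>u. u \<epsilon> U" using U_ex by blast
    show "set_finite u" if "u \<epsilon> U" for u using that U by simp
  next
    fix u v assume uv: "u \<epsilon> U" "v \<epsilon> U"
    obtain z where z: "z \<epsilon> Y" "\<And>x. x \<epsilon> u \<longleftrightarrow> (\<exists>y. x \<epsilon> y \<and> y \<epsilon> Y \<and> embeds y z)"
      using U_mem[OF uv(1)] by blast
    obtain w where w: "w \<epsilon> Y" "\<And>x. x \<epsilon> v \<longleftrightarrow> (\<exists>y. x \<epsilon> y \<and> y \<epsilon> Y \<and> embeds y w)" using U_mem[OF uv(2)] by blast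
    have "embeds z w \<or> embeds w z"
      using finite_comparable[OF Yfin(2)[OF z(1)], of w] unfolding embeds_def by blast
    then show "subset u v \<or> subset v u" unfolding subset_def z(2) w(2) using embeds_trans by blast
  next
    fix u assume u: "u \<epsilon> U"
    show "\<exists>v. v \<epsilon> U \<and> \<not> subset v u"
    proof (rule ccontr)
      assume max: "\<not> ?thesis"
      have "subset y u" if y: "y \<epsilon> Y" for y
      proof -
        obtain v where v: "v \<epsilon> U" "\<And>x. x \<epsilon> v \<longleftrightarrow> (\<exists>y'. x \<epsilon> y' \<and> y' \<epsilon> Y \<and> embeds y' y)"
          using U_ex[OF y] by blast
        have "embeds y y" unfolding embeds_def using equipotent_refl subset_refl by blast
        then have "subset y v" unfolding subset_def v(2) using y by blast
        then show ?thesis using max v(1) subset_trans by blast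
      qed
      moreover have fu: "set_finite u" using u U by simp
      ultimately have "set_finite Y" using finite_subset[OF finite_Power[OF fu], of Y] by simp
      then show False using Y(2) by simp
    qed
  qed
  then show False using endless_chain_imp_D_infinite[of U X] U D by auto
qed

text \<open>
  Two disjoint members \<open>u\<close> and \<open>v\<close> of the same size: \<open>u\<close> is a half of the sum of \<open>u\<close> and \<open>v\<close>.
\<close>

lemma D_finite_imp_HD2:
  assumes D: "D_finite (Fin X)"
  shows "\<exists>c. coloring X c \<and> (\<forall>Y. subset Y (Fin X) \<and> \<not> set_finite Y \<and> pairwise_disjoint Y \<longrightarrow>
    \<not> monochromatic c (FS_le (numeral_set 2) X Y))"
proof -
  obtain c where c: "coloring X c" "\<And>D y. y \<epsilon> Fin X \<Longrightarrow> half D y \<Longrightarrow> app c D \<noteq> app c y"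
    using alternating_coloring by blast
  have "\<not> monochromatic c (FS_le (numeral_set 2) X Y)"
    if Y: "subset Y (Fin X)" "\<not> set_finite Y" "pairwise_disjoint Y" for Y
  proof
    assume mono: "monochromatic c (FS_le (numeral_set 2) X Y)"
    obtain z Y' where Y': "subset Y' Y" "\<not> set_finite Y'" "\<And>y. y \<epsilon> Y' \<Longrightarrow> equipotent y z"
      using infinite_class[OF D Y(1,2)] by blast
    obtain u where u: "u \<epsilon> Y'" "u \<noteq> empty" using infinite_outside[OF Y'(2), of "ins empty empty"] by auto
    obtain v where v: "v \<epsilon> Y'" "v \<noteq> u" using infinite_outside[OF Y'(2), of "ins u empty"] by auto
    have uv: "u \<epsilon> Y" "v \<epsilon> Y" using u v Y'(1) by (auto simp: subset_def)
    then have uvF: "u \<epsilon> Fin X" "v \<epsilon> Fin X" using Y(1) unfolding subset_def by blast+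
    have d: "disj u v" using Y(3) uv v(2) unfolding pairwise_disjoint_def disj_def by metis
    have eq: "symdiff u v = cup u v" using d by (intro ext_eq) (auto simp: disj_def)
    have "equipotent u v" using Y'(3)[OF u(1)] Y'(3)[OF v(1)] equipotent_sym equipotent_trans by blast
    then have "half u (cup u v)" unfolding half_def using u(2) d by blast
    moreover have "cup u v \<epsilon> Fin X" using uvF by (auto simp: subset_def)
    moreover have 1: "equipotent (ins u empty) (numeral_set 1)"
      using equipotent_numeral_Suc[of empty 0 u] by simp
    have "u \<epsilon> FS_le (numeral_set 2) X Y"
    proof (rule mem_FS_leI[OF _ 1])
      show "is_sum X (ins u empty) u" by (rule is_sum_single[OF uvF(1)])
    qed (use uv nonempty in \<open>auto simp: subset_def\<close>)
    moreover have "cup u v \<epsilon> FS_le (numeral_set 2) X Y"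
    proof (rule mem_FS_leI)
      show "is_sum X (ins v (ins u empty)) (cup u v)"
        unfolding eq[symmetric] using v(2) by (intro is_sum_ins is_sum_single uvF) simp
      show "equipotent (ins v (ins u empty)) (numeral_set 2)"
        using equipotent_numeral_Suc[OF 1, of v] v(2) by (simp add: numeral_2_eq_2)
    qed (use uv nonempty in \<open>auto simp: subset_def\<close>)
    ultimately show False using mono c(2) unfolding monochromatic_def by blast
  qed
  then show ?thesis using c(1) by blast
qed

text \<open>
  Choose \<open>K\<close> of the largest possible size among the sets contained in infinitely many members of
  \<open>Y\<close>. A point outside \<open>K\<close> lies in only finitely many of the members that contain \<open>K\<close>, so
  every finite \<open>T\<close> is avoided, outside \<open>K\<close>, by one of them.
\<close>

lemma sunflower_kernel:
  assumes Y: "\<not> set_finite Y" "\<And>y. y \<epsilon> Y \<Longrightarrow> equipotent y z" and z: "set_finite z"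
  shows "\<exists>K. \<forall>T. set_finite T \<longrightarrow> (\<exists>y. y \<epsilon> Y \<and> subset K y \<and> y \<noteq> K \<and> (\<forall>x. x \<epsilon> y \<longrightarrow> x \<epsilon> T \<longrightarrow> x \<epsilon> K))"
proof -
  \<comment> \<open>Infinitely many members of \<open>Y\<close> contain \<open>K\<close>, expressed without forming their set.\<close>
  define many where "many K \<longleftrightarrow> (\<forall>D. set_finite D \<longrightarrow> (\<exists>y. y \<epsilon> Y \<and> subset K y \<and> \<not> y \<epsilon> D))" for K
  have many_definable: "definable1 many" unfolding many_def by (intro def_intros)
  obtain S where S: "\<And>C. C \<epsilon> S \<longleftrightarrow> C \<epsilon> Power z \<and> (\<exists>K. many K \<and> equipotent K C)"
    by (erule definable_setE) (intro def_intros def_subst1[OF many_definable])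
  have "many empty" unfolding many_def using infinite_outside[OF Y(1)] by (auto simp: subset_def)
  then have "empty \<epsilon> S" unfolding S using equipotent_refl by (auto simp: subset_def)
  then have "S \<noteq> empty" by auto
  moreover have "set_finite S" using finite_Power[OF z] S by (blast intro: finite_subset)
  ultimately obtain C where C: "C \<epsilon> S" "\<And>C'. C' \<epsilon> S \<Longrightarrow> subset C C' \<Longrightarrow> C' = C"
    using finite_maximal_subset by blast
  then obtain K where K: "many K" "equipotent K C" using S by blast
  have Cz: "subset C z" using C(1) S by simp
  \<comment> \<open>Adding \<open>x\<close> to \<open>K\<close> and a point of \<open>z\<close> outside \<open>C\<close> to \<open>C\<close> would contradict the maximality of \<open>C\<close>.\<close>
  have few: "\<not> many (ins x K)" if x: "\<not> x \<epsilon> K" for x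
  proof
    assume m: "many (ins x K)"
    then obtain y where y: "y \<epsilon> Y" "subset (ins x K) y"
      unfolding many_def using finite_empty by blast
    have fy: "set_finite y" using finite_equipotent[OF z] Y(2)[OF y(1)] equipotent_sym by blast
    have "C \<noteq> z"
    proof
      assume "C = z"
      then have "equipotent y K" using Y(2)[OF y(1)] K(2) equipotent_sym equipotent_trans by blast
      moreover have "subset K y" using y(2) by (simp add: subset_def)
      ultimately have "K = y" using pigeonhole[OF fy] by blast
      then show False using x y(2) by (simp add: subset_def)
    qed
    then obtain w where w: "w \<epsilon> z" "\<not> w \<epsilon> C" using Cz ext_eq unfolding subset_def by metis
    have "ins w C \<epsilon> S" unfolding S using m equipotent_ins[OF K(2) x w(2)] w(1) Cz
      by (auto simp: subset_def)
    then have "ins w C = C" using C(2)[of "ins w C"] by (simp add: subset_def)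
    then show False using w(2) mem_ins by metis
  qed
  have "\<exists>y. y \<epsilon> Y \<and> subset K y \<and> y \<noteq> K \<and> (\<forall>x. x \<epsilon> y \<longrightarrow> x \<epsilon> T \<longrightarrow> x \<epsilon> K)" if T: "set_finite T" for T
  proof -
    have "\<exists>D. set_finite D \<and> (\<forall>x y. x \<epsilon> diff T K \<longrightarrow> y \<epsilon> Y \<and> subset (ins x K) y \<longrightarrow> y \<epsilon> D)"
    proof (rule finite_indexed_union)
      show "set_finite (diff T K)" using T by simp
      show "definable (\<lambda>s. s 1 \<epsilon> Y \<and> subset (ins (s 0) K) (s 1))" by (intro def_intros)
      show "\<exists>D. set_finite D \<and> (\<forall>y. y \<epsilon> Y \<and> subset (ins x K) y \<longrightarrow> y \<epsilon> D)" if "x \<epsilon> diff T K" for x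
        using few[of x] that unfolding many_def by auto
    qed
    then obtain D where D: "set_finite D"
      "\<And>x y. x \<epsilon> diff T K \<Longrightarrow> y \<epsilon> Y \<Longrightarrow> subset (ins x K) y \<Longrightarrow> y \<epsilon> D" by blast
    have "set_finite (ins K D)" using D(1) by simp
    then obtain y where y: "y \<epsilon> Y" "subset K y" "\<not> y \<epsilon> ins K D" using K(1) unfolding many_def by blast
    have "x \<epsilon> K" if "x \<epsilon> y" "x \<epsilon> T" for x
    proof (rule ccontr)
      assume "\<not> x \<epsilon> K"
      then have "y \<epsilon> D" using D(2)[of x y] y that by (auto simp: subset_def)
      then show False using y(3) by simp
    qed
    then show ?thesis using y by auto
  qed
  then show ?thesis by blast
qed

text \<open>
  The kernel lemma yields four sets of equal size that pairwise meet exactly in \<open>K\<close>. In a sum of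
  two or of four of them the kernel cancels, and what remains is the disjoint union of two or of
  four sets of one size; the former is a half of the latter.
\<close>

lemma D_finite_imp_HB4:
  assumes D: "D_finite (Fin X)"
  shows "\<exists>c. coloring X c \<and> (\<forall>Y. subset Y (Fin X) \<and> \<not> set_finite Y \<longrightarrow>
    \<not> monochromatic c (FS_le (numeral_set 4) X Y))"
proof -
  obtain c where c: "coloring X c" "\<And>D y. y \<epsilon> Fin X \<Longrightarrow> half D y \<Longrightarrow> app c D \<noteq> app c y"
    using alternating_coloring by blast
  have "\<not> monochromatic c (FS_le (numeral_set 4) X Y)"
    if Y: "subset Y (Fin X)" "\<not> set_finite Y" for Y
  proof
    assume mono: "monochromatic c (FS_le (numeral_set 4) X Y)"
    obtain z Y' where z: "set_finite z" and Y': "subset Y' Y" "\<not> set_finite Y'" "\<And>y. y \<epsilon> Y' \<Longrightarrow> equipotent y z"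
      using infinite_class[OF D Y(1,2)] by blast
    obtain K where K: "\<And>T. set_finite T \<Longrightarrow>
        \<exists>y. y \<epsilon> Y' \<and> subset K y \<and> y \<noteq> K \<and> (\<forall>x. x \<epsilon> y \<longrightarrow> x \<epsilon> T \<longrightarrow> x \<epsilon> K)"
      using sunflower_kernel[OF Y'(2,3) z] by blast
    have fin: "set_finite y" "y \<epsilon> Fin X" "y \<epsilon> Y" if "y \<epsilon> Y'" for y
      using that Y'(1) Y(1) unfolding subset_def[of Y] subset_def[of Y'] by auto
    obtain u1 where u1: "u1 \<epsilon> Y'" "subset K u1" "u1 \<noteq> K" using K[OF finite_empty] by blast
    obtain u2 where u2: "u2 \<epsilon> Y'" "subset K u2" "u2 \<noteq> K" "\<And>x. x \<epsilon> u2 \<Longrightarrow> x \<epsilon> u1 \<Longrightarrow> x \<epsilon> K"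
      using K[OF fin(1)[OF u1(1)]] by blast
    have f12: "set_finite (cup u1 u2)" using fin(1)[OF u1(1)] fin(1)[OF u2(1)] by simp
    obtain u3 where u3: "u3 \<epsilon> Y'" "subset K u3" "u3 \<noteq> K" "\<And>x. x \<epsilon> u3 \<Longrightarrow> x \<epsilon> cup u1 u2 \<Longrightarrow> x \<epsilon> K"
      using K[OF f12] by blast
    have f123: "set_finite (cup (cup u1 u2) u3)" using f12 fin(1)[OF u3(1)] by simp
    obtain u4 where u4: "u4 \<epsilon> Y'" "subset K u4" "u4 \<noteq> K" "\<And>x. x \<epsilon> u4 \<Longrightarrow> x \<epsilon> cup (cup u1 u2) u3 \<Longrightarrow> x \<epsilon> K"
      using K[OF f123] by blast
    note us = u1 u2(1,2,3) u3(1,2,3) u4(1,2,3)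
    have Ku: "\<exists>x. x \<epsilon> u \<and> \<not> x \<epsilon> K" if "subset K u" "u \<noteq> K" for u
      using that ext_eq unfolding subset_def by metis
    have ne: "u2 \<noteq> u1" "u3 \<noteq> u1" "u3 \<noteq> u2" "u4 \<noteq> u1" "u4 \<noteq> u2" "u4 \<noteq> u3"
      using Ku u2(2,3,4) u3(2,3,4) u4(2,3,4) mem_cup by metis+
    let ?p = "\<lambda>u. diff u K"
    have K_in: "x \<epsilon> u1" "x \<epsilon> u2" "x \<epsilon> u3" "x \<epsilon> u4" if "x \<epsilon> K" for x
      using that us unfolding subset_def by blast+
    have s2: "symdiff u1 u2 = cup (?p u1) (?p u2)"
    proof (rule ext_eq)
      show "x \<epsilon> symdiff u1 u2 \<longleftrightarrow> x \<epsilon> cup (?p u1) (?p u2)" for x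
        using K_in[of x] u2(4)[of x] by auto
    qed
    have s4: "symdiff (symdiff (symdiff u1 u2) u3) u4 = cup (cup (?p u1) (?p u2)) (cup (?p u3) (?p u4))"
      unfolding s2
    proof (rule ext_eq)
      show "x \<epsilon> symdiff (symdiff (cup (?p u1) (?p u2)) u3) u4 \<longleftrightarrow>
          x \<epsilon> cup (cup (?p u1) (?p u2)) (cup (?p u3) (?p u4))" for x
        using K_in[of x] u2(4)[of x] u3(4)[of x] u4(4)[of x]
        unfolding mem_symdiff mem_cup mem_diff by argo
    qed
    have eqp: "equipotent (?p u) (?p v)" if "u \<epsilon> Y'" "v \<epsilon> Y'" "subset K u" "subset K v" for u v
      by (rule equipotent_diff[OF fin(1)[OF that(2)] that(3,4)
            equipotent_trans[OF Y'(3)[OF that(1)] equipotent_sym[OF Y'(3)[OF that(2)]]]])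
    have "half (cup (?p u1) (?p u2)) (cup (cup (?p u1) (?p u2)) (cup (?p u3) (?p u4)))"
      unfolding half_def
    proof (intro conjI exI[of _ "cup (?p u3) (?p u4)"])
      show "cup (?p u1) (?p u2) \<noteq> empty" unfolding nonempty using Ku[OF u1(2,3)] by auto
      show "equipotent (cup (?p u1) (?p u2)) (cup (?p u3) (?p u4))"
        by (intro equipotent_cup eqp us) (use u2(4) u4(4) in \<open>auto simp: disj_def\<close>)
      show "disj (cup (?p u1) (?p u2)) (cup (?p u3) (?p u4))"
        using u3(4) u4(4) by (auto simp: disj_def)
    qed simp
    moreover have c1: "equipotent (ins u1 empty) (numeral_set 1)"
      using equipotent_numeral_Suc[of empty 0 u1] by simp
    have c2: "equipotent (ins u2 (ins u1 empty)) (numeral_set 2)"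
      using equipotent_numeral_Suc[OF c1, of u2] ne by (simp add: numeral_2_eq_2)
    have c3: "equipotent (ins u3 (ins u2 (ins u1 empty))) (numeral_set 3)"
      using equipotent_numeral_Suc[OF c2, of u3] ne by (simp add: eval_nat_numeral)
    have c4: "equipotent (ins u4 (ins u3 (ins u2 (ins u1 empty)))) (numeral_set 4)"
      using equipotent_numeral_Suc[OF c3, of u4] ne by (simp add: eval_nat_numeral)
    have uY: "u1 \<epsilon> Y" "u2 \<epsilon> Y" "u3 \<epsilon> Y" "u4 \<epsilon> Y" and uF: "u1 \<epsilon> Fin X" "u2 \<epsilon> Fin X" "u3 \<epsilon> Fin X" "u4 \<epsilon> Fin X"
      using fin us by blast+
    have i2: "is_sum X (ins u2 (ins u1 empty)) (symdiff u1 u2)"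
      using ne by (intro is_sum_ins is_sum_single uF) simp
    have i4: "is_sum X (ins u4 (ins u3 (ins u2 (ins u1 empty)))) (symdiff (symdiff (symdiff u1 u2) u3) u4)"
      using ne by (intro is_sum_ins i2 uF) simp_all
    have "cup (?p u1) (?p u2) \<epsilon> FS_le (numeral_set 4) X Y"
      by (rule mem_FS_leI[OF _ c2 _ _ i2[unfolded s2]]) (use uY nonempty in \<open>auto simp: subset_def\<close>)
    moreover have "cup (cup (?p u1) (?p u2)) (cup (?p u3) (?p u4)) \<epsilon> FS_le (numeral_set 4) X Y"
      by (rule mem_FS_leI[OF _ c4 _ _ i4[unfolded s4]]) (use uY nonempty in \<open>auto simp: subset_def\<close>)
    moreover have "cup (cup (?p u1) (?p u2)) (cup (?p u3) (?p u4)) \<epsilon> Fin X"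
      using is_sum_Fin[OF i4] unfolding s4 .
    ultimately show False using mono c(2) unfolding monochromatic_def by blast
  qed
  then show ?thesis using c(1) by blast
qed

section \<open>The theorem of Hindman without choice\<close>

text \<open>
  The role of the set of all finite sums of a sequence of disjoint sets in the usual
  formulation of the theorem of Hindman. Closure properties alone suffice, and no
  sequence has to be chosen.
\<close>

definition IP_family :: "'a \<Rightarrow> bool" where
  "IP_family B \<longleftrightarrow> (\<forall>b. b \<epsilon> B \<longrightarrow> b \<noteq> empty \<and> set_finite b) \<and>
     (\<forall>b c. b \<epsilon> B \<longrightarrow> c \<epsilon> B \<longrightarrow> disj b c \<longrightarrow> cup b c \<epsilon> B) \<and>
     (\<forall>T. set_finite T \<longrightarrow> (\<exists>b. b \<epsilon> B \<and> disj b T))"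

text \<open>
  If \<open>C\<close> is not large for an IP family \<open>B\<close>, the complement of \<open>C\<close> contains an IP subfamily of
  \<open>B\<close>; this dichotomy starts the proof of the theorem of Hindman.
\<close>

definition large :: "'a \<Rightarrow> 'a \<Rightarrow> bool" where
  "large C B \<longleftrightarrow> IP_family B \<and> (\<forall>B'. IP_family B' \<longrightarrow> subset B' B \<longrightarrow> (\<exists>b. b \<epsilon> B' \<and> b \<epsilon> C))"

text \<open>
  The usual arguments pass to a smaller and smaller family, which takes dependent
  choice. Here the smaller family is hidden behind an existential quantifier: constructions
  keep only the set \<open>C\<close> and never select a family.
\<close>

definition some_large :: "'a \<Rightarrow> 'a \<Rightarrow> bool" where
  "some_large G C \<longleftrightarrow> (\<exists>B. subset B G \<and> large C B)"

text \<open>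
  The recursions below are choice-free because each step takes the candidate singled out by \<open>K\<close>.
\<close>

definition choice_rel :: "('a \<Rightarrow> 'a \<Rightarrow> bool) \<Rightarrow> 'a \<Rightarrow> bool" where
  "choice_rel K G \<longleftrightarrow> definable2 K \<and> (\<forall>A. subset A G \<longrightarrow> A \<noteq> empty \<longrightarrow> (\<exists>!b. b \<epsilon> A \<and> K A b))"

text \<open>
  If \<open>E\<close> is the set of all finite unions of some sets, this is the set of all finite
  unions of these sets and \<open>b\<close>.
\<close>

definition adjoin_sums :: "'a \<Rightarrow> 'a \<Rightarrow> 'a" where
  "adjoin_sums E b = Coll (\<lambda>x. x \<epsilon> E \<or> x = b \<or> (\<exists>e. e \<epsilon> E \<and> x = cup b e))"

definition shift :: "'a \<Rightarrow> 'a \<Rightarrow> 'a" where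
  "shift C e = Coll (\<lambda>x. x \<epsilon> C \<and> disj x e \<and> cup x e \<epsilon> C)"

text \<open>
  What remains of \<open>C\<close> after the members of \<open>E\<close> have been generated: every later block chosen from it is
  compatible with all of them.
\<close>

definition shifts :: "'a \<Rightarrow> 'a \<Rightarrow> 'a" where
  "shifts C E = Coll (\<lambda>x. x \<epsilon> C \<and> disj x (Cup E) \<and> (\<forall>e. e \<epsilon> E \<longrightarrow> cup x e \<epsilon> C))"

lemma definable_IP_family [def_intros]: "def_fun f \<Longrightarrow> definable (\<lambda>s. IP_family (f s))"
  by (rule def_subst1[where R = IP_family]) (unfold IP_family_def, intro def_intros)

lemma definable_large [def_intros]: "def_fun f \<Longrightarrow> def_fun g \<Longrightarrow> definable (\<lambda>s. large (f s) (g s))"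
  by (rule def_subst2[where R = large]) (unfold large_def, intro def_intros)

lemma definable_some_large [def_intros]: "def_fun f \<Longrightarrow> def_fun g \<Longrightarrow> definable (\<lambda>s. some_large (f s) (g s))"
  by (rule def_subst2[where R = some_large]) (unfold some_large_def, intro def_intros)

lemma adjoin_sums_ex: "\<exists>z. \<forall>x. x \<epsilon> z \<longleftrightarrow> x \<epsilon> E \<or> x = b \<or> (\<exists>e. e \<epsilon> E \<and> x = cup b e)"
  by (rule definable_comprehension[where a = "cup (ins b E) (Power (cup b (Cup E)))"])
    (intro def_intros, auto simp: subset_def)

lemma mem_adjoin_sums [simp]: "x \<epsilon> adjoin_sums E b \<longleftrightarrow> x \<epsilon> E \<or> x = b \<or> (\<exists>e. e \<epsilon> E \<and> x = cup b e)"
  unfolding adjoin_sums_def by (rule mem_Coll[OF adjoin_sums_ex])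

lemma def_fun_adjoin_sums [def_intros]: "def_fun f \<Longrightarrow> def_fun g \<Longrightarrow> def_fun (\<lambda>s. adjoin_sums (f s) (g s))"
  by (rule def_fun_subst2, rule definable_graph2, unfold adjoin_sums_def, rule def_fun_Coll[OF adjoin_sums_ex], intro def_intros)

lemma shift_ex: "\<exists>z. \<forall>x. x \<epsilon> z \<longleftrightarrow> x \<epsilon> C \<and> disj x e \<and> cup x e \<epsilon> C"
  by (rule definable_separation) (intro def_intros)

lemma mem_shift [simp]: "x \<epsilon> shift C e \<longleftrightarrow> x \<epsilon> C \<and> disj x e \<and> cup x e \<epsilon> C"
  unfolding shift_def by (rule mem_Coll[OF shift_ex])

lemma shifts_ex: "\<exists>z. \<forall>x. x \<epsilon> z \<longleftrightarrow> x \<epsilon> C \<and> disj x (Cup E) \<and> (\<forall>e. e \<epsilon> E \<longrightarrow> cup x e \<epsilon> C)"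
  by (rule definable_separation) (intro def_intros)

lemma mem_shifts [simp]: "x \<epsilon> shifts C E \<longleftrightarrow> x \<epsilon> C \<and> disj x (Cup E) \<and> (\<forall>e. e \<epsilon> E \<longrightarrow> cup x e \<epsilon> C)"
  unfolding shifts_def by (rule mem_Coll[OF shifts_ex])

lemma def_fun_shifts [def_intros]: "def_fun f \<Longrightarrow> def_fun g \<Longrightarrow> def_fun (\<lambda>s. shifts (f s) (g s))"
  by (rule def_fun_subst2, rule definable_graph2, unfold shifts_def, rule def_fun_Coll[OF shifts_ex], intro def_intros)

lemma cup_commute: "cup a b = cup b a" by (rule ext_eq) auto
lemma cup_assoc: "cup (cup a b) c = cup a (cup b c)" by (rule ext_eq) auto
lemma cup_left_commute: "cup a (cup b c) = cup b (cup a c)" by (rule ext_eq) auto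

lemma disj_cup [simp]: "disj x (cup a b) \<longleftrightarrow> disj x a \<and> disj x b" by (auto simp: disj_def)
lemma disj_cup2 [simp]: "disj (cup a b) x \<longleftrightarrow> disj a x \<and> disj b x" by (auto simp: disj_def)
lemma disj_sym: "disj a b \<longleftrightarrow> disj b a" by (auto simp: disj_def)
lemma disj_Cup: "disj x (Cup E) \<longleftrightarrow> (\<forall>e. e \<epsilon> E \<longrightarrow> disj x e)" by (auto simp: disj_def)
lemma disj_self: "disj a a \<longleftrightarrow> a = empty" using nonempty by (auto simp: disj_def)

lemma adjoin_sums_closed:
  assumes cl: "\<And>e e'. e \<epsilon> E \<Longrightarrow> e' \<epsilon> E \<Longrightarrow> cup e e' \<epsilon> E"
    and "x \<epsilon> adjoin_sums E b" and "y \<epsilon> adjoin_sums E b"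
  shows "cup x y \<epsilon> adjoin_sums E b"
proof -
  have eqs: "cup e b = cup b e" "cup e (cup b a) = cup b (cup e a)" "cup b b = b" "cup b (cup b a) = cup b a"
    "cup (cup b a) e = cup b (cup a e)" "cup (cup b a) b = cup b a" "cup (cup b a) (cup b e) = cup b (cup a e)" for a e
    by (auto intro!: ext_eq)
  show ?thesis using assms(2,3) unfolding mem_adjoin_sums by (elim disjE exE conjE) (metis eqs cl)+
qed

lemma finite_adjoin_sums: assumes "set_finite E" shows "set_finite (adjoin_sums E b)"
proof -
  obtain I where I: "\<And>x. x \<epsilon> I \<longleftrightarrow> x \<epsilon> adjoin_sums E b \<and> (\<exists>e. e \<epsilon> E \<and> x = cup b e)"
    by (erule definable_setE) (intro def_intros)
  have d: "definable (\<lambda>s. s 1 = cup b (s 0))" by (intro def_intros)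
  have "set_finite I" by (rule finite_image[where R = "\<lambda>e x. x = cup b e", OF assms d]) (use I in auto)
  then have "set_finite (ins b (cup E I))" using assms by simp
  then show ?thesis by (rule finite_subset) (auto simp: I)
qed

text \<open>
  The recursion common to all steps of the proof of Hindman. Blocks \<open>b\<close> are added one after the
  other, each disjoint from its predecessors; \<open>E\<close> is the finite set of unions of the blocks
  so far, and \<open>\<Phi>\<close> is an invariant of \<open>E\<close>. All unions together form the IP family \<open>B'\<close>, and \<open>Y\<close>
  is the set of blocks.
\<close>

lemma greedy_subfamily:
  assumes B: "IP_family B" and K: "choice_rel K B" and \<Phi>: "definable1 \<Phi>" and \<Phi>0: "\<Phi> empty"
    and step: "\<And>E. set_finite E \<Longrightarrow> subset E B \<Longrightarrow> \<Phi> E \<Longrightarrow> (\<And>e e'. e \<epsilon> E \<Longrightarrow> e' \<epsilon> E \<Longrightarrow> cup e e' \<epsilon> E) \<Longrightarrow>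
      \<exists>b. b \<epsilon> B \<and> disj b (Cup E) \<and> \<Phi> (adjoin_sums E b)"
  shows "\<exists>B' Y. IP_family B' \<and> subset B' B \<and>
    (\<forall>e e'. e \<epsilon> B' \<longrightarrow> e' \<epsilon> B' \<longrightarrow> (\<exists>E. e \<epsilon> E \<and> e' \<epsilon> E \<and> \<Phi> E)) \<and>
    subset Y B' \<and> \<not> set_finite Y \<and> pairwise_disjoint Y"
proof -
  have K_definable: "definable2 K" and choose: "\<And>A. subset A B \<Longrightarrow> A \<noteq> empty \<Longrightarrow> \<exists>!b. b \<epsilon> A \<and> K A b"
    using K unfolding choice_rel_def by blast+
  \<comment> \<open>\<open>N E b\<close>: \<open>b\<close> is the block selected after the stage \<open>E\<close>.\<close>
  define N where "N E b \<longleftrightarrow> (\<exists>A. (\<forall>x. x \<epsilon> A \<longleftrightarrow> x \<epsilon> B \<and> disj x (Cup E) \<and> \<Phi> (adjoin_sums E x)) \<and> b \<epsilon> A \<and> K A b)" for E b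
  have N_definable: "definable2 N" unfolding N_def by (intro def_intros def_subst1[OF \<Phi>] def_subst2[OF K_definable])
  have N_mem: "b \<epsilon> B \<and> disj b (Cup E) \<and> \<Phi> (adjoin_sums E b)" if "N E b" for E b
    using that unfolding N_def by blast
  have cand: "\<exists>A. (\<forall>x. x \<epsilon> A \<longleftrightarrow> x \<epsilon> B \<and> disj x (Cup E) \<and> \<Phi> (adjoin_sums E x))" for E
    by (rule definable_separation) (intro def_intros def_subst1[OF \<Phi>])
  have N_unique: "b = b'" if "N E b" "N E b'" for E b b'
  proof -
    obtain A where A: "\<And>x. x \<epsilon> A \<longleftrightarrow> x \<epsilon> B \<and> disj x (Cup E) \<and> \<Phi> (adjoin_sums E x)" "b \<epsilon> A" "K A b"
      using \<open>N E b\<close> unfolding N_def by blast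
    obtain A' where A': "\<And>x. x \<epsilon> A' \<longleftrightarrow> x \<epsilon> B \<and> disj x (Cup E) \<and> \<Phi> (adjoin_sums E x)" "b' \<epsilon> A'" "K A' b'"
      using \<open>N E b'\<close> unfolding N_def by blast
    have "A = A'" using A(1) A'(1) by (intro ext_eq) blast
    moreover have "subset A B" "A \<noteq> empty" using A unfolding subset_def nonempty by blast+
    ultimately show ?thesis using choose[of A] A(2,3) A'(2,3) by blast
  qed
  have N_ex: "\<exists>b. N E b" if ex: "\<exists>b. b \<epsilon> B \<and> disj b (Cup E) \<and> \<Phi> (adjoin_sums E b)" for E
  proof -
    obtain A where A: "\<And>x. x \<epsilon> A \<longleftrightarrow> x \<epsilon> B \<and> disj x (Cup E) \<and> \<Phi> (adjoin_sums E x)" using cand by blast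
    have "subset A B" "A \<noteq> empty" using A ex unfolding subset_def nonempty by blast+
    then obtain b where "b \<epsilon> A" "K A b" using choose by blast
    then show ?thesis unfolding N_def using A by blast
  qed
  define \<sigma> where "\<sigma> E = Coll (\<lambda>x. x \<epsilon> E \<or> (\<exists>b. N E b \<and> x \<epsilon> adjoin_sums E b))" for E
  have \<sigma>_ex: "\<exists>z. \<forall>x. x \<epsilon> z \<longleftrightarrow> x \<epsilon> E \<or> (\<exists>b. N E b \<and> x \<epsilon> adjoin_sums E b)" for E
  proof (cases "\<exists>b. N E b")
    case True
    then obtain b where b: "N E b" by blast
    have "x \<epsilon> E \<Longrightarrow> x \<epsilon> adjoin_sums E b" for x by simp
    then have "x \<epsilon> adjoin_sums E b \<longleftrightarrow> x \<epsilon> E \<or> (\<exists>b. N E b \<and> x \<epsilon> adjoin_sums E b)" for x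
      using b N_unique[OF b] by metis
    then show ?thesis by blast
  qed blast
  have mem_\<sigma>: "x \<epsilon> \<sigma> E \<longleftrightarrow> x \<epsilon> E \<or> (\<exists>b. N E b \<and> x \<epsilon> adjoin_sums E b)" for E x
    unfolding \<sigma>_def by (rule mem_Coll[OF \<sigma>_ex])
  have \<sigma>_opl: "\<sigma> E = adjoin_sums E b" if "N E b" for E b
  proof (rule ext_eq)
    have "x \<epsilon> E \<Longrightarrow> x \<epsilon> adjoin_sums E b" for x by simp
    then show "x \<epsilon> \<sigma> E \<longleftrightarrow> x \<epsilon> adjoin_sums E b" for x
      unfolding mem_\<sigma> using that N_unique[OF that] by metis
  qed
  have adjoin_sums_B: "subset (adjoin_sums E b) B" if "subset E B" "b \<epsilon> B" "disj b (Cup E)" for E b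
    using that B unfolding IP_family_def subset_def disj_Cup by auto
  have "def_fun (\<lambda>s. \<sigma> (s 0))" unfolding \<sigma>_def
    by (rule def_fun_Coll[OF \<sigma>_ex]) (intro def_intros def_subst2[OF N_definable])
  moreover have "subset (\<sigma> E) B" if "subset E B" for E
    using that adjoin_sums_B[OF that] N_mem[of E] unfolding subset_def mem_\<sigma> by blast
  moreover have \<sigma>_inf: "subset E (\<sigma> E)" for E by (simp add: subset_def mem_\<sigma>)
  ultimately obtain T where T: "empty \<epsilon> T" "\<And>E. E \<epsilon> T \<Longrightarrow> \<sigma> E \<epsilon> T" "\<And>E. E \<epsilon> T \<Longrightarrow> subset E B"
    and ind: "\<And>P E. E \<epsilon> T \<Longrightarrow> definable1 P \<Longrightarrow> P empty \<Longrightarrow> (\<And>E. E \<epsilon> T \<Longrightarrow> P E \<Longrightarrow> P (\<sigma> E)) \<Longrightarrow> P E"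
    and cmp: "\<And>E E'. E \<epsilon> T \<Longrightarrow> E' \<epsilon> T \<Longrightarrow> subset E' E \<or> subset (\<sigma> E) E'"
    using inflationary_tower[of \<sigma> B] by blast
  define J where "J E \<longleftrightarrow> set_finite E \<and> \<Phi> E \<and> (\<forall>e e'. e \<epsilon> E \<longrightarrow> e' \<epsilon> E \<longrightarrow> cup e e' \<epsilon> E)" for E
  have J_N: "\<exists>b. N E b" if "E \<epsilon> T" "J E" for E
    by (rule N_ex, rule step) (use that T(3) in \<open>auto simp: J_def\<close>)
  have J: "J E" if "E \<epsilon> T" for E
    using that
  proof (rule ind)
    show "definable1 J" unfolding J_def by (intro def_intros def_subst1[OF \<Phi>])
    show "J empty" unfolding J_def using \<Phi>0 by simp
    fix E assume E: "E \<epsilon> T" "J E"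
    obtain b where b: "N E b" using J_N[OF E] by blast
    have cl: "cup e e' \<epsilon> E" if "e \<epsilon> E" "e' \<epsilon> E" for e e' using E(2) that unfolding J_def by blast
    have "cup e e' \<epsilon> adjoin_sums E b" if "e \<epsilon> adjoin_sums E b" "e' \<epsilon> adjoin_sums E b" for e e'
      using adjoin_sums_closed[OF cl that] .
    then show "J (\<sigma> E)" unfolding \<sigma>_opl[OF b] J_def
      using finite_adjoin_sums N_mem[OF b] E(2) unfolding J_def by blast
  qed
  have N_T: "\<exists>b. N E b" if "E \<epsilon> T" for E using J_N J that by blast
  have b_in: "b \<epsilon> \<sigma> E" if "N E b" for E b using that by (auto simp: \<sigma>_opl[OF that])
  \<comment> \<open>Blocks are disjoint, so a point of \<open>T0\<close> lies in at most one of them; pass to a stage beyond it.\<close>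
  have claim: "\<exists>E. E \<epsilon> T \<and> (\<forall>E' b. E' \<epsilon> T \<longrightarrow> subset E E' \<longrightarrow> N E' b \<longrightarrow> disj b T0)" if "set_finite T0" for T0
    using that
  proof (induction T0 rule: finite_induct)
    show "definable (\<lambda>s. \<exists>E. E \<epsilon> T \<and> (\<forall>E' b. E' \<epsilon> T \<longrightarrow> subset E E' \<longrightarrow> N E' b \<longrightarrow> disj b (s 0)))"
      by (intro def_intros def_subst2[OF N_definable])
    show "\<exists>E. E \<epsilon> T \<and> (\<forall>E' b. E' \<epsilon> T \<longrightarrow> subset E E' \<longrightarrow> N E' b \<longrightarrow> disj b empty)"
      using T(1) by (auto simp: disj_def)
    fix T0 x assume "\<exists>E. E \<epsilon> T \<and> (\<forall>E' b. E' \<epsilon> T \<longrightarrow> subset E E' \<longrightarrow> N E' b \<longrightarrow> disj b T0)"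
    then obtain E where E: "E \<epsilon> T" "\<And>E' b. E' \<epsilon> T \<Longrightarrow> subset E E' \<Longrightarrow> N E' b \<Longrightarrow> disj b T0" by blast
    have d: "disj b (ins x T0) \<longleftrightarrow> disj b T0 \<and> \<not> x \<epsilon> b" for b by (auto simp: disj_def)
    show "\<exists>E. E \<epsilon> T \<and> (\<forall>E' b. E' \<epsilon> T \<longrightarrow> subset E E' \<longrightarrow> N E' b \<longrightarrow> disj b (ins x T0))"
    proof (cases "\<exists>E1 b1. E1 \<epsilon> T \<and> subset E E1 \<and> N E1 b1 \<and> x \<epsilon> b1")
      case False
      then show ?thesis using E unfolding d by blast
    next
      case True
      then obtain E1 b1 where E1: "E1 \<epsilon> T" "subset E E1" "N E1 b1" "x \<epsilon> b1" by blast
      have "disj b (ins x T0)" if E': "E' \<epsilon> T" "subset (\<sigma> E1) E'" "N E' b" for E' b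
      proof -
        have "subset E E'" using E1(2) \<sigma>_inf E'(2) subset_trans by blast
        then have "disj b T0" using E(2) E' by blast
        moreover have "b1 \<epsilon> E'" using b_in[OF E1(3)] E'(2) by (simp add: subset_def)
        then have "disj b b1" using N_mem[OF E'(3)] unfolding disj_Cup by blast
        then have "\<not> x \<epsilon> b" using E1(4) unfolding disj_def by blast
        ultimately show ?thesis unfolding d by blast
      qed
      then show ?thesis using T(2)[OF E1(1)] by blast
    qed
  qed
  have B_el: "b \<noteq> empty" "set_finite b" if "b \<epsilon> B" for b using B that unfolding IP_family_def by blast+
  have both: "\<exists>E. E \<epsilon> T \<and> e \<epsilon> E \<and> e' \<epsilon> E" if "e \<epsilon> Cup T" "e' \<epsilon> Cup T" for e e'
  proof -
    obtain E E' where E: "e \<epsilon> E" "E \<epsilon> T" "e' \<epsilon> E'" "E' \<epsilon> T" using \<open>e \<epsilon> Cup T\<close> \<open>e' \<epsilon> Cup T\<close> by auto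
    then have "subset E' E \<or> subset E E'" using cmp[OF E(2,4)] \<sigma>_inf subset_trans by blast
    then show ?thesis using E unfolding subset_def by blast
  qed
  have TB: "subset (Cup T) B" using T(3) unfolding subset_def mem_Cup by blast
  have "IP_family (Cup T)"
    unfolding IP_family_def
  proof (intro conjI allI impI)
    show "b \<noteq> empty" "set_finite b" if "b \<epsilon> Cup T" for b using that TB B_el unfolding subset_def by blast+
    show "cup b c \<epsilon> Cup T" if "b \<epsilon> Cup T" "c \<epsilon> Cup T" for b c
      using both[OF that] J unfolding J_def mem_Cup by blast
  next
    fix T0 assume "set_finite T0"
    then obtain E where E: "E \<epsilon> T" "\<And>b. N E b \<Longrightarrow> disj b T0" using claim subset_refl by blast
    then obtain b where "N E b" using N_T by blast
    then show "\<exists>b. b \<epsilon> Cup T \<and> disj b T0" using E b_in T(2) unfolding mem_Cup by blast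
  qed
  moreover have "\<exists>E. e \<epsilon> E \<and> e' \<epsilon> E \<and> \<Phi> E" if "e \<epsilon> Cup T" "e' \<epsilon> Cup T" for e e'
    using both[OF that] J unfolding J_def by blast
  moreover have "\<exists>Y. \<forall>b. b \<epsilon> Y \<longleftrightarrow> b \<epsilon> Cup T \<and> (\<exists>E. E \<epsilon> T \<and> N E b)"
    by (rule definable_separation) (intro def_intros def_subst2[OF N_definable])
  then obtain Y where "\<And>b. b \<epsilon> Y \<longleftrightarrow> b \<epsilon> Cup T \<and> (\<exists>E. E \<epsilon> T \<and> N E b)" by blast
  then have Y: "b \<epsilon> Y \<longleftrightarrow> (\<exists>E. E \<epsilon> T \<and> N E b)" for b using b_in T(2) unfolding mem_Cup by blast
  have YT: "subset Y (Cup T)" unfolding subset_def Y mem_Cup using b_in T(2) by blast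
  moreover have "\<not> set_finite Y"
  proof
    assume "set_finite Y"
    then have "set_finite (Cup Y)"
      by (rule finite_Cup) (use YT TB B_el in \<open>auto simp: subset_def\<close>)
    then obtain E where E: "E \<epsilon> T" "\<And>b. N E b \<Longrightarrow> disj b (Cup Y)" using claim subset_refl by blast
    then obtain b where b: "N E b" using N_T by blast
    then have "disj b b" using E Y unfolding disj_Cup by blast
    then show False using B_el(1) N_mem[OF b] unfolding disj_self by blast
  qed
  moreover have "pairwise_disjoint Y"
  proof -
    have *: "disj b b'" if "subset (\<sigma> E) E'" "N E b" "N E' b'" for E E' b b'
      using that N_mem[OF that(3)] b_in[OF that(2)] unfolding disj_Cup subset_def using disj_sym by blast
    have "disj b b'" if "b \<epsilon> Y" "b' \<epsilon> Y" "b \<noteq> b'" for b b'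
    proof -
      obtain E E' where E: "E \<epsilon> T" "N E b" "E' \<epsilon> T" "N E' b'" using \<open>b \<epsilon> Y\<close> \<open>b' \<epsilon> Y\<close> Y by blast
      have "E \<noteq> E'" using E N_unique that(3) by blast
      then consider "subset (\<sigma> E) E'" | "subset (\<sigma> E') E"
        using cmp[OF E(1,3)] cmp[OF E(3,1)] subset_antisym by blast
      then show ?thesis using * E disj_sym by cases blast+
    qed
    then show ?thesis unfolding pairwise_disjoint_def disj_def by blast
  qed
  ultimately show ?thesis using TB by (intro exI[of _ "Cup T"] exI[of _ Y]) blast
qed

lemma choice_rel_subset: "choice_rel K G \<Longrightarrow> subset B G \<Longrightarrow> choice_rel K B"
  unfolding choice_rel_def using subset_trans by blast

lemma some_large_mono: "some_large G C \<Longrightarrow> (\<And>x. x \<epsilon> C \<Longrightarrow> x \<epsilon> C') \<Longrightarrow> some_large G C'"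
  unfolding some_large_def large_def by blast

lemma some_large_subset: "some_large B C \<Longrightarrow> subset B G \<Longrightarrow> some_large G C"
  unfolding some_large_def using subset_trans by blast

text \<open>
  If \<open>C1\<close> is not large for the given family, some subfamily misses \<open>C1\<close>; every IP family inside it
  then meets \<open>C\<close> in a point of \<open>C2\<close>.
\<close>

lemma some_large_split:
  assumes "some_large G C" and "\<And>x. x \<epsilon> C \<Longrightarrow> x \<epsilon> C1 \<or> x \<epsilon> C2"
  shows "some_large G C1 \<or> some_large G C2"
proof (rule ccontr)
  assume neg: "\<not> ?thesis"
  obtain B where B: "subset B G" "large C B" using assms(1) unfolding some_large_def by blast
  then obtain B' where B': "IP_family B'" "subset B' B" "\<And>b. b \<epsilon> B' \<Longrightarrow> \<not> b \<epsilon> C1"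
    using neg unfolding some_large_def large_def by blast
  then have "subset B' G" using B(1) subset_trans by blast
  then obtain B'' where B'': "IP_family B''" "subset B'' B'" "\<And>b. b \<epsilon> B'' \<Longrightarrow> \<not> b \<epsilon> C2"
    using neg B'(1) unfolding some_large_def large_def by blast
  then have "subset B'' B" using B'(2) subset_trans by blast
  then obtain b where "b \<epsilon> B''" "b \<epsilon> C" using B(2) B''(1) unfolding large_def by blast
  then show False using assms(2) B'' B' unfolding subset_def by blast
qed

lemma some_large_finite_split:
  assumes I: "set_finite I" and R: "definable2 R" and C: "some_large G C"
    and cover: "\<And>x. x \<epsilon> C \<Longrightarrow> \<exists>i. i \<epsilon> I \<and> R i x"
  shows "\<exists>i D. i \<epsilon> I \<and> some_large G D \<and> (\<forall>x. x \<epsilon> D \<longrightarrow> x \<epsilon> C \<and> R i x)"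
proof -
  have "\<forall>C. some_large G C \<longrightarrow> (\<forall>x. x \<epsilon> C \<longrightarrow> (\<exists>i. i \<epsilon> I \<and> R i x)) \<longrightarrow>
      (\<exists>i D. i \<epsilon> I \<and> some_large G D \<and> (\<forall>x. x \<epsilon> D \<longrightarrow> x \<epsilon> C \<and> R i x))" using I
  proof (induction I rule: finite_induct)
    show "definable (\<lambda>s. \<forall>C. some_large G C \<longrightarrow> (\<forall>x. x \<epsilon> C \<longrightarrow> (\<exists>i. i \<epsilon> s 0 \<and> R i x)) \<longrightarrow>
      (\<exists>i D. i \<epsilon> s 0 \<and> some_large G D \<and> (\<forall>x. x \<epsilon> D \<longrightarrow> x \<epsilon> C \<and> R i x)))" by (intro def_intros def_subst2[OF R])
    show "\<forall>C. some_large G C \<longrightarrow> (\<forall>x. x \<epsilon> C \<longrightarrow> (\<exists>i. i \<epsilon> empty \<and> R i x)) \<longrightarrow>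
      (\<exists>i D. i \<epsilon> empty \<and> some_large G D \<and> (\<forall>x. x \<epsilon> D \<longrightarrow> x \<epsilon> C \<and> R i x))"
      unfolding some_large_def large_def using subset_refl mem_empty by blast
    fix I j assume IH: "\<forall>C. some_large G C \<longrightarrow> (\<forall>x. x \<epsilon> C \<longrightarrow> (\<exists>i. i \<epsilon> I \<and> R i x)) \<longrightarrow>
      (\<exists>i D. i \<epsilon> I \<and> some_large G D \<and> (\<forall>x. x \<epsilon> D \<longrightarrow> x \<epsilon> C \<and> R i x))"
    show "\<forall>C. some_large G C \<longrightarrow> (\<forall>x. x \<epsilon> C \<longrightarrow> (\<exists>i. i \<epsilon> ins j I \<and> R i x)) \<longrightarrow>
      (\<exists>i D. i \<epsilon> ins j I \<and> some_large G D \<and> (\<forall>x. x \<epsilon> D \<longrightarrow> x \<epsilon> C \<and> R i x))"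
    proof (rule allI, rule impI, rule impI)
      fix C assume C: "some_large G C" "\<forall>x. x \<epsilon> C \<longrightarrow> (\<exists>i. i \<epsilon> ins j I \<and> R i x)"
      obtain C1 where C1: "\<And>x. x \<epsilon> C1 \<longleftrightarrow> x \<epsilon> C \<and> R j x"
        by (erule definable_setE) (intro def_intros def_subst2[OF R])
      have "some_large G C1 \<or> some_large G (diff C C1)" by (rule some_large_split[OF C(1)]) simp
      then show "\<exists>i D. i \<epsilon> ins j I \<and> some_large G D \<and> (\<forall>x. x \<epsilon> D \<longrightarrow> x \<epsilon> C \<and> R i x)"
      proof
        assume "some_large G C1"
        then show ?thesis using C1 mem_ins by blast
      next
        assume L: "some_large G (diff C C1)"
        have "\<exists>i. i \<epsilon> I \<and> R i x" if "x \<epsilon> diff C C1" for x using that C(2) C1 by auto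
        then obtain i D where "i \<epsilon> I" "some_large G D" "\<forall>x. x \<epsilon> D \<longrightarrow> x \<epsilon> diff C C1 \<and> R i x"
          using IH L by blast
        then show ?thesis using mem_ins mem_diff by blast
      qed
    qed
  qed
  then show ?thesis using C cover by blast
qed

lemma IP_family_tail:
  assumes "IP_family B" and T: "set_finite T" and B': "\<And>b. b \<epsilon> B' \<longleftrightarrow> b \<epsilon> B \<and> disj b T"
  shows "IP_family B'"
  unfolding IP_family_def
proof (intro conjI allI impI)
  fix T' assume "set_finite T'"
  then have "set_finite (cup T T')" using T by simp
  then obtain b where "b \<epsilon> B" "disj b (cup T T')" using assms(1) unfolding IP_family_def by blast
  then show "\<exists>b. b \<epsilon> B' \<and> disj b T'" using B' by auto
qed (use assms(1) B' in \<open>auto simp: IP_family_def\<close>)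

lemma large_subset: "large C B \<Longrightarrow> IP_family B' \<Longrightarrow> subset B' B \<Longrightarrow> large C B'"
  unfolding large_def using subset_trans by blast

text \<open>
  Otherwise one can choose disjoint blocks one after the other so that no union of two disjoint members
  of the family they generate lies in \<open>C\<close>. These unions form an IP subfamily that misses
  \<open>C\<close>, contrary to largeness.
\<close>

lemma finite_test_set:
  assumes K: "choice_rel K B" and L: "large C B"
  shows "\<exists>H. set_finite H \<and> subset H B \<and> (\<forall>b. b \<epsilon> B \<longrightarrow> disj b (Cup H) \<longrightarrow> (\<exists>e. e \<epsilon> H \<and> cup b e \<epsilon> C))"
proof (rule ccontr)
  assume neg: "\<not> ?thesis"
  have B: "IP_family B" using L by (simp add: large_def)
  define \<Phi> where "\<Phi> E \<longleftrightarrow> (\<forall>e e'. e \<epsilon> E \<longrightarrow> e' \<epsilon> E \<longrightarrow> disj e e' \<longrightarrow> \<not> cup e e' \<epsilon> C)" for E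
  have \<Phi>_fo: "definable1 \<Phi>" unfolding \<Phi>_def by (intro def_intros)
  have \<Phi>_step: "\<exists>b. b \<epsilon> B \<and> disj b (Cup E) \<and> \<Phi> (adjoin_sums E b)"
    if E: "set_finite E" "subset E B" "\<Phi> E" and cl: "\<And>e e'. e \<epsilon> E \<Longrightarrow> e' \<epsilon> E \<Longrightarrow> cup e e' \<epsilon> E" for E
  proof -
    obtain b where b: "b \<epsilon> B" "disj b (Cup E)" "\<And>e. e \<epsilon> E \<Longrightarrow> \<not> cup b e \<epsilon> C" using neg E(1,2) by blast
    have bne: "b \<noteq> empty" using b(1) B unfolding IP_family_def by blast
    have b': "\<not> cup e b \<epsilon> C" if "e \<epsilon> E" for e using b(3)[OF that] by (simp add: cup_commute)
    have "\<not> cup e e' \<epsilon> C" if "e \<epsilon> adjoin_sums E b" "e' \<epsilon> adjoin_sums E b" "disj e e'" for e e'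
    proof -
      have m1: "\<not> cup e (cup b a) \<epsilon> C" if "e \<epsilon> E" "a \<epsilon> E" for e a
        using b(3)[OF cl[OF that]] by (simp add: cup_left_commute)
      have m2: "\<not> cup (cup b a) e \<epsilon> C" if "e \<epsilon> E" "a \<epsilon> E" for e a
        using m1[OF that] by (simp add: cup_commute)
      have m3: "\<not> cup e e' \<epsilon> C" if "e \<epsilon> E" "e' \<epsilon> E" "disj e e'" for e e' using E(3) that unfolding \<Phi>_def by blast
      show ?thesis using that b(3) b' m1 m2 m3 bne by (auto simp: disj_self)
    qed
    then show ?thesis using b unfolding \<Phi>_def by blast
  qed
  have \<Phi>_empty: "\<Phi> empty" by (simp add: \<Phi>_def)
  obtain B' where B': "IP_family B'" "subset B' B"
    and \<Phi>: "\<And>e e'. e \<epsilon> B' \<Longrightarrow> e' \<epsilon> B' \<Longrightarrow> \<exists>E. e \<epsilon> E \<and> e' \<epsilon> E \<and> \<Phi> E"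
    using greedy_subfamily[OF B K \<Phi>_fo \<Phi>_empty \<Phi>_step] by blast
  obtain S where S0: "\<And>x. x \<epsilon> S \<longleftrightarrow> x \<epsilon> B' \<and> (\<exists>e e'. e \<epsilon> B' \<and> e' \<epsilon> B' \<and> disj e e' \<and> x = cup e e')"
    by (erule definable_setE) (intro def_intros)
  have cl: "cup e e' \<epsilon> B'" if "e \<epsilon> B'" "e' \<epsilon> B'" "disj e e'" for e e' using B'(1) that unfolding IP_family_def by blast
  have S: "x \<epsilon> S \<longleftrightarrow> (\<exists>e e'. e \<epsilon> B' \<and> e' \<epsilon> B' \<and> disj e e' \<and> x = cup e e')" for x using S0 cl by blast
  have SB': "subset S B'" using S0 by (simp add: subset_def)
  have "IP_family S"
    unfolding IP_family_def
  proof (intro conjI allI impI)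
    show "b \<noteq> empty" "set_finite b" if "b \<epsilon> S" for b
      using that SB' B'(1) unfolding IP_family_def subset_def by blast+
    show "cup b c \<epsilon> S" if bc: "b \<epsilon> S" "c \<epsilon> S" "disj b c" for b c
    proof -
      obtain e e' where e: "e \<epsilon> B'" "e' \<epsilon> B'" "disj e e'" "b = cup e e'" using bc(1) S by blast
      have "c \<epsilon> B'" using bc(2) S0 by blast
      then have "cup e' c \<epsilon> B'" using cl e bc(3) by auto
      moreover have "disj e (cup e' c)" using e(3,4) bc(3) by simp
      moreover have "cup b c = cup e (cup e' c)" using e(4) by (simp add: cup_assoc)
      ultimately show ?thesis using e(1) S by blast
    qed
    fix T assume T: "set_finite T"
    then obtain e where e: "e \<epsilon> B'" "disj e T" using B'(1) unfolding IP_family_def by blast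
    have "set_finite (cup e T)" using e(1) B'(1) T unfolding IP_family_def by simp
    then obtain e' where "e' \<epsilon> B'" "disj e' (cup e T)" using B'(1) unfolding IP_family_def by blast
    then have "cup e e' \<epsilon> S" "disj (cup e e') T" unfolding S using e disj_sym by auto
    then show "\<exists>b. b \<epsilon> S \<and> disj b T" by blast
  qed
  then obtain x where x: "x \<epsilon> S" "x \<epsilon> C" using L SB' B'(2) subset_trans unfolding large_def by blast
  then obtain e e' where e: "e \<epsilon> B'" "e' \<epsilon> B'" "disj e e'" "x = cup e e'" using S by blast
  then show False using \<Phi>[OF e(1,2)] x(2) unfolding \<Phi>_def by blast
qed

text \<open>
  The finitely many shifts of \<open>C\<close> by members of a test set cover the part of \<open>C\<close> in a tail of the
  family, so one of them is large somewhere.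
\<close>

lemma some_large_shift:
  assumes K: "choice_rel K G" and C: "some_large G C" and T: "set_finite T"
  shows "\<exists>e. e \<epsilon> G \<and> disj e T \<and> some_large G (shift C e)"
proof -
  obtain B where B: "subset B G" "large C B" using C unfolding some_large_def by blast
  obtain B1 where B1: "\<And>b. b \<epsilon> B1 \<longleftrightarrow> b \<epsilon> B \<and> disj b T"
    by (erule definable_setE) (intro def_intros)
  have "IP_family B" using B(2) by (simp add: large_def)
  then have gB1: "IP_family B1" using IP_family_tail[OF _ T] B1 by blast
  have sB1: "subset B1 B" using B1 by (simp add: subset_def)
  then have L1: "large C B1" using large_subset[OF B(2) gB1] by blast
  have B1G: "subset B1 G" using sB1 B(1) subset_trans by blast
  obtain H where H: "set_finite H" "subset H B1"
    "\<And>b. b \<epsilon> B1 \<Longrightarrow> disj b (Cup H) \<Longrightarrow> \<exists>e. e \<epsilon> H \<and> cup b e \<epsilon> C"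
    using finite_test_set[OF choice_rel_subset[OF K B1G] L1] by blast
  have "set_finite (Cup H)"
    by (rule finite_Cup[OF H(1)]) (use H(2) gB1 in \<open>auto simp: subset_def IP_family_def\<close>)
  moreover have "\<exists>B2. \<forall>b. b \<epsilon> B2 \<longleftrightarrow> b \<epsilon> B1 \<and> disj b (Cup H)" by (rule definable_separation) (intro def_intros)
  then obtain B2 where B2: "\<And>b. b \<epsilon> B2 \<longleftrightarrow> b \<epsilon> B1 \<and> disj b (Cup H)" by blast
  ultimately have gB2: "IP_family B2" using IP_family_tail[OF gB1] by blast
  have sB2: "subset B2 B1" using B2 by (simp add: subset_def)
  have "\<exists>C'. \<forall>x. x \<epsilon> C' \<longleftrightarrow> x \<epsilon> C \<and> x \<epsilon> B2" by (rule definable_separation) (intro def_intros)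
  then obtain C' where C': "\<And>x. x \<epsilon> C' \<longleftrightarrow> x \<epsilon> C \<and> x \<epsilon> B2" by blast
  have "large C B2" using large_subset[OF L1 gB2 sB2] .
  then have "large C' B2" unfolding large_def subset_def C' by blast
  then have L: "some_large G C'" unfolding some_large_def using sB2 B1G subset_trans by blast
  have cov: "\<exists>e. e \<epsilon> H \<and> (disj x e \<and> cup x e \<epsilon> C)" if "x \<epsilon> C'" for x
    using that H(3)[of x] C' B2 unfolding disj_Cup by blast
  have d: "definable (\<lambda>s. disj (s 1) (s 0) \<and> cup (s 1) (s 0) \<epsilon> C)" by (intro def_intros)
  obtain e D where e: "e \<epsilon> H" "some_large G D" "\<And>x. x \<epsilon> D \<Longrightarrow> x \<epsilon> C' \<and> (disj x e \<and> cup x e \<epsilon> C)"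
    using some_large_finite_split[where R = "\<lambda>e x. disj x e \<and> cup x e \<epsilon> C", OF H(1) d L cov] by blast
  have "some_large G (shift C e)" by (rule some_large_mono[OF e(2)]) (use e(3) C' in auto)
  then show ?thesis using e(1) H(2) B1 B1G unfolding subset_def by blast
qed

lemma shifts_empty: "shifts C empty = C" by (rule ext_eq) (auto simp: disj_def)

lemma shift_shifts: assumes "x \<epsilon> shift (shifts C E) b" shows "x \<epsilon> shifts C (adjoin_sums E b)"
proof -
  have "cup x (cup b e) \<epsilon> C" if "e \<epsilon> E" for e using assms that by (simp add: cup_assoc)
  then show ?thesis using assms by (auto simp: disj_Cup)
qed

text \<open>
  The point \<open>e\<close> of the previous lemma need not belong to \<open>C\<close>. Iterating that lemma gives an
  IP family all of whose members \<open>e\<close> have a large shift; as \<open>C\<close> is large, it meets this family.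
\<close>

lemma some_large_shift_in:
  assumes K: "choice_rel K G" and C: "some_large G C"
  shows "\<exists>e. e \<epsilon> C \<and> e \<epsilon> G \<and> some_large G (shift C e)"
proof -
  obtain B where B: "subset B G" "large C B" using C unfolding some_large_def by blast
  have gB: "IP_family B" using B(2) by (simp add: large_def)
  have KB: "choice_rel K B" using choice_rel_subset[OF K B(1)] .
  have fin: "set_finite (Cup E)" if "set_finite E" "subset E B" for E
    by (rule finite_Cup[OF that(1)]) (use that gB in \<open>auto simp: subset_def IP_family_def\<close>)
  have d: "definable (\<lambda>s. some_large B (shifts C (s 0)))" by (intro def_intros)
  have LB: "some_large B (shifts C empty)" unfolding shifts_empty some_large_def using B(2) subset_refl by blast
  have step: "\<exists>b. b \<epsilon> B \<and> disj b (Cup E) \<and> some_large B (shifts C (adjoin_sums E b))"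
    if E: "set_finite E" "subset E B" "some_large B (shifts C E)" and "\<And>e e'. e \<epsilon> E \<Longrightarrow> e' \<epsilon> E \<Longrightarrow> cup e e' \<epsilon> E" for E
    using some_large_shift[OF KB E(3) fin[OF E(1,2)]] some_large_mono[OF _ shift_shifts] by blast
  obtain B' where B': "IP_family B'" "subset B' B"
    "\<And>e e'. e \<epsilon> B' \<Longrightarrow> e' \<epsilon> B' \<Longrightarrow> \<exists>E. e \<epsilon> E \<and> e' \<epsilon> E \<and> some_large B (shifts C E)"
    using greedy_subfamily[where \<Phi> = "\<lambda>E. some_large B (shifts C E)", OF gB KB d LB step] by blast
  obtain b where b: "b \<epsilon> B'" "b \<epsilon> C" using B(2) B'(1,2) unfolding large_def by blast
  obtain E where E: "b \<epsilon> E" "some_large B (shifts C E)" using B'(3)[OF b(1) b(1)] by blast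
  have "some_large B (shift C b)" by (rule some_large_mono[OF E(2)]) (use E(1) in \<open>auto simp: disj_Cup\<close>)
  then have "some_large G (shift C b)" using some_large_subset B(1) by blast
  then show ?thesis using b B'(2) B(1) unfolding subset_def by blast
qed

text \<open>
  If \<open>C\<close> is not large for \<open>G\<close>, some IP subfamily misses it. Otherwise choose, again and again, points \<open>e\<close>
  of the current set \<open>C\<close> with a large shift and replace
  \<open>C\<close> by that shift; all unions of the chosen points remain in the original \<open>C\<close>.
\<close>

lemma hindman:
  assumes G: "IP_family G" and K: "choice_rel K G"
  shows "\<exists>B Y. IP_family B \<and> subset B G \<and> ((\<forall>b. b \<epsilon> B \<longrightarrow> b \<epsilon> C) \<or> (\<forall>b. b \<epsilon> B \<longrightarrow> \<not> b \<epsilon> C)) \<and>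
    subset Y B \<and> \<not> set_finite Y \<and> pairwise_disjoint Y"
proof (cases "large C G")
  case False
  then obtain B where B: "IP_family B" "subset B G" "\<forall>b. b \<epsilon> B \<longrightarrow> \<not> b \<epsilon> C"
    using G unfolding large_def by blast
  define \<Phi> :: "'a \<Rightarrow> bool" where "\<Phi> E \<longleftrightarrow> True" for E
  have d: "definable1 \<Phi>" and \<Phi>0: "\<Phi> empty" unfolding \<Phi>_def by (intro def_intros) simp
  have step: "\<exists>b. b \<epsilon> B \<and> disj b (Cup E) \<and> \<Phi> (adjoin_sums E b)"
    if "set_finite E" "subset E B" "\<Phi> E" and "\<And>e e'. e \<epsilon> E \<Longrightarrow> e' \<epsilon> E \<Longrightarrow> cup e e' \<epsilon> E" for E
  proof -
    have "set_finite (Cup E)"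
      by (rule finite_Cup[OF that(1)]) (use that B(1) in \<open>auto simp: subset_def IP_family_def\<close>)
    then show ?thesis using B(1) unfolding IP_family_def \<Phi>_def by blast
  qed
  obtain B' Y where "IP_family B'" "subset B' B" "subset Y B'" "\<not> set_finite Y" "pairwise_disjoint Y"
    using greedy_subfamily[OF B(1) choice_rel_subset[OF K B(2)] d \<Phi>0 step] by blast
  then show ?thesis using B subset_trans unfolding subset_def by blast
next
  case True
  define \<Phi> where "\<Phi> E \<longleftrightarrow> subset E C \<and> some_large G (shifts C E)" for E
  have d: "definable1 \<Phi>" unfolding \<Phi>_def by (intro def_intros)
  have "some_large G C" unfolding some_large_def using True subset_refl by blast
  then have \<Phi>0: "\<Phi> empty" unfolding \<Phi>_def shifts_empty by (simp add: subset_def)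
  have step: "\<exists>b. b \<epsilon> G \<and> disj b (Cup E) \<and> \<Phi> (adjoin_sums E b)"
    if "set_finite E" "subset E G" and E: "\<Phi> E" and "\<And>e e'. e \<epsilon> E \<Longrightarrow> e' \<epsilon> E \<Longrightarrow> cup e e' \<epsilon> E" for E
  proof -
    obtain e where e: "e \<epsilon> shifts C E" "e \<epsilon> G" "some_large G (shift (shifts C E) e)"
      using some_large_shift_in[OF K] E unfolding \<Phi>_def by blast
    have "subset (adjoin_sums E e) C" using E e(1) unfolding \<Phi>_def subset_def by auto
    moreover have "some_large G (shifts C (adjoin_sums E e))" using some_large_mono[OF e(3) shift_shifts] .
    ultimately show ?thesis using e unfolding \<Phi>_def by auto
  qed
  obtain B Y where B: "IP_family B" "subset B G" "subset Y B" "\<not> set_finite Y" "pairwise_disjoint Y"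
    "\<And>e e'. e \<epsilon> B \<Longrightarrow> e' \<epsilon> B \<Longrightarrow> \<exists>E. e \<epsilon> E \<and> e' \<epsilon> E \<and> \<Phi> E"
    using greedy_subfamily[OF G K d \<Phi>0 step] by blast
  then show ?thesis unfolding \<Phi>_def subset_def by blast
qed

section \<open>From an endless chain to a monochromatic family\<close>

lemma endless_chain_covers:
  assumes U: "endless_chain U" and a: "set_finite a" and cov: "\<And>x. x \<epsilon> a \<Longrightarrow> x \<epsilon> Cup U"
  shows "\<exists>u. u \<epsilon> U \<and> subset a u"
proof -
  have "(\<forall>x. x \<epsilon> a \<longrightarrow> x \<epsilon> Cup U) \<longrightarrow> (\<exists>u. u \<epsilon> U \<and> subset a u)" using a
  proof (induction a rule: finite_induct)
    show "definable (\<lambda>s. (\<forall>x. x \<epsilon> s 0 \<longrightarrow> x \<epsilon> Cup U) \<longrightarrow> (\<exists>u. u \<epsilon> U \<and> subset (s 0) u))" by (intro def_intros)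
    show "(\<forall>x. x \<epsilon> empty \<longrightarrow> x \<epsilon> Cup U) \<longrightarrow> (\<exists>u. u \<epsilon> U \<and> subset empty u)"
      using U by (auto simp: endless_chain_def subset_def)
    fix a x assume IH: "(\<forall>x. x \<epsilon> a \<longrightarrow> x \<epsilon> Cup U) \<longrightarrow> (\<exists>u. u \<epsilon> U \<and> subset a u)"
    show "(\<forall>y. y \<epsilon> ins x a \<longrightarrow> y \<epsilon> Cup U) \<longrightarrow> (\<exists>u. u \<epsilon> U \<and> subset (ins x a) u)"
    proof
      assume *: "\<forall>y. y \<epsilon> ins x a \<longrightarrow> y \<epsilon> Cup U"
      then obtain u where u: "u \<epsilon> U" "subset a u" using IH by auto
      obtain v where v: "v \<epsilon> U" "x \<epsilon> v" using * by auto
      have "subset u v \<or> subset v u" using U u(1) v(1) unfolding endless_chain_def by blast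
      then have "subset (ins x a) v \<or> subset (ins x a) u" using u(2) v(2) by (auto simp: subset_def)
      then show "\<exists>u. u \<epsilon> U \<and> subset (ins x a) u" using u(1) v(1) by blast
    qed
  qed
  then show ?thesis using cov by blast
qed

text \<open>
  The chain cuts its union into finite blocks, the differences of consecutive members. The finite
  unions of blocks form an IP family, and although the points inside a block cannot be told
  apart, these unions can be well-ordered: compare two of them at the last block where they
  differ.
\<close>

lemma block_family:
  assumes U: "endless_chain U" and UX: "\<And>u. u \<epsilon> U \<Longrightarrow> subset u X"
  shows "\<exists>G K. IP_family G \<and> choice_rel K G \<and> subset G (Fin X)"
proof -
  \<comment> \<open>\<open>x\<close> enters the chain strictly before \<open>y\<close>; incomparable points lie in the same block.\<close>
  define before where "before x y \<longleftrightarrow> (\<exists>u. u \<epsilon> U \<and> x \<epsilon> u \<and> \<not> y \<epsilon> u)" for x y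
  have before_definable: "definable2 before" unfolding before_def by (intro def_intros)
  have lin: "subset u v \<or> subset v u" if "u \<epsilon> U" "v \<epsilon> U" for u v
    using U that unfolding endless_chain_def by blast
  have before_trans: "before x z" if "before x y" "before y z" for x y z
  proof -
    obtain u v where u: "u \<epsilon> U" "x \<epsilon> u" "\<not> y \<epsilon> u" "v \<epsilon> U" "y \<epsilon> v" "\<not> z \<epsilon> v"
      using \<open>before x y\<close> \<open>before y z\<close> unfolding before_def by blast
    then show ?thesis using lin[OF u(1,4)] unfolding before_def subset_def by blast
  qed
  have before_irrefl: "\<not> before x x" for x unfolding before_def by blast
  obtain G where G: "\<And>g. g \<epsilon> G \<longleftrightarrow> g \<epsilon> Fin X \<and> (g \<noteq> empty \<and> (\<forall>x. x \<epsilon> g \<longrightarrow> x \<epsilon> Cup U) \<and>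
      (\<forall>x y. x \<epsilon> g \<longrightarrow> \<not> before x y \<longrightarrow> \<not> before y x \<longrightarrow> y \<epsilon> g))"
    by (erule definable_setE) (intro def_intros def_subst2[OF before_definable])
  have satur: "y \<epsilon> g" if "g \<epsilon> G" "x \<epsilon> g" "\<not> before x y" "\<not> before y x" for g x y using that G by blast
  have GU: "x \<epsilon> Cup U" if "g \<epsilon> G" "x \<epsilon> g" for g x using that G by blast
  have Gfin: "set_finite g" if "g \<epsilon> G" for g using that G by simp
  have IP_family: "IP_family G"
    unfolding IP_family_def
  proof (intro conjI allI impI)
    show "b \<noteq> empty" "set_finite b" if "b \<epsilon> G" for b using that G by simp_all
  next
    fix b c assume bc: "b \<epsilon> G" "c \<epsilon> G"
    have "cup b c \<epsilon> Fin X" using bc G by (auto simp: subset_def)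
    moreover have "cup b c \<noteq> empty" using bc(1) G unfolding nonempty by auto
    moreover have "x \<epsilon> Cup U" if "x \<epsilon> cup b c" for x using that GU bc unfolding mem_cup by blast
    moreover have "y \<epsilon> cup b c" if "x \<epsilon> cup b c" "\<not> before x y" "\<not> before y x" for x y
      using that satur bc unfolding mem_cup by blast
    ultimately show "cup b c \<epsilon> G" using G by blast
  next
    fix T assume T: "set_finite T"
    \<comment> \<open>The double difference is the intersection of \<open>T\<close> with the union of the chain.\<close>
    have fin: "set_finite (diff T (diff T (Cup U)))" using T by simp
    have "x \<epsilon> Cup U" if "x \<epsilon> diff T (diff T (Cup U))" for x using that unfolding mem_diff by blast
    then obtain u where u: "u \<epsilon> U" "subset (diff T (diff T (Cup U))) u"
      using endless_chain_covers[OF U fin] by blast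
    obtain v where v: "v \<epsilon> U" "\<not> subset v u" using U u(1) unfolding endless_chain_def by blast
    have "diff v u \<epsilon> Fin X" using UX[OF v(1)] U v(1) by (auto simp: endless_chain_def subset_def)
    moreover have "diff v u \<noteq> empty" using v(2) unfolding nonempty subset_def by auto
    moreover have "x \<epsilon> Cup U" if "x \<epsilon> diff v u" for x using that v(1) unfolding mem_Cup mem_diff by blast
    moreover have "y \<epsilon> diff v u" if "x \<epsilon> diff v u" "\<not> before x y" "\<not> before y x" for x y
      using that u(1) v(1) unfolding before_def mem_diff by blast
    ultimately have "diff v u \<epsilon> G" using G by blast
    moreover have "disj (diff v u) T"
      using u(2) v(1) unfolding disj_def subset_def mem_diff mem_Cup by blast
    ultimately show "\<exists>b. b \<epsilon> G \<and> disj b T" by blast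
  qed
  \<comment> \<open>Lexicographic order, the latest block being the most significant.\<close>
  define lt where "lt g h \<longleftrightarrow> g \<epsilon> G \<and> h \<epsilon> G \<and>
    (\<exists>x. x \<epsilon> h \<and> \<not> x \<epsilon> g \<and> (\<forall>y. before x y \<longrightarrow> (y \<epsilon> g \<longleftrightarrow> y \<epsilon> h)))" for g h
  have lt_definable: "definable2 lt" unfolding lt_def by (intro def_intros def_subst2[OF before_definable])
  have lt_irrefl: "\<not> lt g g" for g unfolding lt_def by blast
  have lt_trans: "lt g k" if gh: "lt g h" and hk: "lt h k" for g h k
  proof -
    obtain x where x: "x \<epsilon> h" "\<not> x \<epsilon> g" "\<And>y. before x y \<Longrightarrow> y \<epsilon> g \<longleftrightarrow> y \<epsilon> h"
      using gh unfolding lt_def by blast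
    obtain x' where x': "x' \<epsilon> k" "\<not> x' \<epsilon> h" "\<And>y. before x' y \<Longrightarrow> y \<epsilon> h \<longleftrightarrow> y \<epsilon> k"
      using hk unfolding lt_def by blast
    have G3: "g \<epsilon> G" "h \<epsilon> G" "k \<epsilon> G" using gh hk unfolding lt_def by blast+
    consider "before x x'" | "before x' x" using satur[OF G3(2) x(1)] x'(2) by blast
    then show ?thesis
    proof cases
      case 1
      have "y \<epsilon> g \<longleftrightarrow> y \<epsilon> k" if "before x' y" for y using x(3)[OF before_trans[OF 1 that]] x'(3)[OF that] by simp
      moreover have "\<not> x' \<epsilon> g" using x(3)[OF 1] x'(2) by simp
      ultimately show ?thesis using x'(1) G3 unfolding lt_def by blast
    next
      case 2
      have "y \<epsilon> g \<longleftrightarrow> y \<epsilon> k" if "before x y" for y using x'(3)[OF before_trans[OF 2 that]] x(3)[OF that] by simp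
      moreover have "x \<epsilon> k" using x'(3)[OF 2] x(1) by simp
      ultimately show ?thesis using x(2) G3 unfolding lt_def by blast
    qed
  qed
  have lt_total: "g = h \<or> lt g h \<or> lt h g" if g: "g \<epsilon> G" and h: "h \<epsilon> G" for g h
  proof (cases "symdiff g h = empty")
    case True
    then have "\<not> x \<epsilon> symdiff g h" for x by simp
    then have "g = h" by (intro ext_eq) auto
    then show ?thesis ..
  next
    case False
    have fin: "set_finite (symdiff g h)" using Gfin g h by simp
    have d: "definable (\<lambda>s. before (s 1) (s 0))" by (intro def_subst2[OF before_definable] def_intros)
    have "\<exists>m. m \<epsilon> symdiff g h \<and> (\<forall>y. y \<epsilon> symdiff g h \<longrightarrow> \<not> before m y)"
      by (rule finite_minimal[where R = "\<lambda>a b. before b a", OF fin d False])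
        (blast intro: before_trans, rule before_irrefl)
    then obtain m where m: "m \<epsilon> symdiff g h" "\<And>y. y \<epsilon> symdiff g h \<Longrightarrow> \<not> before m y" by blast
    then have "y \<epsilon> g \<longleftrightarrow> y \<epsilon> h" if "before m y" for y using that by auto
    then show ?thesis using m(1) g h unfolding lt_def mem_symdiff by blast
  qed
  define K where "K A b \<longleftrightarrow> (\<forall>a. a \<epsilon> A \<longrightarrow> a = b \<or> lt b a)" for A b
  have K_definable: "definable2 K" unfolding K_def by (intro def_intros def_subst2[OF lt_definable])
  have "\<exists>!b. b \<epsilon> A \<and> K A b" if A: "subset A G" "A \<noteq> empty" for A
  proof -
    have AG: "a \<epsilon> G" if "a \<epsilon> A" for a using that A(1) by (simp add: subset_def)
    obtain a0 where a0: "a0 \<epsilon> A" using A(2) unfolding nonempty by blast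
    obtain u where u: "u \<epsilon> U" "subset a0 u"
      using endless_chain_covers[OF U Gfin[OF AG[OF a0]] GU[OF AG[OF a0]]] by blast
    have fu: "set_finite u" using U u(1) by (simp add: endless_chain_def)
    \<comment> \<open>Only finitely many members of \<open>A\<close> lie below the stage \<open>u\<close>, and all others come later in the order.\<close>
    obtain S where S: "\<And>a. a \<epsilon> S \<longleftrightarrow> a \<epsilon> A \<and> subset a u"
      by (erule definable_setE) (intro def_intros)
    have fS: "set_finite S" by (rule finite_subset[OF finite_Power[OF fu]]) (simp add: S)
    have S_ne: "S \<noteq> empty" using S a0 u(2) unfolding nonempty by blast
    have "\<exists>b. b \<epsilon> S \<and> (\<forall>a. a \<epsilon> S \<longrightarrow> \<not> lt a b)"
      by (rule finite_minimal[OF fS lt_definable S_ne]) (blast intro: lt_trans, rule lt_irrefl)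
    then obtain b where b: "b \<epsilon> S" "\<And>a. a \<epsilon> S \<Longrightarrow> \<not> lt a b" by blast
    have bA: "b \<epsilon> A" "subset b u" using b(1) S by simp_all
    have "a = b \<or> lt b a" if a: "a \<epsilon> A" for a
    proof (cases "subset a u")
      case True
      then show ?thesis using b(2)[of a] S a lt_total[OF AG[OF a] AG[OF bA(1)]] by blast
    next
      case False
      then obtain y where y: "y \<epsilon> a" "\<not> y \<epsilon> u" unfolding subset_def by blast
      have "\<not> lt a b"
      proof
        assume "lt a b"
        then obtain x where x: "x \<epsilon> b" "\<And>y. before x y \<Longrightarrow> y \<epsilon> a \<longleftrightarrow> y \<epsilon> b" unfolding lt_def by blast
        have "before x y" using x(1) bA(2) u(1) y(2) unfolding before_def subset_def by blast
        then show False using x(2) y bA(2) unfolding subset_def by blast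
      qed
      then show ?thesis using lt_total[OF AG[OF a] AG[OF bA(1)]] by blast
    qed
    then have "K A b" unfolding K_def by blast
    moreover have "b' = b" if "b' \<epsilon> A" "K A b'" for b'
      using that bA(1) \<open>K A b\<close> lt_trans lt_irrefl unfolding K_def by metis
    ultimately show ?thesis using bA(1) by blast
  qed
  then have "choice_rel K G" unfolding choice_rel_def using K_definable by blast
  moreover have "subset G (Fin X)" using G by (simp add: subset_def)
  ultimately show ?thesis using IP_family by blast
qed

text \<open>
  The theorem of Hindman for the blocks of an endless chain, applied to one colour class.
\<close>

lemma D_infinite_imp_monochromatic:
  assumes X: "\<not> D_finite (Fin X)" and c: "coloring X c"
  shows "\<exists>Y. subset Y (Fin X) \<and> \<not> set_finite Y \<and> pairwise_disjoint Y \<and> monochromatic c (FS X Y)"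
proof -
  obtain U where U: "endless_chain U" "\<And>u. u \<epsilon> U \<Longrightarrow> subset u X" using D_infinite_imp_endless_chain[OF X] by blast
  obtain G K where G: "IP_family G" "choice_rel K G" "subset G (Fin X)" using block_family[OF U] by blast
  have c: "func c (Fin X) (numeral_set 2)" using c by (simp add: coloring_def)
  obtain C where C: "\<And>x. x \<epsilon> C \<longleftrightarrow> x \<epsilon> Fin X \<and> opair x empty \<epsilon> c"
    by (erule definable_setE) (intro def_intros)
  obtain B Y where B: "IP_family B" "subset B G"
    and mono: "(\<forall>b. b \<epsilon> B \<longrightarrow> b \<epsilon> C) \<or> (\<forall>b. b \<epsilon> B \<longrightarrow> \<not> b \<epsilon> C)"
    and Y: "subset Y B" "\<not> set_finite Y" "pairwise_disjoint Y"
    using hindman[OF G(1,2)] by blast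
  have BX: "b \<epsilon> Fin X" if "b \<epsilon> B" for b using that B(2) G(3) unfolding subset_def by blast
  have val: "app c b = (if b \<epsilon> C then empty else succ empty)" if "b \<epsilon> B" for b
  proof -
    have "app c b = empty \<longleftrightarrow> b \<epsilon> C" using app_eq[OF c BX[OF that]] C BX[OF that] by simp
    moreover have "app c b = empty \<or> app c b = succ empty"
      using app_mem[OF c BX[OF that]] by (auto simp: numeral_2_eq_2)
    ultimately show ?thesis by auto
  qed
  have FS: "z \<epsilon> B" if z: "z \<epsilon> FS X Y" for z
  proof -
    obtain F where F: "subset F Y" "F \<noteq> empty" "is_sum X F z" using z unfolding mem_FS by blast
    have "pairwise_disjoint F" using Y(3) F(1) unfolding pairwise_disjoint_def subset_def by blast
    moreover have "cup u v \<epsilon> B" if "u \<epsilon> B" "v \<epsilon> B" "disj u v" for u v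
      using B(1) that unfolding IP_family_def by blast
    ultimately show ?thesis using is_sum_closed[OF F(3,2) subset_trans[OF F(1) Y(1)]] by blast
  qed
  have "app c u = app c v" if "u \<epsilon> B" "v \<epsilon> B" for u v using val[OF that(1)] val[OF that(2)] mono that by auto
  then have "monochromatic c (FS X Y)" unfolding monochromatic_def using FS by blast
  moreover have "subset Y (Fin X)" using Y(1) BX by (auto simp: subset_def[of Y])
  ultimately show ?thesis using Y by blast
qed

text \<open>
  The sums of at most \<open>n\<close> members are among all finite sums, so the single monochromatic family of
  the previous lemma refutes all three Hindman-finiteness properties at once.
\<close>

lemma equivalences:
  "(HD_finite X \<longleftrightarrow> D_finite (Fin X)) \<and> (D_finite (Fin X) \<longleftrightarrow> HD_n_finite (numeral_set 2) X) \<and>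
   (HD_n_finite (numeral_set 2) X \<longleftrightarrow> HB_n_finite (numeral_set 4) X)"
proof -
  have FS_le: "monochromatic c (FS_le n X Y)" if "monochromatic c (FS X Y)" for c n Y
    using that FS_le_FS by (rule monochromatic_mono)
  have 1: "D_finite (Fin X)"
    if "HD_finite X \<or> HD_n_finite (numeral_set 2) X \<or> HB_n_finite (numeral_set 4) X"
  proof (rule ccontr)
    assume "\<not> D_finite (Fin X)"
    then have "\<exists>Y. subset Y (Fin X) \<and> \<not> set_finite Y \<and> pairwise_disjoint Y \<and> monochromatic c (FS X Y)"
      if "coloring X c" for c using D_infinite_imp_monochromatic that by blast
    then show False using that FS_le unfolding HD_finite_def HD_n_finite_def HB_n_finite_def by blast
  qed
  have 2: "HD_n_finite (numeral_set 2) X" "HB_n_finite (numeral_set 4) X" if "D_finite (Fin X)"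
    using D_finite_imp_HD2[OF that] D_finite_imp_HB4[OF that] unfolding HD_n_finite_def HB_n_finite_def by blast+
  have "HD_finite X" if "HD_n_finite (numeral_set 2) X"
    using that FS_le unfolding HD_finite_def HD_n_finite_def by blast
  then show ?thesis using 1 2 by blast
qed

end

theorem theorem3p2:
  fixes mem :: "'a \<Rightarrow> 'a \<Rightarrow> bool" and X :: 'a
  assumes "ZF_model mem"
  shows "(membership.HD_finite mem X \<longleftrightarrow>
            membership.D_finite mem (membership.Fin mem X)) \<and>
         (membership.D_finite mem (membership.Fin mem X) \<longleftrightarrow>
            membership.HD_n_finite mem (membership.numeral_set mem 2) X) \<and>
         (membership.HD_n_finite mem (membership.numeral_set mem 2) X \<longleftrightarrow>
            membership.HB_n_finite mem (membership.numeral_set mem 4) X)"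
  by (rule ZF_model.equivalences[OF assms])

end
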